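(* Every bicyclic graph is extra-good.
   Context: All graphs are finite and simple; $V(G)$, $E(G)$ are the vertex and edge sets, $\mathrm{v}(G)=|V(G)|$, $\mathrm{e}(G)=|E(G)|$. A connected graph $G$ is bicyclic if $\mathrm{e}(G)=\mathrm{v}(G)+1$. $\mu$ is Lebesgue measure on $[0,1]$. $\mathcal{H}$ is the space of bounded measurable real functions on $[0,1]^2$. A bounded measurable nonnegative symmetric function $g$ on $[0,1]^2$ is called doubly nonnegative if there is $h\in\mathcal{H}$ (possibly taking negative values) with $g(x,y)=\int_{[0,1]}h(x,z)h(y,z)\,d\mu(z)$ for (almost) all $x,y$. A graph $G$ with vertices $v_1,\dots,v_n$, $n=\mathrm{v}(G)$, and at least one edge is called extra-good if for every doubly nonnegative function $g$ and all bounded measurable nonnegative functions $f_1,\dots,f_n$ on $[0,1]$, $$\int_{[0,1]^n}\prod_{\{v_i,v_j\}\in E(G)}g(x_i,x_j)\prod_{i=1}^n f_i(x_i)\,d\mu^n\;\ge\;\Big(\int_{[0,1]^2}f(x)g(x,y)f(y)\,d\mu^2\Big)^{\mathrm{e}(G)},$$ where $f(x)=\big(\prod_{i=1}^n f_i(x)\big)^{1/(2\mathrm{e}(G))}$. *)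

theory Defs
  imports "HOL-Analysis.Analysis"
begin

definition simple_graph :: "'a set \<Rightarrow> 'a set set \<Rightarrow> bool" where
  "simple_graph V E \<longleftrightarrow> finite V \<and> (\<forall>e\<in>E. e \<subseteq> V \<and> card e = 2)"

definition connected_graph :: "'a set \<Rightarrow> 'a set set \<Rightarrow> bool" where
  "connected_graph V E \<longleftrightarrow>
     simple_graph V E \<and> V \<noteq> {} \<and> (\<forall>u\<in>V. \<forall>v\<in>V. (u, v) \<in> {(a, b). {a, b} \<in> E}\<^sup>*)"

definition bicyclic :: "'a set \<Rightarrow> 'a set set \<Rightarrow> bool" where
  "bicyclic V E \<longleftrightarrow> connected_graph V E \<and> card E = card V + 1"

definition unit_interval :: "real measure" where
  "unit_interval = lebesgue_on {0..1}"

text \<open>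
  The library product of copies of Lebesgue measure is not complete. Completing it yields Lebesgue
  measure on the square and on the cube, so that measurable functions on these are the
  Lebesgue measurable ones.
\<close>

definition unit_square :: "(real \<times> real) measure" where
  "unit_square = completion (unit_interval \<Otimes>\<^sub>M unit_interval)"

definition unit_cube :: "'a set \<Rightarrow> ('a \<Rightarrow> real) measure" where
  "unit_cube V = completion (\<Pi>\<^sub>M v\<in>V. unit_interval)"

definition bounded_measurable :: "'a measure \<Rightarrow> ('a \<Rightarrow> real) \<Rightarrow> bool" where
  "bounded_measurable M f \<longleftrightarrow> f \<in> borel_measurable M \<and> bounded (f ` space M)"

text \<open>
  For Lebesgue measurable \<open>h\<close> the inner integral below exists only for almost all \<open>(x, y)\<close>.
\<close>

definition doubly_nonnegative :: "(real \<times> real \<Rightarrow> real) \<Rightarrow> bool" where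
  "doubly_nonnegative g \<longleftrightarrow>
     bounded_measurable unit_square g \<and>
     (\<forall>x\<in>{0..1}. \<forall>y\<in>{0..1}. 0 \<le> g (x, y) \<and> g (x, y) = g (y, x)) \<and>
     (\<exists>h. bounded_measurable unit_square h \<and>
        (AE (x, y) in unit_square. g (x, y) = (\<integral>z. h (x, z) * h (y, z) \<partial>unit_interval)))"

text \<open>
  \<open>edge_val g x {u, v} = g (x u, x v)\<close>. The order in which the endpoints of the edge are
  listed is immaterial as \<open>g\<close> is symmetric.
\<close>

definition edge_val :: "(real \<times> real \<Rightarrow> real) \<Rightarrow> ('a \<Rightarrow> real) \<Rightarrow> 'a set \<Rightarrow> real" where
  "edge_val g x e = (let (u, v) = (SOME (u, v). e = {u, v}) in g (x u, x v))"

text \<open>The vertices themselves serve as indices of the variables and of the vertex weights.\<close>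

definition extra_good :: "'a set \<Rightarrow> 'a set set \<Rightarrow> bool" where
  "extra_good V E \<longleftrightarrow>
     simple_graph V E \<and> E \<noteq> {} \<and>
     (\<forall>g f. doubly_nonnegative g \<longrightarrow>
        (\<forall>v\<in>V. bounded_measurable unit_interval (f v) \<and> (\<forall>t\<in>{0..1}. 0 \<le> f v t)) \<longrightarrow>
        (let F = (\<lambda>t. (\<Prod>v\<in>V. f v t) powr (1 / (2 * real (card E))))
         in (\<integral>x. (\<Prod>e\<in>E. edge_val g x e) * (\<Prod>v\<in>V. f v (x v)) \<partial>unit_cube V)
            \<ge> (\<integral>(x, y). F x * g (x, y) * F y \<partial>unit_square) ^ card E))"

end

theory Submission
  imports Defs "HOL-Probability.Probability"
begin

text \<open>
  Let \<open>Z\<close> be the integral on the right hand side and consider the probability density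
  \<open>K(x, y) = F(x) g(x, y) F(y) / Z\<close> with marginal \<open>\<rho>\<close>. For the weights \<open>w\<^sub>v = f\<^sub>v / F ^ deg v\<close>, whose product is
  one, the assertion becomes \<open>\<integral> \<Prod>K \<Prod>w\<^sub>v \<ge> 1\<close>. It is a special case of
  \<open>\<integral> \<Prod>K \<Prod>w\<^sub>v \<ge> exp (\<Sum>\<^sub>v \<integral> \<rho> ln w\<^sub>v)\<close> for arbitrary positive weights, the property \<open>good\<close> below.

  In this form the inequality passes from two graphs to the graph obtained by identifying a vertex of one with
  a vertex of the other (\<open>good_glue\<close>). It holds for any number of internally disjoint paths between two vertices
  (\<open>good_theta\<close>): averaging over the exchange of the two ends makes the weights along each path
  symmetric. Since \<open>g\<close> is a Gram kernel, the Cauchy-Schwarz inequality then cuts every path in its middle, at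
  a vertex or within an edge, and what remains is the square of the integral of a tree, which is bounded below by
  Jensen's inequality (\<open>parallel_paths\<close>).

  Every bicyclic graph arises from such graphs by gluing (\<open>bicyclic_member\<close>): single edges provide the
  pendant trees and connecting paths, two parallel paths form a cycle, three a theta graph.

  Logarithms require everything to be bounded away from \<open>0\<close>. This is arranged by adding a small constant
  to the kernel, which remains a Gram kernel, and to the weights (\<open>nonneg_inequality\<close>).
\<close>

section \<open>Bounded positive weights\<close>

text \<open>Both bounds are required, so that logarithms of weights are bounded and every integral below exists
  for trivial reasons.\<close>

definition pos_weight :: "'b measure \<Rightarrow> ('b \<Rightarrow> real) \<Rightarrow> bool" where
  "pos_weight M f \<longleftrightarrow> f \<in> borel_measurable M \<and> (\<exists>c>0. \<exists>C. \<forall>x\<in>space M. c \<le> f x \<and> f x \<le> C)"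

lemma bounded_measurable_iff:
  "bounded_measurable M f \<longleftrightarrow> f \<in> borel_measurable M \<and> (\<exists>C. \<forall>x\<in>space M. \<bar>f x\<bar> \<le> C)"
  unfolding bounded_measurable_def bounded_iff by auto

lemma bounded_measurable_measurable [measurable_dest]:
  "bounded_measurable M f \<Longrightarrow> f \<in> borel_measurable M"
  by (simp add: bounded_measurable_def)

lemma bounded_measurableE:
  assumes "bounded_measurable M f"
  obtains C where "C > 0" "\<And>x. x \<in> space M \<Longrightarrow> \<bar>f x\<bar> \<le> C"
proof -
  obtain C where C: "\<forall>x\<in>space M. \<bar>f x\<bar> \<le> C"
    using assms unfolding bounded_measurable_iff by blast
  show ?thesis
  proof (rule that[of "\<bar>C\<bar> + 1"])
    fix x assume "x \<in> space M"
    with C show "\<bar>f x\<bar> \<le> \<bar>C\<bar> + 1" by force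
  qed simp
qed

lemma bounded_measurableI:
  "f \<in> borel_measurable M \<Longrightarrow> (\<And>x. x \<in> space M \<Longrightarrow> \<bar>f x\<bar> \<le> C) \<Longrightarrow> bounded_measurable M f"
  unfolding bounded_measurable_iff by blast

lemma pos_weight_measurable [measurable_dest]: "pos_weight M f \<Longrightarrow> f \<in> borel_measurable M"
  by (simp add: pos_weight_def)

lemma pos_weightI:
  "f \<in> borel_measurable M \<Longrightarrow> c > 0 \<Longrightarrow> (\<And>x. x \<in> space M \<Longrightarrow> c \<le> f x) \<Longrightarrow>
    (\<And>x. x \<in> space M \<Longrightarrow> f x \<le> C) \<Longrightarrow> pos_weight M f"
  unfolding pos_weight_def by blast

lemma pos_weightE:
  assumes "pos_weight M f"
  obtains c C where "c > 0" "C > 0" "\<And>x. x \<in> space M \<Longrightarrow> c \<le> f x" "\<And>x. x \<in> space M \<Longrightarrow> f x \<le> C"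
proof -
  obtain c C where "c > 0" "\<forall>x\<in>space M. c \<le> f x \<and> f x \<le> C"
    using assms unfolding pos_weight_def by blast
  then show ?thesis
    by (intro that[of c "max C 1"]) (auto simp: le_max_iff_disj)
qed

lemma pos_weight_pos: "pos_weight M f \<Longrightarrow> x \<in> space M \<Longrightarrow> 0 < f x"
  by (meson less_le_trans pos_weightE)

lemma pos_weight_bounded: "pos_weight M f \<Longrightarrow> bounded_measurable M f"
  by (smt (verit) bounded_measurableI pos_weightE pos_weight_measurable)

lemma pos_weight_const: "c > 0 \<Longrightarrow> pos_weight M (\<lambda>x. c)"
  by (rule pos_weightI) auto

lemma pos_weight_mult:
  assumes "pos_weight M f" "pos_weight M g" shows "pos_weight M (\<lambda>x. f x * g x)"
proof -
  obtain c C where 1: "c > 0" "C > 0" "\<And>x. x \<in> space M \<Longrightarrow> c \<le> f x" "\<And>x. x \<in> space M \<Longrightarrow> f x \<le> C"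
    using assms(1) by (rule pos_weightE) blast
  obtain d D where 2: "d > 0" "D > 0" "\<And>x. x \<in> space M \<Longrightarrow> d \<le> g x" "\<And>x. x \<in> space M \<Longrightarrow> g x \<le> D"
    using assms(2) by (rule pos_weightE) blast
  show ?thesis
  proof (rule pos_weightI[of _ _ "c * d" "C * D"])
    fix x assume x: "x \<in> space M"
    show "c * d \<le> f x * g x"
      using 1(1,3) 2(1,3) x by (intro mult_mono) (auto intro: order_trans less_imp_le)
    show "f x * g x \<le> C * D"
      using 1 2 x by (intro mult_mono) (auto intro: order_trans[OF _ 1(3)] order_trans[OF _ 2(3)] less_imp_le)
  qed (use assms 1 2 in auto)
qed

lemma pos_weight_inverse:
  assumes "pos_weight M f" shows "pos_weight M (\<lambda>x. inverse (f x))"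
proof -
  obtain c C where 1: "c > 0" "C > 0" "\<And>x. x \<in> space M \<Longrightarrow> c \<le> f x" "\<And>x. x \<in> space M \<Longrightarrow> f x \<le> C"
    using assms(1) by (rule pos_weightE) blast
  show ?thesis
    by (rule pos_weightI[of _ _ "inverse C" "inverse c"])
       (use assms 1 in \<open>auto intro!: le_imp_inverse_le intro: less_le_trans\<close>)
qed

lemma pos_weight_divide:
  "pos_weight M f \<Longrightarrow> pos_weight M g \<Longrightarrow> pos_weight M (\<lambda>x. f x / g x)"
  unfolding divide_inverse by (intro pos_weight_mult pos_weight_inverse)

lemma pos_weight_powr:
  assumes "pos_weight M f" "a \<ge> 0" shows "pos_weight M (\<lambda>x. f x powr a)"
proof -
  obtain c C where 1: "c > 0" "C > 0" "\<And>x. x \<in> space M \<Longrightarrow> c \<le> f x" "\<And>x. x \<in> space M \<Longrightarrow> f x \<le> C"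
    using assms(1) by (rule pos_weightE) blast
  show ?thesis
  proof (rule pos_weightI[of _ _ "c powr a" "C powr a"])
    fix x assume x: "x \<in> space M"
    show "c powr a \<le> f x powr a" "f x powr a \<le> C powr a"
      using 1(1,2) 1(3,4)[OF x] assms(2) by (auto intro!: powr_mono2)
  qed (use assms 1 in auto)
qed

lemma pos_weight_sqrt:
  assumes "pos_weight M f" shows "pos_weight M (\<lambda>x. sqrt (f x))"
proof -
  obtain c C where 1: "c > 0" "C > 0" "\<And>x. x \<in> space M \<Longrightarrow> c \<le> f x" "\<And>x. x \<in> space M \<Longrightarrow> f x \<le> C"
    using assms(1) by (rule pos_weightE) blast
  show ?thesis
    by (rule pos_weightI[of _ _ "sqrt c" "sqrt C"]) (use assms 1 in auto)
qed

lemma pos_weight_prod: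
  "(\<And>i. i \<in> I \<Longrightarrow> pos_weight M (f i)) \<Longrightarrow> pos_weight M (\<lambda>x. \<Prod>i\<in>I. f i x)"
  by (induction I rule: infinite_finite_induct) (auto intro: pos_weight_const pos_weight_mult)

lemma pos_weight_power: "pos_weight M f \<Longrightarrow> pos_weight M (\<lambda>x. f x ^ n)"
  by (induction n) (auto intro: pos_weight_const pos_weight_mult)

lemma pos_weight_comp:
  assumes "pos_weight M f" "T \<in> measurable N M" shows "pos_weight N (\<lambda>x. f (T x))"
proof -
  obtain c C where 1: "c > 0" "C > 0" "\<And>x. x \<in> space M \<Longrightarrow> c \<le> f x" "\<And>x. x \<in> space M \<Longrightarrow> f x \<le> C"
    using assms(1) by (rule pos_weightE) blast
  show ?thesis
    using assms 1 measurable_space[OF assms(2)] measurable_compose[OF assms(2), of f borel]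
    by (intro pos_weightI[of _ _ c C]) auto
qed

lemma bounded_measurable_comp:
  assumes "bounded_measurable M f" "T \<in> measurable N M" shows "bounded_measurable N (\<lambda>x. f (T x))"
proof -
  obtain C where 1: "C > 0" "\<And>x. x \<in> space M \<Longrightarrow> \<bar>f x\<bar> \<le> C"
    using assms(1) by (rule bounded_measurableE) blast
  show ?thesis
    using assms 1 measurable_space[OF assms(2)] measurable_compose[OF assms(2), of f borel]
    by (intro bounded_measurableI[of _ _ C]) auto
qed

lemma bounded_measurable_mult:
  assumes "bounded_measurable M f" "bounded_measurable M g"
  shows "bounded_measurable M (\<lambda>x. f x * g x)"
proof -
  obtain C where 1: "C > 0" "\<And>x. x \<in> space M \<Longrightarrow> \<bar>f x\<bar> \<le> C"
    using assms(1) by (rule bounded_measurableE) blast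
  obtain D where 2: "D > 0" "\<And>x. x \<in> space M \<Longrightarrow> \<bar>g x\<bar> \<le> D"
    using assms(2) by (rule bounded_measurableE) blast
  show ?thesis
    by (rule bounded_measurableI[of _ _ "C * D"])
       (use assms 1 2 in \<open>auto simp: abs_mult intro!: mult_mono intro: less_imp_le\<close>)
qed

context prob_space begin

lemma bounded_integrable:
  assumes f: "bounded_measurable M f" shows "integrable M f"
proof -
  obtain C where "\<And>x. x \<in> space M \<Longrightarrow> \<bar>f x\<bar> \<le> C"
    using f by (rule bounded_measurableE) blast
  then show ?thesis
    using f by (intro integrable_const_bound[of _ C]) (auto intro!: AE_I2)
qed

lemma pos_weight_integrable: "pos_weight M f \<Longrightarrow> integrable M f"
  by (intro bounded_integrable pos_weight_bounded)

lemma pos_weight_integral_pos: assumes "pos_weight M f" shows "0 < integral\<^sup>L M f"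
proof -
  obtain c C where 1: "c > 0" "\<And>x. x \<in> space M \<Longrightarrow> c \<le> f x"
    using assms(1) by (rule pos_weightE) blast
  have "c \<le> integral\<^sup>L M f"
    using 1 assms by (intro integral_ge_const pos_weight_integrable AE_I2) auto
  with 1 show ?thesis by linarith
qed

lemma pos_weight_integral:
  assumes "pos_weight (N \<Otimes>\<^sub>M M) f" shows "pos_weight N (\<lambda>x. \<integral>y. f (x, y) \<partial>M)"
proof -
  obtain c C where 1: "c > 0" "C > 0" "\<And>x. x \<in> space (N \<Otimes>\<^sub>M M) \<Longrightarrow> c \<le> f x"
       "\<And>x. x \<in> space (N \<Otimes>\<^sub>M M) \<Longrightarrow> f x \<le> C"
    using assms(1) by (rule pos_weightE) blast
  have i: "integrable M (\<lambda>y. f (x, y))" if "x \<in> space N" for x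
    by (rule pos_weight_integrable) (use assms that in \<open>auto intro: pos_weight_comp\<close>)
  show ?thesis
  proof (rule pos_weightI[of _ _ c C])
    show "(\<lambda>x. \<integral>y. f (x, y) \<partial>M) \<in> borel_measurable N"
      using pos_weight_measurable[OF assms] by (intro borel_measurable_lebesgue_integral) simp
    fix x assume "x \<in> space N"
    then show "c \<le> (\<integral>y. f (x, y) \<partial>M)" "(\<integral>y. f (x, y) \<partial>M) \<le> C"
      using i[of x] 1(3,4)
      by (auto intro!: integral_ge_const integral_le_const AE_I2 simp: space_pair_measure)
  qed (use 1 in auto)
qed

lemma bounded_measurable_integral:
  assumes "bounded_measurable (N \<Otimes>\<^sub>M M) f" shows "bounded_measurable N (\<lambda>x. \<integral>y. f (x, y) \<partial>M)"
proof -
  obtain C where 1: "C > 0" "\<And>x. x \<in> space (N \<Otimes>\<^sub>M M) \<Longrightarrow> \<bar>f x\<bar> \<le> C"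
    using assms(1) by (rule bounded_measurableE) blast
  show ?thesis
  proof (rule bounded_measurableI[of _ _ C])
    show "(\<lambda>x. \<integral>y. f (x, y) \<partial>M) \<in> borel_measurable N"
      using bounded_measurable_measurable[OF assms] by (intro borel_measurable_lebesgue_integral) simp
    fix x assume "x \<in> space N"
    then have "bounded_measurable M (\<lambda>y. f (x, y))"
      using assms by (auto intro: bounded_measurable_comp)
    then have i: "integrable M (\<lambda>y. f (x, y))" by (rule bounded_integrable)
    have b: "\<bar>f (x, y)\<bar> \<le> C" if "y \<in> space M" for y
      using 1 that \<open>x \<in> space N\<close> by (auto simp: space_pair_measure)
    have "\<bar>\<integral>y. f (x, y) \<partial>M\<bar> \<le> (\<integral>y. \<bar>f (x, y)\<bar> \<partial>M)" by (rule integral_abs_bound)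
    also have "\<dots> \<le> C"
      using i b by (intro integral_le_const AE_I2) auto
    finally show "\<bar>\<integral>y. f (x, y) \<partial>M\<bar> \<le> C" .
  qed
qed

text \<open>The inequality of arithmetic and geometric means, applied to \<open>t * a\<close> and \<open>b / t\<close> with the \<open>t\<close> for
  which these two have the same integral.\<close>

lemma cauchy_schwarz_sqrt:
  assumes a: "pos_weight M a" and b: "pos_weight M b"
  shows "(\<integral>x. sqrt (a x * b x) \<partial>M) \<le> sqrt (integral\<^sup>L M a * integral\<^sup>L M b)"
proof -
  define A where "A = integral\<^sup>L M a"
  define B where "B = integral\<^sup>L M b"
  have pos: "A > 0" "B > 0" unfolding A_def B_def using assms by (auto intro: pos_weight_integral_pos)
  define t where "t = sqrt (B / A)"
  have t: "t > 0" "t\<^sup>2 = B / A" unfolding t_def using pos by auto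
  have "(\<integral>x. sqrt (a x * b x) \<partial>M) \<le> (\<integral>x. (t * a x + b x / t) / 2 \<partial>M)"
  proof (rule integral_mono_AE)
    show "integrable M (\<lambda>x. sqrt (a x * b x))"
      using assms by (intro pos_weight_integrable pos_weight_sqrt pos_weight_mult)
    show "integrable M (\<lambda>x. (t * a x + b x / t) / 2)"
      using a b pos_weight_integrable by simp
    show "AE x in M. sqrt (a x * b x) \<le> (t * a x + b x / t) / 2"
    proof (rule AE_I2)
      fix x assume x: "x \<in> space M"
      have p: "a x > 0" "b x > 0" using assms x by (auto dest: pos_weight_pos)
      show "sqrt (a x * b x) \<le> (t * a x + b x / t) / 2"
        using arith_geo_mean_sqrt[of "t * a x" "b x / t"] p t by (simp add: field_simps)
    qed
  qed
  also have "\<dots> = (t * A + B / t) / 2"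
    using assms by (simp add: A_def B_def pos_weight_integrable)
  also have "t * A = sqrt (A * B)"
    using pos unfolding t_def by (simp add: real_sqrt_divide real_sqrt_mult field_simps)
  also have "B / t = sqrt (A * B)"
    using pos unfolding t_def by (simp add: real_sqrt_divide real_sqrt_mult field_simps)
  finally show ?thesis by (simp add: A_def B_def)
qed

text \<open>Bessel's inequality for a single unit vector: expand the square of \<open>f - c s\<close>, where \<open>c\<close> is the
  coefficient of \<open>f\<close> along \<open>s\<close>.\<close>

lemma cauchy_schwarz_unit:
  assumes f: "bounded_measurable M f" and s: "bounded_measurable M s" and 1: "(\<integral>x. (s x)\<^sup>2 \<partial>M) = 1"
  shows "(\<integral>x. f x * s x \<partial>M)\<^sup>2 \<le> (\<integral>x. (f x)\<^sup>2 \<partial>M)"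
proof -
  define c where "c = (\<integral>x. f x * s x \<partial>M)"
  have i: "integrable M (\<lambda>x. (f x)\<^sup>2)" "integrable M (\<lambda>x. (s x)\<^sup>2)" "integrable M (\<lambda>x. f x * s x)"
    unfolding power2_eq_square using f s by (auto intro!: bounded_integrable bounded_measurable_mult)
  have "0 \<le> (\<integral>x. (f x - c * s x)\<^sup>2 \<partial>M)" by simp
  also have "\<dots> = (\<integral>x. (f x)\<^sup>2 - 2 * c * (f x * s x) + c\<^sup>2 * (s x)\<^sup>2 \<partial>M)"
    by (intro Bochner_Integration.integral_cong) (auto simp: power2_eq_square algebra_simps)
  also have "\<dots> = (\<integral>x. (f x)\<^sup>2 \<partial>M) - 2 * c * c + c\<^sup>2 * 1"
    using i by (simp add: 1 c_def)
  finally show ?thesis unfolding c_def[symmetric] by (simp add: power2_eq_square)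
qed

end

section \<open>Gram kernels and rank-one lower bounds\<close>

text \<open>\<open>\<kappa>\<close> is the Gram kernel of the vectors \<open>Q (x, \<cdot>)\<close> in the Hilbert space over \<open>N\<close>, and \<open>L\<close> is their
  coordinate along the unit vector \<open>s\<close>. Hence \<open>\<kappa>\<close> exceeds the rank-one kernel \<open>L(x) L(y)\<close> by a positive
  semidefinite one.\<close>

definition factors :: "'b measure \<Rightarrow> 'c measure \<Rightarrow> ('b \<times> 'b \<Rightarrow> real) \<Rightarrow> ('b \<Rightarrow> real) \<Rightarrow> bool" where
  "factors M N \<kappa> L \<longleftrightarrow> prob_space N \<and> (\<exists>Q s. bounded_measurable (M \<Otimes>\<^sub>M N) Q \<and>
     bounded_measurable N s \<and> (\<integral>z. (s z)\<^sup>2 \<partial>N) = 1 \<and>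
     (AE p in M \<Otimes>\<^sub>M M. \<kappa> p = (\<integral>z. Q (fst p, z) * Q (snd p, z) \<partial>N)) \<and>
     (AE x in M. L x = (\<integral>z. Q (x, z) * s z \<partial>N)))"

text \<open>The positive semidefinite order \<open>\<kappa> \<ge> L \<otimes> L\<close>, expressed by quadratic forms.\<close>

definition dominates :: "'b measure \<Rightarrow> ('b \<times> 'b \<Rightarrow> real) \<Rightarrow> ('b \<Rightarrow> real) \<Rightarrow> bool" where
  "dominates M \<kappa> L \<longleftrightarrow> (\<forall>D. bounded_measurable M D \<longrightarrow>
     (\<integral>x. D x * L x \<partial>M)\<^sup>2 \<le> (\<integral>p. D (fst p) * \<kappa> p * D (snd p) \<partial>(M \<Otimes>\<^sub>M M)))"

lemma integral_pair_mult:
  fixes f g :: "'b \<Rightarrow> real"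
  assumes "prob_space M" "bounded_measurable M f" "bounded_measurable M g"
  shows "(\<integral>p. f (fst p) * g (snd p) \<partial>(M \<Otimes>\<^sub>M M)) = integral\<^sup>L M f * integral\<^sup>L M g"
proof -
  interpret prob_space M by fact
  interpret P: pair_prob_space M M ..
  have "bounded_measurable (M \<Otimes>\<^sub>M M) (\<lambda>p. f (fst p) * g (snd p))"
    using assms(2,3) by (auto intro!: bounded_measurable_mult bounded_measurable_comp[of M _ fst] bounded_measurable_comp[of M _ snd])
  then have "integrable (M \<Otimes>\<^sub>M M) (\<lambda>p. f (fst p) * g (snd p))"
    by (rule P.bounded_integrable)
  then have "(\<integral>p. f (fst p) * g (snd p) \<partial>(M \<Otimes>\<^sub>M M)) = (\<integral>x. \<integral>y. f x * g y \<partial>M \<partial>M)"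
    by (subst P.integral_fst'[symmetric]) auto
  then show ?thesis by simp
qed

lemma dominates_one:
  assumes "prob_space M" shows "dominates M (\<lambda>_. 1) (\<lambda>_. 1)"
  unfolding dominates_def
  using integral_pair_mult[OF assms] by (auto simp: power2_eq_square)

text \<open>Fubini's theorem turns the pairing of a Gram kernel with \<open>\<psi>\<close> into an average of quadratic forms of \<open>\<psi>\<close>.\<close>

lemma integral_factorisation:
  assumes M: "prob_space M" and N: "prob_space N" and Q: "bounded_measurable (M \<Otimes>\<^sub>M N) Q"
    and \<kappa>: "bounded_measurable (M \<Otimes>\<^sub>M M) \<kappa>"
    and AE: "AE p in M \<Otimes>\<^sub>M M. \<kappa> p = (\<integral>z. Q (fst p, z) * Q (snd p, z) \<partial>N)"
    and \<psi>: "bounded_measurable (M \<Otimes>\<^sub>M M) \<psi>"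
  shows "(\<integral>p. \<kappa> p * \<psi> p \<partial>(M \<Otimes>\<^sub>M M)) =
    (\<integral>z. (\<integral>p. Q (fst p, z) * \<psi> p * Q (snd p, z) \<partial>(M \<Otimes>\<^sub>M M)) \<partial>N)"
    and "bounded_measurable N (\<lambda>z. \<integral>p. Q (fst p, z) * \<psi> p * Q (snd p, z) \<partial>(M \<Otimes>\<^sub>M M))"
proof -
  interpret prob_space M by fact
  interpret N: prob_space N by fact
  interpret P: pair_prob_space M M ..
  interpret PN: pair_prob_space "M \<Otimes>\<^sub>M M" N ..
  let ?f = "\<lambda>p z. Q (fst p, z) * \<psi> p * Q (snd p, z)"
  have Q1: "bounded_measurable ((M \<Otimes>\<^sub>M M) \<Otimes>\<^sub>M N) (\<lambda>q. Q (fst (fst q), snd q))"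
       "bounded_measurable ((M \<Otimes>\<^sub>M M) \<Otimes>\<^sub>M N) (\<lambda>q. Q (snd (fst q), snd q))"
    using Q by (auto intro: bounded_measurable_comp)
  have \<psi>1: "bounded_measurable ((M \<Otimes>\<^sub>M M) \<Otimes>\<^sub>M N) (\<lambda>q. \<psi> (fst q))"
    using \<psi> by (auto intro: bounded_measurable_comp)
  have b: "bounded_measurable ((M \<Otimes>\<^sub>M M) \<Otimes>\<^sub>M N) (\<lambda>q. ?f (fst q) (snd q))"
    by (intro bounded_measurable_mult Q1 \<psi>1)
  then have i: "integrable ((M \<Otimes>\<^sub>M M) \<Otimes>\<^sub>M N) (case_prod ?f)"
    by (simp add: split_beta' PN.bounded_integrable)
  have "(\<integral>p. \<kappa> p * \<psi> p \<partial>(M \<Otimes>\<^sub>M M)) = (\<integral>p. (\<integral>z. ?f p z \<partial>N) \<partial>(M \<Otimes>\<^sub>M M))"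
  proof (rule integral_cong_AE)
    show "(\<lambda>p. \<kappa> p * \<psi> p) \<in> borel_measurable (M \<Otimes>\<^sub>M M)"
      using \<kappa> \<psi> by measurable
    show "(\<lambda>p. \<integral>z. ?f p z \<partial>N) \<in> borel_measurable (M \<Otimes>\<^sub>M M)"
      using bounded_measurable_measurable[OF N.bounded_measurable_integral[OF b]] by simp
    show "AE p in M \<Otimes>\<^sub>M M. \<kappa> p * \<psi> p = (\<integral>z. ?f p z \<partial>N)"
      using AE
    proof eventually_elim
      case (elim p)
      have "(\<integral>z. ?f p z \<partial>N) = (\<integral>z. Q (fst p, z) * Q (snd p, z) * \<psi> p \<partial>N)"
        by (simp add: ac_simps)
      with elim show ?case by simp
    qed
  qed
  also have "\<dots> = (\<integral>z. (\<integral>p. ?f p z \<partial>(M \<Otimes>\<^sub>M M)) \<partial>N)"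
    by (rule PN.Fubini_integral[OF i, symmetric])
  finally show "(\<integral>p. \<kappa> p * \<psi> p \<partial>(M \<Otimes>\<^sub>M M)) = (\<integral>z. (\<integral>p. ?f p z \<partial>(M \<Otimes>\<^sub>M M)) \<partial>N)" .
  have "(\<lambda>q. (snd q, fst q)) \<in> measurable (N \<Otimes>\<^sub>M (M \<Otimes>\<^sub>M M)) ((M \<Otimes>\<^sub>M M) \<Otimes>\<^sub>M N)"
    by measurable
  from bounded_measurable_comp[OF b this]
  show "bounded_measurable N (\<lambda>z. \<integral>p. ?f p z \<partial>(M \<Otimes>\<^sub>M M))"
    using P.bounded_measurable_integral[of N "\<lambda>q. ?f (snd q) (fst q)"] by simp
qed

lemma integral_swap_leg:
  assumes M: "prob_space M" and N: "prob_space N" and Q: "bounded_measurable (M \<Otimes>\<^sub>M N) Q"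
    and s: "bounded_measurable N s" and L: "bounded_measurable M L"
    and AE: "AE x in M. L x = (\<integral>z. Q (x, z) * s z \<partial>N)"
    and D: "bounded_measurable M D"
  shows "(\<integral>x. D x * L x \<partial>M) = (\<integral>z. (\<integral>x. D x * Q (x, z) \<partial>M) * s z \<partial>N)"
    and "bounded_measurable N (\<lambda>z. \<integral>x. D x * Q (x, z) \<partial>M)"
proof -
  interpret prob_space M by fact
  interpret N: prob_space N by fact
  interpret P: pair_prob_space M N ..
  have D1: "bounded_measurable (M \<Otimes>\<^sub>M N) (\<lambda>q. D (fst q))" and s1: "bounded_measurable (M \<Otimes>\<^sub>M N) (\<lambda>q. s (snd q))"
    using D s by (auto intro: bounded_measurable_comp)
  have b: "bounded_measurable (M \<Otimes>\<^sub>M N) (\<lambda>q. D (fst q) * Q q)"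
    by (intro bounded_measurable_mult D1 Q)
  have b2: "bounded_measurable (M \<Otimes>\<^sub>M N) (\<lambda>q. D (fst q) * Q q * s (snd q))"
    by (intro bounded_measurable_mult b s1)
  have "(\<integral>x. D x * L x \<partial>M) = (\<integral>x. (\<integral>z. D x * Q (x, z) * s z \<partial>N) \<partial>M)"
  proof (rule integral_cong_AE)
    show "(\<lambda>x. D x * L x) \<in> borel_measurable M"
      using D L by measurable
    show "(\<lambda>x. \<integral>z. D x * Q (x, z) * s z \<partial>N) \<in> borel_measurable M"
      using bounded_measurable_measurable[OF N.bounded_measurable_integral[OF b2]] by simp
    show "AE x in M. D x * L x = (\<integral>z. D x * Q (x, z) * s z \<partial>N)"
      using AE by eventually_elim (simp add: mult.assoc)
  qed
  also have "\<dots> = (\<integral>z. (\<integral>x. D x * Q (x, z) * s z \<partial>M) \<partial>N)"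
    by (rule P.Fubini_integral[symmetric]) (use P.bounded_integrable[OF b2] in \<open>simp add: split_beta'\<close>)
  finally show "(\<integral>x. D x * L x \<partial>M) = (\<integral>z. (\<integral>x. D x * Q (x, z) \<partial>M) * s z \<partial>N)"
    by simp
  have "(\<lambda>q. (snd q, fst q)) \<in> measurable (N \<Otimes>\<^sub>M M) (M \<Otimes>\<^sub>M N)"
    by measurable
  from bounded_measurable_comp[OF b this]
  show "bounded_measurable N (\<lambda>z. \<integral>x. D x * Q (x, z) \<partial>M)"
    using bounded_measurable_integral[of N "\<lambda>q. D (snd q) * Q (snd q, fst q)"] by simp
qed

text \<open>A Schur product theorem that also keeps track of the rank-one lower bounds. Inserting the Gram form of
  \<open>\<kappa>\<close> turns the quadratic form of \<open>\<kappa> \<kappa>'\<close> at \<open>D\<close> into an average over \<open>z\<close> of the quadratic forms of \<open>\<kappa>'\<close> at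
  \<open>D Q(\<cdot>, z)\<close>; these are bounded below by squares, and projecting on the unit vector \<open>s\<close> finishes the proof.\<close>

lemma dominates_mult:
  assumes M: "prob_space M" and fac: "factors M N \<kappa> L"
    and b: "bounded_measurable (M \<Otimes>\<^sub>M M) \<kappa>" "bounded_measurable M L"
    and b': "bounded_measurable (M \<Otimes>\<^sub>M M) \<kappa>'" "bounded_measurable M L'"
    and dom: "dominates M \<kappa>' L'"
  shows "dominates M (\<lambda>p. \<kappa> p * \<kappa>' p) (\<lambda>x. L x * L' x)"
  unfolding dominates_def
proof (intro allI impI)
  fix D assume D: "bounded_measurable M D"
  interpret prob_space M by fact
  interpret P: pair_prob_space M M ..
  obtain Q s where N: "prob_space N" and Q: "bounded_measurable (M \<Otimes>\<^sub>M N) Q"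
    and s: "bounded_measurable N s" "(\<integral>z. (s z)\<^sup>2 \<partial>N) = 1"
    and AE: "AE p in M \<Otimes>\<^sub>M M. \<kappa> p = (\<integral>z. Q (fst p, z) * Q (snd p, z) \<partial>N)"
    and AE': "AE x in M. L x = (\<integral>z. Q (x, z) * s z \<partial>N)"
    using fac unfolding factors_def by blast
  interpret N: prob_space N by fact
  have DL: "bounded_measurable M (\<lambda>x. D x * L' x)" by (intro bounded_measurable_mult D b')
  have \<psi>: "bounded_measurable (M \<Otimes>\<^sub>M M) (\<lambda>p. D (fst p) * \<kappa>' p * D (snd p))"
    using D b' by (auto intro!: bounded_measurable_mult bounded_measurable_comp[OF D])
  note swap = integral_swap_leg[OF M N Q s(1) b(2) AE' DL]
  note fct = integral_factorisation[OF M N Q b(1) AE \<psi>]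
  have "(\<integral>x. D x * (L x * L' x) \<partial>M)\<^sup>2 = (\<integral>z. (\<integral>x. D x * L' x * Q (x, z) \<partial>M) * s z \<partial>N)\<^sup>2"
    using swap(1) by (simp add: ac_simps)
  also have "\<dots> \<le> (\<integral>z. (\<integral>x. D x * L' x * Q (x, z) \<partial>M)\<^sup>2 \<partial>N)"
    by (rule N.cauchy_schwarz_unit[OF swap(2) s])
  also have "\<dots> \<le> (\<integral>z. (\<integral>p. Q (fst p, z) * (D (fst p) * \<kappa>' p * D (snd p)) * Q (snd p, z) \<partial>(M \<Otimes>\<^sub>M M)) \<partial>N)"
  proof (rule integral_mono_AE[OF _ _ AE_I2])
    show "integrable N (\<lambda>z. (\<integral>x. D x * L' x * Q (x, z) \<partial>M)\<^sup>2)"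
      unfolding power2_eq_square by (intro N.bounded_integrable bounded_measurable_mult swap(2))
    show "integrable N (\<lambda>z. \<integral>p. Q (fst p, z) * (D (fst p) * \<kappa>' p * D (snd p)) * Q (snd p, z) \<partial>(M \<Otimes>\<^sub>M M))"
      by (rule N.bounded_integrable[OF fct(2)])
    fix z assume z: "z \<in> space N"
    have "bounded_measurable M (\<lambda>x. D x * Q (x, z))"
      using z by (intro bounded_measurable_mult D bounded_measurable_comp[OF Q]) auto
    with dom have "(\<integral>x. (D x * Q (x, z)) * L' x \<partial>M)\<^sup>2
        \<le> (\<integral>p. (D (fst p) * Q (fst p, z)) * \<kappa>' p * (D (snd p) * Q (snd p, z)) \<partial>(M \<Otimes>\<^sub>M M))"
      unfolding dominates_def by blast
    then show "(\<integral>x. D x * L' x * Q (x, z) \<partial>M)\<^sup>2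
        \<le> (\<integral>p. Q (fst p, z) * (D (fst p) * \<kappa>' p * D (snd p)) * Q (snd p, z) \<partial>(M \<Otimes>\<^sub>M M))"
      by (simp add: ac_simps)
  qed
  also have "\<dots> = (\<integral>p. \<kappa> p * (D (fst p) * \<kappa>' p * D (snd p)) \<partial>(M \<Otimes>\<^sub>M M))"
    using fct(1) by simp
  also have "\<dots> = (\<integral>p. D (fst p) * (\<kappa> p * \<kappa>' p) * D (snd p) \<partial>(M \<Otimes>\<^sub>M M))"
    by (simp add: ac_simps)
  finally show "(\<integral>x. D x * (L x * L' x) \<partial>M)\<^sup>2 \<le> \<dots>" .
qed

text \<open>Passing from \<open>\<kappa>\<close> to \<open>A \<kappa> A\<^sup>T\<close> applies \<open>A\<close> to the Gram vectors. For path kernels this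
  prolongs a path symmetrically at both ends.\<close>

lemma factors_conjugate:
  assumes M: "prob_space M" and fac: "factors M N \<kappa> L"
    and b: "bounded_measurable (M \<Otimes>\<^sub>M M) \<kappa>" "bounded_measurable M L"
    and A: "bounded_measurable (M \<Otimes>\<^sub>M M) A"
  shows "factors M N (\<lambda>p. \<integral>q. \<kappa> q * (A (fst p, fst q) * A (snd p, snd q)) \<partial>(M \<Otimes>\<^sub>M M))
           (\<lambda>x. \<integral>s. A (x, s) * L s \<partial>M)"
proof -
  interpret prob_space M by fact
  obtain Q s where N: "prob_space N" and Q: "bounded_measurable (M \<Otimes>\<^sub>M N) Q"
    and s: "bounded_measurable N s" "(\<integral>z. (s z)\<^sup>2 \<partial>N) = 1"
    and AE: "AE p in M \<Otimes>\<^sub>M M. \<kappa> p = (\<integral>z. Q (fst p, z) * Q (snd p, z) \<partial>N)"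
    and AE': "AE x in M. L x = (\<integral>z. Q (x, z) * s z \<partial>N)"
    using fac unfolding factors_def by blast
  interpret N: prob_space N by fact
  define Q' where "Q' = (\<lambda>q. \<integral>s. A (fst q, s) * Q (s, snd q) \<partial>M)"
  have "bounded_measurable ((M \<Otimes>\<^sub>M N) \<Otimes>\<^sub>M M) (\<lambda>r. A (fst (fst r), snd r))"
    "bounded_measurable ((M \<Otimes>\<^sub>M N) \<Otimes>\<^sub>M M) (\<lambda>r. Q (snd r, snd (fst r)))"
    by (auto intro: bounded_measurable_comp[OF A] bounded_measurable_comp[OF Q])
  from bounded_measurable_integral[OF bounded_measurable_mult[OF this]]
  have Q': "bounded_measurable (M \<Otimes>\<^sub>M N) Q'" by (simp add: Q'_def)
  have Ax: "bounded_measurable M (\<lambda>s. A (x, s))" if "x \<in> space M" for x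
    using that by (intro bounded_measurable_comp[OF A]) auto
  have Qz: "bounded_measurable M (\<lambda>s. Q (s, z))" if "z \<in> space N" for z
    using that by (intro bounded_measurable_comp[OF Q]) auto
  have 1: "(\<integral>q. \<kappa> q * (A (x, fst q) * A (y, snd q)) \<partial>(M \<Otimes>\<^sub>M M)) = (\<integral>z. Q' (x, z) * Q' (y, z) \<partial>N)"
    if xy: "x \<in> space M" "y \<in> space M" for x y
  proof -
    have \<psi>: "bounded_measurable (M \<Otimes>\<^sub>M M) (\<lambda>q. A (x, fst q) * A (y, snd q))"
      by (intro bounded_measurable_mult bounded_measurable_comp[OF Ax[OF xy(1)]] bounded_measurable_comp[OF Ax[OF xy(2)]]) auto
    have "(\<integral>q. \<kappa> q * (A (x, fst q) * A (y, snd q)) \<partial>(M \<Otimes>\<^sub>M M)) =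
      (\<integral>z. (\<integral>q. Q (fst q, z) * (A (x, fst q) * A (y, snd q)) * Q (snd q, z) \<partial>(M \<Otimes>\<^sub>M M)) \<partial>N)"
      by (rule integral_factorisation(1)[OF M N Q b(1) AE \<psi>])
    also have "\<dots> = (\<integral>z. Q' (x, z) * Q' (y, z) \<partial>N)"
    proof (rule Bochner_Integration.integral_cong[OF refl])
      fix z assume z: "z \<in> space N"
      have "(\<integral>q. (A (x, fst q) * Q (fst q, z)) * (A (y, snd q) * Q (snd q, z)) \<partial>(M \<Otimes>\<^sub>M M)) = Q' (x, z) * Q' (y, z)"
        using integral_pair_mult[OF M bounded_measurable_mult[OF Ax[OF xy(1)] Qz[OF z]]
           bounded_measurable_mult[OF Ax[OF xy(2)] Qz[OF z]]] by (simp add: Q'_def)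
      then show "(\<integral>q. Q (fst q, z) * (A (x, fst q) * A (y, snd q)) * Q (snd q, z) \<partial>(M \<Otimes>\<^sub>M M)) = Q' (x, z) * Q' (y, z)"
        by (simp add: ac_simps)
    qed
    finally show ?thesis .
  qed
  have 2: "(\<integral>s. A (x, s) * L s \<partial>M) = (\<integral>z. Q' (x, z) * s z \<partial>N)" if "x \<in> space M" for x
    using integral_swap_leg(1)[OF M N Q s(1) b(2) AE' Ax[OF that]] by (simp add: Q'_def)
  show ?thesis
    unfolding factors_def
  proof (intro conjI exI[of _ Q'] exI[of _ s])
    show "AE p in M \<Otimes>\<^sub>M M. (\<integral>q. \<kappa> q * (A (fst p, fst q) * A (snd p, snd q)) \<partial>(M \<Otimes>\<^sub>M M)) =
        (\<integral>z. Q' (fst p, z) * Q' (snd p, z) \<partial>N)"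
      by (intro AE_I2 1) (auto simp: space_pair_measure)
    show "AE x in M. (\<integral>s. A (x, s) * L s \<partial>M) = (\<integral>z. Q' (x, z) * s z \<partial>N)"
      by (intro AE_I2 2)
  qed (use N Q' s in auto)
qed

section \<open>Integrals over parallel paths\<close>

text \<open>A symmetric probability density \<open>K\<close>, bounded away from \<open>0\<close>, which is positive semidefinite in the strong
  sense of being a Gram kernel. The vectors may live over another space \<open>N\<close> than the points, since adding
  a positive constant to a kernel needs an additional dimension.\<close>

locale factored_density = prob_space M
  for M :: "real measure" +
  fixes N :: "'c measure" and K :: "real \<times> real \<Rightarrow> real" and h :: "real \<times> 'c \<Rightarrow> real"
  assumes K: "pos_weight (M \<Otimes>\<^sub>M M) K"
    and K_sym: "x \<in> space M \<Longrightarrow> y \<in> space M \<Longrightarrow> K (x, y) = K (y, x)"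
    and K_total: "(\<integral>p. K p \<partial>(M \<Otimes>\<^sub>M M)) = 1"
    and N: "prob_space N"
    and h: "bounded_measurable (M \<Otimes>\<^sub>M N) h"
    and K_factor: "AE p in M \<Otimes>\<^sub>M M. K p = (\<integral>z. h (fst p, z) * h (snd p, z) \<partial>N)"
begin

sublocale P: pair_prob_space M M ..

definition \<rho> :: "real \<Rightarrow> real" where "\<rho> x = (\<integral>y. K (x, y) \<partial>M)"

definition mean_log :: "(real \<Rightarrow> real) \<Rightarrow> real" where "mean_log u = (\<integral>x. \<rho> x * ln (u x) \<partial>M)"

definition integral_op :: "(real \<Rightarrow> real) \<Rightarrow> real \<Rightarrow> real" where "integral_op u x = (\<integral>y. K (x, y) * u y \<partial>M)"

lemma K_comp: "a \<in> measurable L M \<Longrightarrow> b \<in> measurable L M \<Longrightarrow> pos_weight L (\<lambda>x. K (a x, b x))"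
  by (rule pos_weight_comp[OF K]) auto

lemma \<rho>: "pos_weight M \<rho>"
  unfolding \<rho>_def by (rule pos_weight_integral[OF K])

lemma integral_op: assumes "pos_weight M u" shows "pos_weight M (integral_op u)"
proof -
  have "pos_weight (M \<Otimes>\<^sub>M M) (\<lambda>p. K p * u (snd p))"
    by (intro pos_weight_mult K pos_weight_comp[OF assms]) auto
  from pos_weight_integral[OF this] show ?thesis by (simp add: integral_op_def[abs_def])
qed

lemma integral_\<rho>: "integral\<^sup>L M \<rho> = 1"
  unfolding \<rho>_def using P.integral_fst'[of K] P.pos_weight_integrable[OF K] K_total by simp

lemma bounded_ln:
  fixes u :: "'d \<Rightarrow> real"
  assumes "pos_weight X u" shows "bounded_measurable X (\<lambda>x. ln (u x))"
proof -
  obtain c C where 1: "c > 0" "C > 0" "\<And>x. x \<in> space X \<Longrightarrow> c \<le> u x" "\<And>x. x \<in> space X \<Longrightarrow> u x \<le> C"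
    using assms(1) by (rule pos_weightE) blast
  show ?thesis
  proof (rule bounded_measurableI[of _ _ "\<bar>ln c\<bar> + \<bar>ln C\<bar>"])
    fix x assume "x \<in> space X"
    then have "ln c \<le> ln (u x)" "ln (u x) \<le> ln C"
      using 1 by (auto intro!: ln_mono intro: less_le_trans)
    then show "\<bar>ln (u x)\<bar> \<le> \<bar>ln c\<bar> + \<bar>ln C\<bar>" by linarith
  qed (use assms in measurable)
qed

lemma mean_log_integrable: "pos_weight M u \<Longrightarrow> integrable M (\<lambda>x. \<rho> x * ln (u x))"
  by (intro bounded_integrable bounded_measurable_mult pos_weight_bounded \<rho> bounded_ln)

lemma mean_log_cong: "(\<And>x. x \<in> space M \<Longrightarrow> u x = v x) \<Longrightarrow> mean_log u = mean_log v"
  unfolding mean_log_def by (intro Bochner_Integration.integral_cong) auto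

lemma mean_log_mult:
  assumes "pos_weight M u" "pos_weight M v"
  shows "mean_log (\<lambda>x. u x * v x) = mean_log u + mean_log v"
proof -
  have "mean_log (\<lambda>x. u x * v x) = (\<integral>x. \<rho> x * ln (u x) + \<rho> x * ln (v x) \<partial>M)"
    unfolding mean_log_def
    using pos_weight_pos[OF assms(1)] pos_weight_pos[OF assms(2)]
    by (intro Bochner_Integration.integral_cong refl) (subst ln_mult_pos, auto simp: ring_distribs)
  then show ?thesis using assms[THEN mean_log_integrable] by (simp add: mean_log_def)
qed

lemma mean_log_divide:
  assumes "pos_weight M u" "pos_weight M v"
  shows "mean_log (\<lambda>x. u x / v x) = mean_log u - mean_log v"
proof -
  have "mean_log (\<lambda>x. u x / v x) = (\<integral>x. \<rho> x * ln (u x) - \<rho> x * ln (v x) \<partial>M)"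
    unfolding mean_log_def
    using pos_weight_pos[OF assms(1)] pos_weight_pos[OF assms(2)]
    by (intro Bochner_Integration.integral_cong refl) (subst ln_divide_pos, auto simp: ring_distribs)
  then show ?thesis using assms[THEN mean_log_integrable] by (simp add: mean_log_def)
qed

lemma mean_log_sqrt:
  assumes "pos_weight M u"
  shows "mean_log (\<lambda>x. sqrt (u x)) = mean_log u / 2"
proof -
  have "mean_log (\<lambda>x. sqrt (u x)) = (\<integral>x. (\<rho> x * ln (u x)) / 2 \<partial>M)"
    unfolding mean_log_def using pos_weight_pos[OF assms]
    by (intro Bochner_Integration.integral_cong refl) (subst ln_sqrt, auto intro: less_imp_le)
  then show ?thesis by (simp add: mean_log_def)
qed

lemma mean_log_one: "mean_log (\<lambda>x. 1) = 0"
  by (simp add: mean_log_def)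

lemma mean_log_prod:
  assumes "\<And>i. i \<in> I \<Longrightarrow> pos_weight M (u i)"
  shows "mean_log (\<lambda>x. \<Prod>i\<in>I. u i x) = (\<Sum>i\<in>I. mean_log (u i))"
  using assms
  by (induction I rule: infinite_finite_induct) (auto simp: mean_log_one mean_log_mult pos_weight_prod)

text \<open>Jensen's inequality for the logarithm, under the density \<open>\<rho>\<close> and applied to \<open>u / \<rho>\<close>.\<close>

lemma mean_log_le_integral:
  assumes u: "pos_weight M u"
  shows "exp (mean_log u - mean_log \<rho>) \<le> integral\<^sup>L M u"
proof -
  define a where "a = integral\<^sup>L M u"
  have a: "a > 0" unfolding a_def by (rule pos_weight_integral_pos[OF u])
  have "mean_log u - mean_log \<rho> - ln a = (\<integral>x. \<rho> x * ln (u x) - \<rho> x * ln (\<rho> x) - \<rho> x * ln a \<partial>M)"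
    using mean_log_integrable[OF u] mean_log_integrable[OF \<rho>] pos_weight_integrable[OF \<rho>]
    by (simp add: mean_log_def integral_\<rho>)
  also have "\<dots> \<le> (\<integral>x. u x / a - \<rho> x \<partial>M)"
  proof (rule integral_mono_AE[OF _ _ AE_I2])
    show "integrable M (\<lambda>x. \<rho> x * ln (u x) - \<rho> x * ln (\<rho> x) - \<rho> x * ln a)"
      using mean_log_integrable[OF u] mean_log_integrable[OF \<rho>] pos_weight_integrable[OF \<rho>] by simp
    show "integrable M (\<lambda>x. u x / a - \<rho> x)"
      using pos_weight_integrable[OF \<rho>] pos_weight_integrable[OF u] by simp
    fix x assume x: "x \<in> space M"
    have p: "u x > 0" "\<rho> x > 0" using x u \<rho> by (auto dest: pos_weight_pos)
    have "ln (u x / (a * \<rho> x)) \<le> u x / (a * \<rho> x) - 1"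
      using p a by (intro ln_le_minus_one) auto
    then have "\<rho> x * ln (u x / (a * \<rho> x)) \<le> \<rho> x * (u x / (a * \<rho> x) - 1)"
      using p by (intro mult_left_mono) auto
    also have "\<dots> = u x / a - \<rho> x" using p a by (simp add: field_simps)
    also have "ln (u x / (a * \<rho> x)) = ln (u x) - ln (\<rho> x) - ln a"
      using p a by (simp add: ln_div ln_mult)
    finally show "\<rho> x * ln (u x) - \<rho> x * ln (\<rho> x) - \<rho> x * ln a \<le> u x / a - \<rho> x"
      by (simp add: algebra_simps)
  qed
  also have "\<dots> = 0"
    using a pos_weight_integrable[OF \<rho>] pos_weight_integrable[OF u] by (simp add: integral_\<rho> a_def[symmetric])
  finally have "mean_log u - mean_log \<rho> \<le> ln a" by simp
  then show ?thesis using a by (simp add: a_def[symmetric] ln_ge_iff)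
qed

text \<open>This is the nonnegativity of the relative entropy of \<open>\<rho>\<close>.\<close>

lemma mean_log_\<rho>_nonneg: "0 \<le> mean_log \<rho>"
  using mean_log_le_integral[OF pos_weight_const[of 1]] by (simp add: mean_log_one prob_space)

text \<open>Jensen's inequality for the transition probabilities \<open>K (x, y) / \<rho> x\<close>. Both marginals of \<open>K\<close> are \<open>\<rho>\<close>, so
  the step from \<open>x\<close> to \<open>y\<close> does not change the mean of \<open>ln u\<close>.\<close>

lemma mean_log_integral_op:
  assumes u: "pos_weight M u"
  shows "mean_log u + mean_log \<rho> \<le> mean_log (integral_op u)"
proof -
  have bK: "bounded_measurable (M \<Otimes>\<^sub>M M) (\<lambda>p. K p * ln (u (snd p)))"
    by (intro bounded_measurable_mult pos_weight_bounded K bounded_measurable_comp[OF bounded_ln[OF u]]) auto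
  have b2: "bounded_measurable M (\<lambda>x. \<integral>y. K (x, y) * ln (u y) \<partial>M)"
    using bounded_measurable_integral[OF bK] by simp
  have "mean_log u = (\<integral>y. (\<integral>x. K (x, y) * ln (u y) \<partial>M) \<partial>M)"
    unfolding mean_log_def
  proof (rule Bochner_Integration.integral_cong[OF refl])
    fix y assume "y \<in> space M"
    then have "\<rho> y = (\<integral>x. K (x, y) \<partial>M)"
      unfolding \<rho>_def by (intro Bochner_Integration.integral_cong) (auto simp: K_sym)
    then show "\<rho> y * ln (u y) = (\<integral>x. K (x, y) * ln (u y) \<partial>M)" by simp
  qed
  also have "\<dots> = (\<integral>x. (\<integral>y. K (x, y) * ln (u y) \<partial>M) \<partial>M)"
    by (rule P.Fubini_integral) (use P.bounded_integrable[OF bK] in \<open>simp add: split_beta'\<close>)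
  also have "\<dots> \<le> (\<integral>x. \<rho> x * ln (integral_op u x) - \<rho> x * ln (\<rho> x) \<partial>M)"
  proof (rule integral_mono_AE[OF _ _ AE_I2])
    show "integrable M (\<lambda>x. \<integral>y. K (x, y) * ln (u y) \<partial>M)" by (rule bounded_integrable[OF b2])
    show "integrable M (\<lambda>x. \<rho> x * ln (integral_op u x) - \<rho> x * ln (\<rho> x))"
      using mean_log_integrable[OF integral_op[OF u]] mean_log_integrable[OF \<rho>] by simp
    fix x assume x: "x \<in> space M"
    define b where "b = \<rho> x / integral_op u x"
    have p: "integral_op u x > 0" "\<rho> x > 0" using x integral_op[OF u] \<rho> by (auto dest: pos_weight_pos)
    then have b: "b > 0" by (simp add: b_def)
    have Kx: "pos_weight M (\<lambda>y. K (x, y))" using x by (intro K_comp) auto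
    have i: "integrable M (\<lambda>y. K (x, y))" "integrable M (\<lambda>y. K (x, y) * u y)"
        "integrable M (\<lambda>y. K (x, y) * ln (u y))"
      by (intro bounded_integrable bounded_measurable_mult bounded_ln u pos_weight_bounded[OF Kx] pos_weight_bounded[OF u])+
    have "(\<integral>y. K (x, y) * ln (u y) \<partial>M) + \<rho> x * ln b = (\<integral>y. K (x, y) * ln (u y) + K (x, y) * ln b \<partial>M)"
      using i by (simp add: \<rho>_def)
    also have "\<dots> \<le> (\<integral>y. b * (K (x, y) * u y) - K (x, y) \<partial>M)"
    proof (rule integral_mono_AE[OF _ _ AE_I2])
      fix y assume y: "y \<in> space M"
      have q: "u y > 0" "K (x, y) > 0" using u Kx y by (auto dest: pos_weight_pos)
      have "ln (u y) + ln b \<le> u y * b - 1"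
        using ln_le_minus_one[of "u y * b"] q b by (simp add: ln_mult)
      then have "K (x, y) * (ln (u y) + ln b) \<le> K (x, y) * (u y * b - 1)"
        using q by (intro mult_left_mono) auto
      then show "K (x, y) * ln (u y) + K (x, y) * ln b \<le> b * (K (x, y) * u y) - K (x, y)"
        by (simp add: algebra_simps)
    qed (use i in auto)
    also have "\<dots> = b * integral_op u x - \<rho> x" using i by (simp add: \<rho>_def integral_op_def)
    also have "\<dots> = 0" using p by (simp add: b_def)
    finally show "(\<integral>y. K (x, y) * ln (u y) \<partial>M) \<le> \<rho> x * ln (integral_op u x) - \<rho> x * ln (\<rho> x)"
      using p by (simp add: b_def ln_div algebra_simps)
  qed
  also have "\<dots> = mean_log (integral_op u) - mean_log \<rho>"
    using mean_log_integrable[OF integral_op[OF u]] mean_log_integrable[OF \<rho>] by (simp add: mean_log_def)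
  finally show ?thesis by simp
qed

text \<open>The integral over the interior vertices, with weights \<open>ws\<close>, of a path whose ends are at the two points.\<close>

fun path_kernel :: "(real \<Rightarrow> real) list \<Rightarrow> real \<times> real \<Rightarrow> real" where
  "path_kernel [] p = K p"
| "path_kernel (w # ws) p = (\<integral>s. K (fst p, s) * w s * path_kernel ws (s, snd p) \<partial>M)"

definition weights :: "(real \<Rightarrow> real) list \<Rightarrow> bool" where
  "weights ws \<longleftrightarrow> (\<forall>w\<in>set ws. pos_weight M w)"

lemma weights_simps [simp]:
  "weights []" "weights (w # ws) \<longleftrightarrow> pos_weight M w \<and> weights ws"
  "weights (ws @ vs) \<longleftrightarrow> weights ws \<and> weights vs" "weights (rev ws) \<longleftrightarrow> weights ws"
  by (auto simp: weights_def)

lemma path_kernel: "weights ws \<Longrightarrow> pos_weight (M \<Otimes>\<^sub>M M) (path_kernel ws)"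
proof (induction ws)
  case Nil
  then show ?case using K by (simp add: path_kernel.simps[abs_def])
next
  case (Cons w ws)
  then have IH: "pos_weight (M \<Otimes>\<^sub>M M) (path_kernel ws)" and w: "pos_weight M w" by auto
  have "pos_weight ((M \<Otimes>\<^sub>M M) \<Otimes>\<^sub>M M) (\<lambda>r. K (fst (fst r), snd r) * w (snd r) * path_kernel ws (snd r, snd (fst r)))"
    by (intro pos_weight_mult pos_weight_comp[OF w] pos_weight_comp[OF IH] K_comp) auto
  from pos_weight_integral[OF this] show ?case by (simp add: path_kernel.simps[abs_def])
qed

lemma path_kernel_comp:
  "weights ws \<Longrightarrow> a \<in> measurable L M \<Longrightarrow> b \<in> measurable L M \<Longrightarrow> pos_weight L (\<lambda>x. path_kernel ws (a x, b x))"
  by (rule pos_weight_comp[OF path_kernel]) auto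

lemma path_kernel_snoc:
  assumes "weights ws" "pos_weight M w" "x \<in> space M" "y \<in> space M"
  shows "path_kernel (ws @ [w]) (x, y) = (\<integral>t. path_kernel ws (x, t) * w t * K (t, y) \<partial>M)"
  using assms
proof (induction ws arbitrary: x)
  case Nil
  then show ?case by (simp add: mult.assoc)
next
  case (Cons v ws)
  then have v: "pos_weight M v" and ws: "weights ws" by auto
  have b: "pos_weight (M \<Otimes>\<^sub>M M) (\<lambda>p. K (x, fst p) * v (fst p) * (path_kernel ws (fst p, snd p) * w (snd p) * K (snd p, y)))"
    using Cons.prems
    by (intro pos_weight_mult path_kernel_comp ws K_comp pos_weight_comp[OF v] pos_weight_comp[OF \<open>pos_weight M w\<close>]) auto
  have "path_kernel ((v # ws) @ [w]) (x, y)
      = (\<integral>s. K (x, s) * v s * (\<integral>t. path_kernel ws (s, t) * w t * K (t, y) \<partial>M) \<partial>M)"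
    using Cons by (auto intro!: Bochner_Integration.integral_cong)
  also have "\<dots> = (\<integral>s. (\<integral>t. K (x, s) * v s * (path_kernel ws (s, t) * w t * K (t, y)) \<partial>M) \<partial>M)"
    by simp
  also have "\<dots> = (\<integral>t. (\<integral>s. K (x, s) * v s * (path_kernel ws (s, t) * w t * K (t, y)) \<partial>M) \<partial>M)"
    by (rule P.Fubini_integral[symmetric]) (use P.pos_weight_integrable[OF b] in \<open>simp add: split_beta'\<close>)
  also have "\<dots> = (\<integral>t. path_kernel (v # ws) (x, t) * w t * K (t, y) \<partial>M)"
    by (simp add: mult.assoc[symmetric])
  finally show ?case .
qed

lemma path_kernel_rev:
  assumes "weights ws" "x \<in> space M" "y \<in> space M"
  shows "path_kernel (rev ws) (x, y) = path_kernel ws (y, x)"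
  using assms
proof (induction ws arbitrary: y)
  case Nil
  then show ?case by (simp add: K_sym)
next
  case (Cons w ws)
  then show ?case
    by (auto simp: path_kernel_snoc K_sym mult_ac intro!: Bochner_Integration.integral_cong)
qed

definition geometric_mean :: "(real \<Rightarrow> real) list \<Rightarrow> (real \<Rightarrow> real) list \<Rightarrow> (real \<Rightarrow> real) list" where
  "geometric_mean us vs = map2 (\<lambda>u v s. sqrt (u s * v s)) us vs"

lemma geometric_mean_weights:
  "weights us \<Longrightarrow> weights vs \<Longrightarrow> weights (geometric_mean us vs)"
  by (auto simp: weights_def geometric_mean_def intro!: pos_weight_sqrt pos_weight_mult
      dest: set_zip_leftD set_zip_rightD)

text \<open>The Cauchy-Schwarz inequality at each interior vertex.\<close>

lemma path_kernel_geometric_mean: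
  assumes "length us = length vs" "weights us" "weights vs" "x \<in> space M" "y \<in> space M"
  shows "path_kernel (geometric_mean us vs) (x, y) \<le> sqrt (path_kernel us (x, y) * path_kernel vs (x, y))"
  using assms
proof (induction us vs arbitrary: x rule: list_induct2)
  case Nil
  then show ?case using pos_weight_pos[OF K, of "(x, y)"] by (simp add: geometric_mean_def space_pair_measure)
next
  case (Cons u us v vs)
  then have u: "pos_weight M u" "weights us" and v: "pos_weight M v" "weights vs"
    and x: "x \<in> space M" and y: "y \<in> space M" by auto
  let ?w = "\<lambda>s. sqrt (u s * v s)"
  let ?a = "\<lambda>s. K (x, s) * u s * path_kernel us (s, y)"
  let ?b = "\<lambda>s. K (x, s) * v s * path_kernel vs (s, y)"
  have w: "pos_weight M ?w" using u v by (intro pos_weight_sqrt pos_weight_mult)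
  note g = geometric_mean_weights[OF u(2) v(2)]
  have pa: "pos_weight M ?a" and pb: "pos_weight M ?b"
    and pg: "pos_weight M (\<lambda>s. K (x, s) * ?w s * path_kernel (geometric_mean us vs) (s, y))"
    using x y by (auto intro!: pos_weight_mult path_kernel_comp K_comp u v w g)
  have "path_kernel (geometric_mean (u # us) (v # vs)) (x, y)
    = (\<integral>s. K (x, s) * ?w s * path_kernel (geometric_mean us vs) (s, y) \<partial>M)"
    by (simp add: geometric_mean_def)
  also have "\<dots> \<le> (\<integral>s. sqrt (?a s * ?b s) \<partial>M)"
  proof (rule integral_mono_AE[OF _ _ AE_I2])
    fix s assume s: "s \<in> space M"
    have p: "K (x, s) > 0" "u s > 0" "v s > 0"
      using s x u v pos_weight_pos[OF K, of "(x, s)"] by (auto simp: space_pair_measure dest: pos_weight_pos)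
    have "K (x, s) * ?w s * path_kernel (geometric_mean us vs) (s, y)
      \<le> K (x, s) * ?w s * sqrt (path_kernel us (s, y) * path_kernel vs (s, y))"
      using Cons.IH[OF u(2) v(2) s y] p by (intro mult_left_mono) auto
    also have "\<dots> = sqrt (?a s * ?b s)"
      using p by (simp add: real_sqrt_mult)
    finally show "K (x, s) * ?w s * path_kernel (geometric_mean us vs) (s, y) \<le> sqrt (?a s * ?b s)" .
  qed (auto intro!: pos_weight_integrable pos_weight_sqrt pos_weight_mult[OF pa pb] pg)
  also have "\<dots> \<le> sqrt (integral\<^sup>L M ?a * integral\<^sup>L M ?b)"
    by (rule cauchy_schwarz_sqrt[OF pa pb])
  finally show ?case by simp
qed

lemma factors_cong:
  assumes "factors M X \<kappa> L" "\<And>x y. x \<in> space M \<Longrightarrow> y \<in> space M \<Longrightarrow> \<kappa>' (x, y) = \<kappa> (x, y)"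
  shows "factors M X \<kappa>' L"
proof -
  have eq: "AE p in M \<Otimes>\<^sub>M M. \<kappa>' p = \<kappa> p"
    by (rule AE_I2) (use assms(2) in \<open>auto simp: space_pair_measure\<close>)
  have "AE p in M \<Otimes>\<^sub>M M. \<kappa>' p = (\<integral>z. Q (fst p, z) * Q (snd p, z) \<partial>X)"
    if "AE p in M \<Otimes>\<^sub>M M. \<kappa> p = (\<integral>z. Q (fst p, z) * Q (snd p, z) \<partial>X)" for Q
    using that eq by eventually_elim simp
  with assms(1) show ?thesis unfolding factors_def by blast
qed

text \<open>Cutting an edge in the middle: the unit vector is the mean \<open>\<integral> h(x, \<cdot>)\<close>, whose square norm is the total mass
  of \<open>K\<close>, and the coordinates along it are the marginal \<open>\<rho>\<close>.\<close>

lemma factors_edge: "factors M N K \<rho>"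
proof -
  interpret N: prob_space N by (rule N)
  interpret PN: pair_prob_space M N ..
  define s where "s z = (\<integral>x. h (x, z) \<partial>M)" for z
  have "bounded_measurable (N \<Otimes>\<^sub>M M) (\<lambda>q. h (snd q, fst q))"
    by (rule bounded_measurable_comp[OF h]) measurable
  from bounded_measurable_integral[OF this] have s: "bounded_measurable N s" by (simp add: s_def[abs_def])
  have hz: "bounded_measurable M (\<lambda>x. h (x, z))" if "z \<in> space N" for z
    using that by (intro bounded_measurable_comp[OF h]) auto
  have c1: "bounded_measurable X (\<lambda>_. 1 :: real)" for X :: "'x measure"
    by (intro pos_weight_bounded pos_weight_const) auto
  have "1 = (\<integral>z. (\<integral>p. h (fst p, z) * 1 * h (snd p, z) \<partial>(M \<Otimes>\<^sub>M M)) \<partial>N)"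
    using integral_factorisation(1)[OF prob_space_axioms N h pos_weight_bounded[OF K] K_factor c1] K_total by simp
  also have "\<dots> = (\<integral>z. (s z)\<^sup>2 \<partial>N)"
    using integral_pair_mult[OF prob_space_axioms hz hz]
    by (intro Bochner_Integration.integral_cong) (auto simp: s_def power2_eq_square)
  finally have 1: "(\<integral>z. (s z)\<^sup>2 \<partial>N) = 1" by simp
  have "AE x in M. AE y in M. K (x, y) = (\<integral>z. h (x, z) * h (y, z) \<partial>N)"
    using P.AE_pair[OF K_factor] by simp
  then have 2: "AE x in M. \<rho> x = (\<integral>z. h (x, z) * s z \<partial>N)"
  proof (rule AE_mp, intro AE_I2 impI)
    fix x assume x: "x \<in> space M" and ae: "AE y in M. K (x, y) = (\<integral>z. h (x, z) * h (y, z) \<partial>N)"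
    have hx: "bounded_measurable N (\<lambda>z. h (x, z))"
      using x by (intro bounded_measurable_comp[OF h]) auto
    have Kx: "bounded_measurable M (\<lambda>y. K (x, y))"
      using x by (intro pos_weight_bounded K_comp) auto
    have "AE y in M. K (x, y) = (\<integral>z. h (y, z) * h (x, z) \<partial>N)"
      using ae by (simp add: mult.commute)
    from integral_swap_leg(1)[OF prob_space_axioms N h hx Kx this c1]
    have "\<rho> x = (\<integral>z. s z * h (x, z) \<partial>N)"
      by (simp add: \<rho>_def s_def)
    then show "\<rho> x = (\<integral>z. h (x, z) * s z \<partial>N)"
      by (simp add: mult.commute)
  qed
  show ?thesis
    unfolding factors_def using N h s 1 K_factor 2 by blast
qed

text \<open>Cutting a path of two edges at its middle vertex: each half receives the square root of the weight there,
  and the unit vector is \<open>sqrt \<rho>\<close>.\<close>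

lemma factors_vertex:
  assumes m: "pos_weight M m"
  shows "factors M M (path_kernel [m]) (integral_op (\<lambda>s. sqrt (m s * \<rho> s)))"
proof -
  let ?Q = "\<lambda>q. K q * sqrt (m (snd q))" and ?s = "\<lambda>s. sqrt (\<rho> s)"
  have Q: "bounded_measurable (M \<Otimes>\<^sub>M M) ?Q"
    by (intro pos_weight_bounded pos_weight_mult K pos_weight_sqrt pos_weight_comp[OF m]) auto
  have s: "bounded_measurable M ?s"
    by (intro pos_weight_bounded pos_weight_sqrt \<rho>)
  have "(\<integral>z. (?s z)\<^sup>2 \<partial>M) = (\<integral>z. \<rho> z \<partial>M)"
    by (intro Bochner_Integration.integral_cong) (auto dest: pos_weight_pos[OF \<rho>])
  then have 1: "(\<integral>z. (?s z)\<^sup>2 \<partial>M) = 1" by (simp add: integral_\<rho>)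
  have 2: "path_kernel [m] p = (\<integral>z. ?Q (fst p, z) * ?Q (snd p, z) \<partial>M)" if "p \<in> space (M \<Otimes>\<^sub>M M)" for p
    using that pos_weight_pos[OF m]
    by (auto simp: space_pair_measure K_sym less_imp_le intro!: Bochner_Integration.integral_cong)
  have 3: "integral_op (\<lambda>s. sqrt (m s * \<rho> s)) x = (\<integral>z. ?Q (x, z) * ?s z \<partial>M)" for x
    by (simp add: integral_op_def real_sqrt_mult mult.assoc)
  show ?thesis
    unfolding factors_def using Q s 1 2 3 prob_space_axioms
    by (intro conjI exI[of _ ?Q] exI[of _ ?s] AE_I2) auto
qed

text \<open>Half of a palindromic path, integrated from the cut up to the end.\<close>

fun leg :: "(real \<Rightarrow> real) list \<Rightarrow> (real \<Rightarrow> real) \<Rightarrow> real \<Rightarrow> real" where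
  "leg [] L = L"
| "leg (v # vs) L = integral_op (\<lambda>s. v s * leg vs L s)"

lemma leg: "weights vs \<Longrightarrow> pos_weight M L \<Longrightarrow> pos_weight M (leg vs L)"
  by (induction vs) (auto intro: integral_op pos_weight_mult)

lemma mean_log_leg:
  "weights vs \<Longrightarrow> pos_weight M L \<Longrightarrow> mean_log L + (\<Sum>v\<leftarrow>vs. mean_log v) \<le> mean_log (leg vs L)"
proof (induction vs)
  case (Cons v vs)
  then have "pos_weight M v" "pos_weight M (leg vs L)" by (auto intro: leg)
  then show ?case
    using mean_log_integral_op[of "\<lambda>s. v s * leg vs L s"] mean_log_\<rho>_nonneg Cons
    by (auto simp: mean_log_mult pos_weight_mult)
qed simp

lemma factors_leg:
  assumes "factors M X (path_kernel us) L" "pos_weight M L" "weights us" "weights vs"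
  shows "factors M X (path_kernel (vs @ us @ rev vs)) (leg vs L)"
  using assms(4)
proof (induction vs)
  case Nil
  then show ?case using assms(1) by simp
next
  case (Cons v vs)
  let ?ws = "vs @ us @ rev vs"
  from Cons have v: "pos_weight M v" and vs: "weights vs" by auto
  then have ws: "weights ?ws" using assms by simp
  have b: "pos_weight (M \<Otimes>\<^sub>M M) (\<lambda>p. K p * v (snd p))"
    by (intro pos_weight_mult K pos_weight_comp[OF v]) auto
  have fac: "factors M X (\<lambda>p. \<integral>q. path_kernel ?ws q * ((K (fst p, fst q) * v (fst q)) * (K (snd p, snd q) * v (snd q))) \<partial>(M \<Otimes>\<^sub>M M))
     (\<lambda>x. \<integral>s. K (x, s) * v s * leg vs L s \<partial>M)"
    using factors_conjugate[OF prob_space_axioms Cons.IH[OF vs] pos_weight_bounded[OF path_kernel[OF ws]]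
      pos_weight_bounded[OF leg[OF vs assms(2)]] pos_weight_bounded[OF b]] by simp
  have eq: "path_kernel (v # ?ws @ [v]) (x, y) =
     (\<integral>q. path_kernel ?ws q * ((K (x, fst q) * v (fst q)) * (K (y, snd q) * v (snd q))) \<partial>(M \<Otimes>\<^sub>M M))"
    if xy: "x \<in> space M" "y \<in> space M" for x y
  proof -
    have "pos_weight (M \<Otimes>\<^sub>M M) (\<lambda>q. path_kernel ?ws q * ((K (x, fst q) * v (fst q)) * (K (y, snd q) * v (snd q))))"
      using xy by (intro pos_weight_mult path_kernel ws K_comp pos_weight_comp[OF v]) auto
    then have "(\<integral>q. path_kernel ?ws q * ((K (x, fst q) * v (fst q)) * (K (y, snd q) * v (snd q))) \<partial>(M \<Otimes>\<^sub>M M))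
       = (\<integral>s. (\<integral>t. path_kernel ?ws (s, t) * ((K (x, s) * v s) * (K (y, t) * v t)) \<partial>M) \<partial>M)"
      by (subst P.integral_fst'[symmetric]) (auto intro: P.pos_weight_integrable)
    also have "\<dots> = (\<integral>s. (\<integral>t. (K (x, s) * v s) * (path_kernel ?ws (s, t) * v t * K (t, y)) \<partial>M) \<partial>M)"
      using xy by (intro Bochner_Integration.integral_cong) (auto simp: K_sym)
    also have "\<dots> = (\<integral>s. (K (x, s) * v s) * (\<integral>t. path_kernel ?ws (s, t) * v t * K (t, y) \<partial>M) \<partial>M)"
      by simp
    also have "\<dots> = (\<integral>s. (K (x, s) * v s) * path_kernel (?ws @ [v]) (s, y) \<partial>M)"
      using path_kernel_snoc[OF ws v _ xy(2)] by (intro Bochner_Integration.integral_cong) auto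
    finally show ?thesis by simp
  qed
  have "factors M X (path_kernel (v # ?ws @ [v])) (\<lambda>x. \<integral>s. K (x, s) * v s * leg vs L s \<partial>M)"
    by (rule factors_cong[OF fac], unfold fst_conv snd_conv, rule eq)
  moreover have "leg (v # vs) L = (\<lambda>x. \<integral>s. K (x, s) * v s * leg vs L s \<partial>M)"
    by (simp add: integral_op_def fun_eq_iff mult.assoc)
  ultimately show ?case by (simp del: path_kernel.simps leg.simps)
qed

lemma palindrome_cases:
  fixes us :: "'d list"
  assumes "rev us = us"
  obtains vs where "us = vs @ rev vs" | vs m where "us = vs @ [m] @ rev vs"
proof -
  define k where "k = length us div 2"
  define vs where "vs = take k us"
  have eq: "us = vs @ drop k us" by (simp add: vs_def)
  have "rev vs = drop (length us - k) (rev us)" by (simp add: vs_def rev_take)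
  then have r: "rev vs = drop (length us - k) us" by (simp add: assms)
  show ?thesis
  proof (cases "even (length us)")
    case True
    then have "length us - k = k" by (auto simp: k_def)
    with r eq show ?thesis using that(1) by metis
  next
    case False
    then have k: "length us - k = Suc k" "k < length us" by (auto simp: k_def elim!: oddE)
    then have "drop k us = [us ! k] @ rev vs" using r by (simp add: Cons_nth_drop_Suc)
    with eq show ?thesis using that(2) by metis
  qed
qed

text \<open>A palindromic path is cut at its middle vertex or at its middle edge. The surplus \<open>mean_log \<rho>\<close> pays for
  the last Jensen inequality in the proof of \<open>parallel_paths\<close>.\<close>

lemma palindromic_path_factors:
  assumes us: "weights us" "rev us = us"
  obtains L where "pos_weight M L" "factors M N (path_kernel us) L \<or> factors M M (path_kernel us) L"
    "(\<Sum>u\<leftarrow>us. mean_log u) / 2 + mean_log \<rho> \<le> mean_log L"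
  using us(2)
proof (cases rule: palindrome_cases)
  case (1 vs)
  with us have vs: "weights vs" by simp
  have "factors M N (path_kernel []) \<rho>"
    using factors_edge by (rule factors_cong) simp
  from factors_leg[OF this \<rho> _ vs] have "factors M N (path_kernel us) (leg vs \<rho>)" by (simp add: 1)
  moreover have "(\<Sum>u\<leftarrow>us. mean_log u) / 2 + mean_log \<rho> \<le> mean_log (leg vs \<rho>)"
    using mean_log_leg[OF vs \<rho>] by (simp add: 1 sum_list_rev rev_map[symmetric])
  ultimately show ?thesis using that leg[OF vs \<rho>] by blast
next
  case (2 vs m)
  with us have vs: "weights vs" and m: "pos_weight M m" by auto
  let ?r = "\<lambda>s. sqrt (m s * \<rho> s)"
  have r: "pos_weight M ?r" using m \<rho> by (intro pos_weight_sqrt pos_weight_mult)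
  from factors_leg[OF factors_vertex[OF m] integral_op[OF r] _ vs] m
  have "factors M M (path_kernel us) (leg vs (integral_op ?r))" by (simp add: 2)
  moreover have "mean_log ?r = (mean_log m + mean_log \<rho>) / 2"
    using m \<rho> by (simp add: mean_log_sqrt mean_log_mult pos_weight_mult)
  then have "(\<Sum>u\<leftarrow>us. mean_log u) / 2 + mean_log \<rho> \<le> mean_log (leg vs (integral_op ?r))"
    using mean_log_leg[OF vs integral_op[OF r]] mean_log_integral_op[OF r] mean_log_\<rho>_nonneg
    by (simp add: 2 sum_list_rev rev_map[symmetric] add_divide_distrib)
  ultimately show ?thesis using that leg[OF vs integral_op[OF r]] by blast
qed

lemma sum_geometric_mean:
  assumes "length us = length vs" "weights us" "weights vs"
  shows "(\<Sum>w\<leftarrow>geometric_mean us vs. mean_log w) = ((\<Sum>u\<leftarrow>us. mean_log u) + (\<Sum>v\<leftarrow>vs. mean_log v)) / 2"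
  using assms
  by (induction us vs rule: list_induct2)
     (auto simp: geometric_mean_def mean_log_sqrt mean_log_mult pos_weight_mult field_simps)

lemma rev_geometric_mean: "rev (geometric_mean us (rev us)) = geometric_mean us (rev us)"
  by (rule nth_equalityI) (auto simp: geometric_mean_def rev_nth mult.commute fun_eq_iff)

lemma dominates_paths:
  assumes "finite I" "\<And>i. i \<in> I \<Longrightarrow> weights (us i)" "\<And>i. i \<in> I \<Longrightarrow> pos_weight M (L i)"
    "\<And>i. i \<in> I \<Longrightarrow> factors M N (path_kernel (us i)) (L i) \<or> factors M M (path_kernel (us i)) (L i)"
  shows "dominates M (\<lambda>p. \<Prod>i\<in>I. path_kernel (us i) p) (\<lambda>x. \<Prod>i\<in>I. L i x)"
  using assms
proof (induction I)
  case empty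
  show ?case using dominates_one[OF prob_space_axioms] by simp
next
  case (insert i I)
  have b: "bounded_measurable (M \<Otimes>\<^sub>M M) (path_kernel (us i))" "bounded_measurable M (L i)"
    using insert.prems by (auto intro!: pos_weight_bounded path_kernel)
  have b': "bounded_measurable (M \<Otimes>\<^sub>M M) (\<lambda>p. \<Prod>i\<in>I. path_kernel (us i) p)" "bounded_measurable M (\<lambda>x. \<Prod>i\<in>I. L i x)"
    using insert.prems by (auto intro!: pos_weight_bounded pos_weight_prod path_kernel)
  have dom: "dominates M (\<lambda>p. \<Prod>i\<in>I. path_kernel (us i) p) (\<lambda>x. \<Prod>i\<in>I. L i x)"
    using insert by auto
  have "factors M N (path_kernel (us i)) (L i) \<or> factors M M (path_kernel (us i)) (L i)"
    using insert by auto
  then have "dominates M (\<lambda>p. path_kernel (us i) p * (\<Prod>i\<in>I. path_kernel (us i) p)) (\<lambda>x. L i x * (\<Prod>i\<in>I. L i x))"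
    by (auto intro: dominates_mult[OF prob_space_axioms _ b b' dom])
  then show ?case using insert.hyps by simp
qed

text \<open>Integrals of parallel paths with common ends. Exchanging the ends reverses all the weight lists without
  changing the integral, and so by the inequality of means the lists may be assumed palindromic. All paths
  are then Gram kernels, and cutting each of them in the middle bounds the integral below by the square of
  the integral of a spider whose legs are the half paths. Jensen's inequality, first along each leg and then at
  the centre, evaluates the spider.\<close>

lemma parallel_paths:
  assumes I: "finite I" "I \<noteq> {}" and ws: "\<And>i. i \<in> I \<Longrightarrow> weights (ws i)"
    and a: "pos_weight M a" and b: "pos_weight M b"
  shows "exp (mean_log a + mean_log b + (\<Sum>i\<in>I. \<Sum>w\<leftarrow>ws i. mean_log w))
    \<le> (\<integral>p. a (fst p) * b (snd p) * (\<Prod>i\<in>I. path_kernel (ws i) p) \<partial>(M \<Otimes>\<^sub>M M))"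
proof -
  define us where "us i = geometric_mean (ws i) (rev (ws i))" for i
  define \<omega> where "\<omega> x = sqrt (a x * b x)" for x
  define f where "f = (\<lambda>p. a (fst p) * b (snd p) * (\<Prod>i\<in>I. path_kernel (ws i) p))"
  have us: "weights (us i)" "rev (us i) = us i" if "i \<in> I" for i
    using ws[OF that] by (auto simp: us_def geometric_mean_weights rev_geometric_mean)
  have \<omega>: "pos_weight M \<omega>" using a b by (auto simp: \<omega>_def[abs_def] intro: pos_weight_sqrt pos_weight_mult)
  have "\<exists>L. pos_weight M L \<and> (factors M N (path_kernel (us i)) L \<or> factors M M (path_kernel (us i)) L)
     \<and> (\<Sum>u\<leftarrow>us i. mean_log u) / 2 + mean_log \<rho> \<le> mean_log L" if "i \<in> I" for i
    using palindromic_path_factors[OF us[OF that]] by metis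
  then obtain L where L: "\<And>i. i \<in> I \<Longrightarrow> pos_weight M (L i)"
     "\<And>i. i \<in> I \<Longrightarrow> factors M N (path_kernel (us i)) (L i) \<or> factors M M (path_kernel (us i)) (L i)"
     "\<And>i. i \<in> I \<Longrightarrow> (\<Sum>u\<leftarrow>us i. mean_log u) / 2 + mean_log \<rho> \<le> mean_log (L i)"
    by metis
  have dom: "dominates M (\<lambda>p. \<Prod>i\<in>I. path_kernel (us i) p) (\<lambda>x. \<Prod>i\<in>I. L i x)"
    by (rule dominates_paths[OF I(1) us(1) L(1,2)])
  have pf: "pos_weight (M \<Otimes>\<^sub>M M) f"
    unfolding f_def using ws
    by (intro pos_weight_mult pos_weight_prod path_kernel pos_weight_comp[OF a] pos_weight_comp[OF b]) auto
  have pfs: "pos_weight (M \<Otimes>\<^sub>M M) (\<lambda>p. f (snd p, fst p))"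
    by (rule pos_weight_comp[OF pf]) measurable
  have pu: "pos_weight (M \<Otimes>\<^sub>M M) (\<lambda>p. \<omega> (fst p) * (\<Prod>i\<in>I. path_kernel (us i) p) * \<omega> (snd p))"
    using us by (intro pos_weight_mult pos_weight_prod path_kernel pos_weight_comp[OF \<omega>]) auto
  let ?L = "\<lambda>x. \<omega> x * (\<Prod>i\<in>I. L i x)"
  have pL: "pos_weight M ?L" using L by (intro pos_weight_mult \<omega> pos_weight_prod)
  \<comment> \<open>The factor 2 comes from the square of the spider, whose centre and legs carry half of the total
    logarithm of the weights each time.\<close>
  have "mean_log a + mean_log b + (\<Sum>i\<in>I. \<Sum>w\<leftarrow>ws i. mean_log w)
      = 2 * (mean_log \<omega> + (\<Sum>i\<in>I. (\<Sum>u\<leftarrow>us i. mean_log u) / 2))"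
  proof -
    have "(\<Sum>u\<leftarrow>us i. mean_log u) = (\<Sum>w\<leftarrow>ws i. mean_log w)" if "i \<in> I" for i
      using sum_geometric_mean[of "ws i" "rev (ws i)"] ws[OF that]
      by (simp add: us_def sum_list_rev rev_map[symmetric])
    moreover have "mean_log \<omega> = (mean_log a + mean_log b) / 2"
      using a b by (simp add: \<omega>_def[abs_def] mean_log_sqrt mean_log_mult pos_weight_mult)
    ultimately show ?thesis by (simp add: sum_distrib_left)
  qed
  also have "\<dots> \<le> 2 * (mean_log ?L - mean_log \<rho>)"
  proof -
    have "mean_log \<rho> * 1 \<le> mean_log \<rho> * card I"
      using mean_log_\<rho>_nonneg I by (intro mult_left_mono) (auto simp: Suc_le_eq card_gt_0_iff)
    moreover have "(\<Sum>i\<in>I. (\<Sum>u\<leftarrow>us i. mean_log u) / 2 + mean_log \<rho>) \<le> (\<Sum>i\<in>I. mean_log (L i))"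
      by (intro sum_mono L(3))
    ultimately show ?thesis
      using L(1) \<omega> by (simp add: mean_log_mult mean_log_prod pos_weight_prod sum.distrib mult.commute)
  qed
  finally have "exp (mean_log a + mean_log b + (\<Sum>i\<in>I. \<Sum>w\<leftarrow>ws i. mean_log w))
     \<le> exp (2 * (mean_log ?L - mean_log \<rho>))"
    unfolding exp_le_cancel_iff .
  also have "\<dots> = (exp (mean_log ?L - mean_log \<rho>))\<^sup>2"
    by (rule exp_double)
  also have "\<dots> \<le> (integral\<^sup>L M ?L)\<^sup>2"
    by (intro power_mono mean_log_le_integral pL) auto
  also have "\<dots> \<le> (\<integral>p. \<omega> (fst p) * (\<Prod>i\<in>I. path_kernel (us i) p) * \<omega> (snd p) \<partial>(M \<Otimes>\<^sub>M M))"
    using dom pos_weight_bounded[OF \<omega>] unfolding dominates_def by blast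
  also have "\<dots> \<le> (\<integral>p. (f p + f (snd p, fst p)) / 2 \<partial>(M \<Otimes>\<^sub>M M))"
  proof (rule integral_mono_AE[OF _ _ AE_I2])
    fix p assume "p \<in> space (M \<Otimes>\<^sub>M M)"
    then obtain x y where p: "p = (x, y)" and xy: "x \<in> space M" "y \<in> space M"
      by (auto simp: space_pair_measure)
    have pos: "a x > 0" "a y > 0" "b x > 0" "b y > 0"
      using xy pos_weight_pos[OF a] pos_weight_pos[OF b] by auto
    have kpos: "path_kernel vs (x, y) > 0" "path_kernel vs (y, x) > 0" if "weights vs" for vs
      using xy pos_weight_pos[OF path_kernel[OF that]] by (auto simp: space_pair_measure)
    have "\<omega> x * (\<Prod>i\<in>I. path_kernel (us i) (x, y)) * \<omega> y
      \<le> \<omega> x * (\<Prod>i\<in>I. sqrt (path_kernel (ws i) (x, y) * path_kernel (ws i) (y, x))) * \<omega> y"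
    proof (intro mult_right_mono mult_left_mono prod_mono conjI)
      fix i assume i: "i \<in> I"
      show "0 \<le> path_kernel (us i) (x, y)" using kpos[OF us(1)[OF i]] by simp
      show "path_kernel (us i) (x, y) \<le> sqrt (path_kernel (ws i) (x, y) * path_kernel (ws i) (y, x))"
        using path_kernel_geometric_mean[of "ws i" "rev (ws i)" x y] ws[OF i] xy
        by (simp add: us_def path_kernel_rev)
    qed (use pos in \<open>auto simp: \<omega>_def\<close>)
    also have "\<dots> = sqrt (f (x, y) * f (y, x))"
    proof -
      have prod_sqrt: "(\<Prod>i\<in>I. sqrt (g i)) = sqrt (\<Prod>i\<in>I. g i)" for g :: "_ \<Rightarrow> real"
        using I(1) by (induction I) (auto simp: real_sqrt_mult)
      show ?thesis unfolding f_def \<omega>_def prod_sqrt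
        by (simp add: real_sqrt_mult[symmetric] prod.distrib ac_simps)
    qed
    also have "\<dots> \<le> (f (x, y) + f (y, x)) / 2"
    proof (rule arith_geo_mean_sqrt)
      show "0 \<le> f (x, y)" "0 \<le> f (y, x)"
        using pos_weight_pos[OF pf] xy by (auto simp: space_pair_measure less_imp_le)
    qed
    finally show "\<omega> (fst p) * (\<Prod>i\<in>I. path_kernel (us i) p) * \<omega> (snd p) \<le> (f p + f (snd p, fst p)) / 2"
      by (simp add: p)
  next
    show "integrable (M \<Otimes>\<^sub>M M) (\<lambda>p. \<omega> (fst p) * (\<Prod>i\<in>I. path_kernel (us i) p) * \<omega> (snd p))"
      by (rule P.pos_weight_integrable[OF pu])
    show "integrable (M \<Otimes>\<^sub>M M) (\<lambda>p. (f p + f (snd p, fst p)) / 2)"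
      using P.pos_weight_integrable[OF pf] P.pos_weight_integrable[OF pfs] by simp
  qed
  also have "\<dots> = integral\<^sup>L (M \<Otimes>\<^sub>M M) f"
    using P.pos_weight_integrable[OF pf] P.pos_weight_integrable[OF pfs]
      P.integral_product_swap[of f] by (simp add: split_beta')
  finally show ?thesis unfolding f_def .
qed

end

section \<open>Decomposition of bicyclic graphs\<close>

lemma simple_graph_finite_edges: "simple_graph V E \<Longrightarrow> finite E"
  by (rule finite_subset[of _ "Pow V"]) (auto simp: simple_graph_def)

fun path_edges :: "'a list \<Rightarrow> 'a set set" where
  "path_edges (u # v # p) = insert {u, v} (path_edges (v # p))"
| "path_edges _ = {}"

lemma finite_path_edges [simp]: "finite (path_edges p)"
  by (induction p rule: path_edges.induct) auto

lemma path_edges_subset: "e \<in> path_edges p \<Longrightarrow> e \<subseteq> set p"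
  by (induction p rule: path_edges.induct) auto

lemma path_edges_card: "distinct p \<Longrightarrow> e \<in> path_edges p \<Longrightarrow> card e = 2"
  by (induction p rule: path_edges.induct) auto

lemma card_path_edges: "distinct p \<Longrightarrow> card (path_edges p) = length p - 1"
proof (induction p rule: path_edges.induct)
  case (1 u v p)
  then have "{u, v} \<notin> path_edges (v # p)"
    using path_edges_subset[of "{u, v}" "v # p"] by auto
  with 1 show ?case by simp
qed auto

lemma path_edges_append:
  "p \<noteq> [] \<Longrightarrow> q \<noteq> [] \<Longrightarrow> path_edges (p @ q) = insert {last p, hd q} (path_edges p \<union> path_edges q)"
proof (induction p rule: path_edges.induct)
  case ("2_2" v)
  then show ?case by (cases q) auto
qed auto

lemma path_edges_rev: "path_edges (rev p) = path_edges p"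
proof (induction p rule: path_edges.induct)
  case (1 u v p)
  have "path_edges (rev (u # v # p)) = path_edges (rev (v # p) @ [u])" by simp
  also have "\<dots> = insert {last (rev (v # p)), u} (path_edges (rev (v # p)))"
    by (subst path_edges_append) auto
  finally show ?case using 1 by (auto simp: insert_commute)
qed auto

text \<open>A path between \<open>a\<close> and \<open>b\<close> containing the edge \<open>{a, b}\<close> is that edge. Therefore internally disjoint
  paths that are different lists have no common edge.\<close>

lemma path_edges_ends:
  assumes "distinct (a # q @ [b])" "{a, b} \<in> path_edges (a # q @ [b])" shows "q = []"
proof (rule ccontr)
  assume "q \<noteq> []"
  then obtain s q' where q: "q = s # q'" by (cases q) auto
  with assms have "{a, b} \<in> path_edges (s # q' @ [b])"
    by (auto simp: doubleton_eq_iff)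
  from path_edges_subset[OF this] assms(1) show False by (auto simp: q)
qed

text \<open>A path from \<open>a\<close> to \<open>b\<close> is given by the list of its interior vertices. Two paths and three paths give
  the cycles and the theta graphs, and the empty list alone gives a single edge.\<close>

definition internally_disjoint :: "'a \<Rightarrow> 'a \<Rightarrow> 'a list set \<Rightarrow> bool" where
  "internally_disjoint a b Qs \<longleftrightarrow> finite Qs \<and> Qs \<noteq> {} \<and> a \<noteq> b \<and> (\<forall>q\<in>Qs. distinct (a # q @ [b])) \<and>
     (\<forall>q\<in>Qs. \<forall>q'\<in>Qs. q \<noteq> q' \<longrightarrow> set q \<inter> set q' = {})"

definition theta_vertices :: "'a \<Rightarrow> 'a \<Rightarrow> 'a list set \<Rightarrow> 'a set" where
  "theta_vertices a b Qs = {a, b} \<union> (\<Union>q\<in>Qs. set q)"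

definition theta_edges :: "'a \<Rightarrow> 'a \<Rightarrow> 'a list set \<Rightarrow> 'a set set" where
  "theta_edges a b Qs = (\<Union>q\<in>Qs. path_edges (a # q @ [b]))"

lemma theta_edges_disjoint:
  assumes "internally_disjoint a b Qs" "q \<in> Qs" "q' \<in> Qs" "q \<noteq> q'"
  shows "path_edges (a # q @ [b]) \<inter> path_edges (a # q' @ [b]) = {}"
proof (rule ccontr)
  assume "path_edges (a # q @ [b]) \<inter> path_edges (a # q' @ [b]) \<noteq> {}"
  then obtain e where e: "e \<in> path_edges (a # q @ [b])" "e \<in> path_edges (a # q' @ [b])" by auto
  have d: "distinct (a # q @ [b])" "distinct (a # q' @ [b])" "set q \<inter> set q' = {}"
    using assms unfolding internally_disjoint_def by blast+
  have "e \<subseteq> {a, b}"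
    using path_edges_subset[OF e(1)] path_edges_subset[OF e(2)] d(3) by auto
  moreover have "card e = 2" using path_edges_card[OF d(1) e(1)] .
  ultimately have "e = {a, b}" using d(1) by (intro card_subset_eq) auto
  with path_edges_ends[OF d(1)] path_edges_ends[OF d(2)] e assms(4) show False by simp
qed

lemma theta_simple:
  assumes "internally_disjoint a b Qs"
  shows "simple_graph (theta_vertices a b Qs) (theta_edges a b Qs)"
  unfolding simple_graph_def
proof (intro conjI ballI)
  show "finite (theta_vertices a b Qs)"
    using assms by (auto simp: internally_disjoint_def theta_vertices_def)
  fix e assume "e \<in> theta_edges a b Qs"
  then obtain q where q: "q \<in> Qs" "e \<in> path_edges (a # q @ [b])" by (auto simp: theta_edges_def)
  with path_edges_subset[OF q(2)] show "e \<subseteq> theta_vertices a b Qs" by (auto simp: theta_vertices_def)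
  show "card e = 2"
    using path_edges_card[OF _ q(2)] assms q(1) by (auto simp: internally_disjoint_def)
qed

lemma card_theta:
  assumes "internally_disjoint a b Qs"
  shows "card (theta_edges a b Qs) + 2 = card (theta_vertices a b Qs) + card Qs"
proof -
  have fin: "finite Qs" and ab: "a \<noteq> b" and d: "\<And>q. q \<in> Qs \<Longrightarrow> distinct (a # q @ [b])"
    and disj: "\<And>q q'. q \<in> Qs \<Longrightarrow> q' \<in> Qs \<Longrightarrow> q \<noteq> q' \<Longrightarrow> set q \<inter> set q' = {}"
    using assms unfolding internally_disjoint_def by blast+
  have "card (theta_edges a b Qs) = (\<Sum>q\<in>Qs. card (path_edges (a # q @ [b])))"
    unfolding theta_edges_def using fin theta_edges_disjoint[OF assms] by (intro card_UN_disjoint) auto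
  also have "\<dots> = (\<Sum>q\<in>Qs. length q + 1)"
    using d by (intro sum.cong) (auto simp: card_path_edges)
  also have "\<dots> = (\<Sum>q\<in>Qs. card (set q)) + card Qs"
    unfolding sum.distrib using d by (simp add: distinct_card)
  also have "(\<Sum>q\<in>Qs. card (set q)) = card (\<Union>q\<in>Qs. set q)"
    using fin disj by (intro card_UN_disjoint[symmetric]) auto
  finally have 1: "card (theta_edges a b Qs) = card (\<Union>q\<in>Qs. set q) + card Qs" .
  have "card (theta_vertices a b Qs) = card {a, b} + card (\<Union>q\<in>Qs. set q)"
    unfolding theta_vertices_def using fin d by (intro card_Un_disjoint) auto
  with 1 ab show ?thesis by simp
qed

lemma rtrancl_crossing:
  "(u, t) \<in> R\<^sup>* \<Longrightarrow> u \<in> A \<Longrightarrow> t \<notin> A \<Longrightarrow> \<exists>x y. (x, y) \<in> R \<and> x \<in> A \<and> y \<notin> A"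
  by (induction rule: rtrancl_induct) blast+

text \<open>A connected graph is exhausted by adding one pendant vertex at a time, since some edge leaves every
  proper part of the vertex set.\<close>

lemma grow_to_spanning:
  assumes con: "connected_graph V E"
    and "Q V\<^sub>0 E\<^sub>0" "V\<^sub>0 \<subseteq> V" "V\<^sub>0 \<noteq> {}"
    and step: "\<And>V' E' v s. Q V' E' \<Longrightarrow> V' \<subseteq> V \<Longrightarrow> v \<in> V' \<Longrightarrow> s \<in> V - V' \<Longrightarrow> {v, s} \<in> E \<Longrightarrow>
      Q (insert s V') (insert {v, s} E')"
  shows "\<exists>E'. Q V E'"
  using assms(2-4)
proof (induction "card (V - V\<^sub>0)" arbitrary: V\<^sub>0 E\<^sub>0 rule: less_induct)
  case less
  have fin: "finite V" using con by (auto simp: connected_graph_def simple_graph_def)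
  show ?case
  proof (cases "V\<^sub>0 = V")
    case True
    with less show ?thesis by blast
  next
    case False
    then obtain u t where "u \<in> V\<^sub>0" "t \<in> V" "t \<notin> V\<^sub>0" using less by auto
    moreover from this have "(u, t) \<in> {(a, b). {a, b} \<in> E}\<^sup>*"
      using con less.prems by (auto simp: connected_graph_def)
    ultimately obtain v s where vs: "{v, s} \<in> E" "v \<in> V\<^sub>0" "s \<notin> V\<^sub>0"
      using rtrancl_crossing[of u t "{(a, b). {a, b} \<in> E}" V\<^sub>0] by auto
    then have s: "s \<in> V - V\<^sub>0" using con by (auto simp: connected_graph_def simple_graph_def)
    have "card (V - insert s V\<^sub>0) < card (V - V\<^sub>0)"
      using s fin by (intro psubset_card_mono) auto
    from less.hyps[OF this step[OF less.prems(1,2) vs(2) s vs(1)]] s less.prems show ?thesis by auto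
  qed
qed

definition joins :: "'a list \<Rightarrow> 'a \<Rightarrow> 'a \<Rightarrow> bool" where
  "joins p u v \<longleftrightarrow> p \<noteq> [] \<and> distinct p \<and> hd p = u \<and> last p = v"

text \<open>The tree is represented by what is used of it: the number of its edges and the paths in it.\<close>

lemma spanning_tree:
  assumes con: "connected_graph V E"
  obtains T where "T \<subseteq> E" "card V = card T + 1"
    "\<And>u v. u \<in> V \<Longrightarrow> v \<in> V \<Longrightarrow> \<exists>p. joins p u v \<and> set p \<subseteq> V \<and> path_edges p \<subseteq> T"
proof -
  define Q where "Q V' T \<longleftrightarrow> T \<subseteq> E \<and> finite V' \<and> finite T \<and> (\<forall>e\<in>T. e \<subseteq> V') \<and> card V' = card T + 1 \<and>
    (\<forall>u\<in>V'. \<forall>v\<in>V'. \<exists>p. joins p u v \<and> set p \<subseteq> V' \<and> path_edges p \<subseteq> T)" for V' T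
  obtain r where r: "r \<in> V" using con by (auto simp: connected_graph_def)
  have "\<exists>T. Q V T"
  proof (rule grow_to_spanning[OF con, of Q "{r}" "{}"])
    have "joins [r] r r" by (simp add: joins_def)
    then show "Q {r} {}" unfolding Q_def by (auto intro!: exI[of _ "[r]"])
    fix V' T v s
    assume Q: "Q V' T" and "V' \<subseteq> V" and v: "v \<in> V'" and s: "s \<in> V - V'" and vs: "{v, s} \<in> E"
    have "{v, s} \<notin> T" using Q s by (auto simp: Q_def)
    moreover have "\<exists>p. joins p a b \<and> set p \<subseteq> insert s V' \<and> path_edges p \<subseteq> insert {v, s} T"
      if ab: "a \<in> insert s V'" "b \<in> insert s V'" for a b
    proof -
      consider "a \<in> V'" "b \<in> V'" | "a = s" "b = s" | "a \<in> V'" "b = s" | "a = s" "b \<in> V'" using ab by blast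
      then show ?thesis
      proof cases
        case 1
        then have "\<exists>p. joins p a b \<and> set p \<subseteq> V' \<and> path_edges p \<subseteq> T" using Q by (auto simp: Q_def)
        then show ?thesis by blast
      next
        case 2
        then show ?thesis by (intro exI[of _ "[s]"]) (auto simp: joins_def)
      next
        case 3
        then obtain p where p: "joins p a v" "set p \<subseteq> V'" "path_edges p \<subseteq> T"
          using Q v unfolding Q_def by blast
        then have "joins (p @ [s]) a s" "path_edges (p @ [s]) \<subseteq> insert {v, s} T"
          using s by (auto simp: joins_def path_edges_append)
        with 3 p show ?thesis by (intro exI[of _ "p @ [s]"]) auto
      next
        case 4
        then obtain p where p: "joins p v b" "set p \<subseteq> V'" "path_edges p \<subseteq> T"
          using Q v unfolding Q_def by blast
        then have "joins (s # p) s b" "path_edges (s # p) \<subseteq> insert {v, s} T"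
          using s path_edges_append[of "[s]" p] by (auto simp: joins_def)
        with 4 p show ?thesis by (intro exI[of _ "s # p"]) auto
      qed
    qed
    ultimately show "Q (insert s V') (insert {v, s} T)"
      using Q v s vs unfolding Q_def by (auto simp del: insert_iff)
  qed (use r in auto)
  then show ?thesis using that unfolding Q_def by blast
qed

text \<open>The two properties of the integral inequality on which the graph theory relies: in the application, \<open>G\<close> is
  the class of graphs for which the inequality holds for arbitrary positive weights.\<close>

locale glue_closed =
  fixes G :: "'v set \<Rightarrow> 'v set set \<Rightarrow> bool"
  assumes theta: "internally_disjoint a b Qs \<Longrightarrow> G (theta_vertices a b Qs) (theta_edges a b Qs)"
    and glue: "G V\<^sub>1 E\<^sub>1 \<Longrightarrow> G V\<^sub>2 E\<^sub>2 \<Longrightarrow> V\<^sub>1 \<inter> V\<^sub>2 = {v} \<Longrightarrow> G (V\<^sub>1 \<union> V\<^sub>2) (E\<^sub>1 \<union> E\<^sub>2)"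
begin

lemma single_edge: "u \<noteq> v \<Longrightarrow> G {u, v} {{u, v}}"
  using theta[of u v "{[]}"] by (simp add: internally_disjoint_def theta_vertices_def theta_edges_def)

text \<open>The excess \<open>k\<close> of edges over vertices is carried along: a subgraph that spans and has the same excess as
  the whole graph is the whole graph.\<close>

definition member_excess :: "'v set \<Rightarrow> 'v set set \<Rightarrow> nat \<Rightarrow> bool" where
  "member_excess V E k \<longleftrightarrow> G V E \<and> simple_graph V E \<and> V \<noteq> {} \<and> card E = card V + k"

lemma member_pendant:
  assumes "member_excess V E k" "v \<in> V" "s \<notin> V" shows "member_excess (insert s V) (insert {v, s} E) k"
proof -
  have sg: "simple_graph V E" using assms by (simp add: member_excess_def)
  have "G (V \<union> {v, s}) (E \<union> {{v, s}})"
    by (rule glue) (use assms single_edge[of v s] in \<open>auto simp: member_excess_def\<close>)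
  moreover have "V \<union> {v, s} = insert s V" using assms by auto
  moreover have "{v, s} \<notin> E" using sg assms by (auto simp: simple_graph_def)
  moreover have "finite E" using sg by (auto simp: simple_graph_def intro: finite_subset[of _ "Pow V"])
  moreover have "card {v, s} = 2" using assms(2,3) by (subst card_2_iff) blast
  ultimately show ?thesis
    using assms sg by (auto simp: member_excess_def simple_graph_def)
qed

lemma member_spanning:
  assumes "connected_graph V E" "member_excess V\<^sub>0 E\<^sub>0 k" "E\<^sub>0 \<subseteq> E" "V\<^sub>0 \<subseteq> V"
  shows "\<exists>E'\<subseteq>E. member_excess V E' k"
proof -
  have "\<exists>E'. E' \<subseteq> E \<and> member_excess V E' k"
    by (rule grow_to_spanning[OF assms(1), of "\<lambda>V' E'. E' \<subseteq> E \<and> member_excess V' E' k" V\<^sub>0 E\<^sub>0])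
       (use assms in \<open>auto intro: member_pendant simp: member_excess_def[of V\<^sub>0]\<close>)
  then show ?thesis by blast
qed

text \<open>Growing one vertex at a time until the set \<open>S\<close> is met for the first time, so that it is met in
  one vertex only. The invariant freezes the subgraph from that moment on.\<close>

lemma member_hitting:
  assumes con: "connected_graph V E" and "member_excess V\<^sub>0 E\<^sub>0 k" "E\<^sub>0 \<subseteq> E" "V\<^sub>0 \<subseteq> V"
    and S: "S \<subseteq> V" "S \<noteq> {}" and "V\<^sub>0 \<inter> S = {} \<or> (\<exists>v. V\<^sub>0 \<inter> S = {v})"
  shows "\<exists>V\<^sub>1\<subseteq>V. \<exists>E\<^sub>1\<subseteq>E. member_excess V\<^sub>1 E\<^sub>1 k \<and> (\<exists>v. V\<^sub>1 \<inter> S = {v})"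
proof -
  define Q where "Q V' E' \<longleftrightarrow> (\<exists>V\<^sub>1\<subseteq>V'. \<exists>E\<^sub>1\<subseteq>E. member_excess V\<^sub>1 E\<^sub>1 k \<and>
    (V\<^sub>1 = V' \<and> V\<^sub>1 \<inter> S = {} \<or> (\<exists>v. V\<^sub>1 \<inter> S = {v})))" for V' and E' :: "'v set set"
  have "\<exists>E'. Q V E'"
  proof (rule grow_to_spanning[OF con, of Q V\<^sub>0 E\<^sub>0])
    show "Q V\<^sub>0 E\<^sub>0" unfolding Q_def using assms by blast
    show "V\<^sub>0 \<noteq> {}" using assms by (simp add: member_excess_def)
    fix V' E' v s
    assume Q: "Q V' E'" and "V' \<subseteq> V" and v: "v \<in> V'" and s: "s \<in> V - V'" and vs: "{v, s} \<in> E"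
    from Q obtain V\<^sub>1 E\<^sub>1 where 1: "V\<^sub>1 \<subseteq> V'" "E\<^sub>1 \<subseteq> E" "member_excess V\<^sub>1 E\<^sub>1 k"
       "V\<^sub>1 = V' \<and> V\<^sub>1 \<inter> S = {} \<or> (\<exists>v. V\<^sub>1 \<inter> S = {v})" unfolding Q_def by blast
    from 1(4) show "Q (insert s V') (insert {v, s} E')"
    proof
      assume eq: "V\<^sub>1 = V' \<and> V\<^sub>1 \<inter> S = {}"
      then have "member_excess (insert s V') (insert {v, s} E\<^sub>1) k"
        using member_pendant[OF 1(3), of v s] v s by auto
      moreover have "insert s V' \<inter> S = {} \<or> insert s V' \<inter> S = {s}" using eq by auto
      ultimately show ?thesis
        unfolding Q_def using 1(2) vs
        by (intro exI[of _ "insert s V'"] exI[of _ "insert {v, s} E\<^sub>1"] conjI) auto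
    next
      assume "\<exists>v. V\<^sub>1 \<inter> S = {v}"
      then show ?thesis unfolding Q_def using 1 by blast
    qed
  qed (use assms in auto)
  then obtain V\<^sub>1 E\<^sub>1 where "V\<^sub>1 \<subseteq> V" "E\<^sub>1 \<subseteq> E" "member_excess V\<^sub>1 E\<^sub>1 k" "V\<^sub>1 = V \<and> V\<^sub>1 \<inter> S = {} \<or> (\<exists>v. V\<^sub>1 \<inter> S = {v})"
    unfolding Q_def by blast
  with S show ?thesis by blast
qed

lemma member_cycle:
  assumes p: "joins p u v" and uv: "u \<noteq> v" "{u, v} \<notin> path_edges p"
  shows "member_excess (set p) (insert {u, v} (path_edges p)) 0"
proof -
  from p uv obtain p' where "p = u # p'" "p' \<noteq> []" by (cases p) (auto simp: joins_def split: if_splits)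
  with p obtain q where pq: "p = u # q @ [v]"
    by (cases p' rule: rev_cases) (auto simp: joins_def)
  have q: "q \<noteq> []" using uv by (auto simp: pq)
  have d: "internally_disjoint u v {[], q}"
    using p uv by (auto simp: internally_disjoint_def joins_def pq)
  have "theta_vertices u v {[], q} = set p" by (auto simp: theta_vertices_def pq)
  moreover have "theta_edges u v {[], q} = insert {u, v} (path_edges p)" by (auto simp: theta_edges_def pq)
  ultimately show ?thesis
    using theta[OF d] theta_simple[OF d] card_theta[OF d] q p by (auto simp: member_excess_def joins_def)
qed

text \<open>If \<open>p\<close> is closed up to a cycle by an edge joining its ends, then \<open>x\<close> and \<open>y\<close> split this cycle into the middle
  part of \<open>p\<close> and the path that runs from \<open>x\<close> back to the start, over the closing edge and from the end back
  to \<open>y\<close>.\<close>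

lemma outer_path:
  assumes "p = \<alpha> @ x # mid @ y # \<beta>"
  shows "path_edges (x # (rev \<alpha> @ rev \<beta>) @ [y]) \<subseteq> insert {hd p, last p} (path_edges p)"
proof -
  have "path_edges (x # (rev \<alpha> @ rev \<beta>) @ [y]) = path_edges (rev (\<alpha> @ [x]) @ rev (y # \<beta>))" by simp
  also have "\<dots> = insert {last (rev (\<alpha> @ [x])), hd (rev (y # \<beta>))} (path_edges (\<alpha> @ [x]) \<union> path_edges (y # \<beta>))"
    by (subst path_edges_append) (simp_all only: path_edges_rev rev_is_Nil_conv append_is_Nil_conv list.distinct simp_thms)
  also have "last (rev (\<alpha> @ [x])) = hd p" by (cases \<alpha>) (auto simp: assms)
  also have "hd (rev (y # \<beta>)) = last p" unfolding hd_rev by (simp add: assms)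
  also have "path_edges (\<alpha> @ [x]) \<union> path_edges (y # \<beta>) \<subseteq> path_edges p"
    using path_edges_append[of "\<alpha> @ [x]" "mid @ y # \<beta>"] path_edges_append[of mid "y # \<beta>"]
    by (cases "mid = []") (auto simp: assms)
  finally show ?thesis by blast
qed

text \<open>Two fundamental cycles with at least two common vertices. Here \<open>x\<close> and \<open>y\<close> are the first and the last
  vertex of \<open>p\<^sub>1\<close> on \<open>p\<^sub>2\<close>; they split the second cycle into two paths, and the outer part of the first
  cycle is a third path meeting the second cycle only in its ends. At most one of the three can be a single edge, since the
  closing edges are different and outside the tree.\<close>

lemma member_theta:
  assumes p\<^sub>1: "p\<^sub>1 = \<alpha>\<^sub>1 @ x # m\<^sub>1 @ y # \<beta>\<^sub>1" "distinct p\<^sub>1" and p\<^sub>2: "p\<^sub>2 = \<alpha>\<^sub>2 @ x # m\<^sub>2 @ y # \<beta>\<^sub>2" "distinct p\<^sub>2"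
    and disj: "set \<alpha>\<^sub>1 \<inter> set p\<^sub>2 = {}" "set \<beta>\<^sub>1 \<inter> set p\<^sub>2 = {}"
    and T: "path_edges p\<^sub>1 \<subseteq> T" "path_edges p\<^sub>2 \<subseteq> T"
    and f: "{hd p\<^sub>1, last p\<^sub>1} \<notin> T" "{hd p\<^sub>2, last p\<^sub>2} \<notin> T" "{hd p\<^sub>1, last p\<^sub>1} \<noteq> {hd p\<^sub>2, last p\<^sub>2}"
  shows "\<exists>V\<^sub>0\<subseteq>set p\<^sub>1 \<union> set p\<^sub>2. \<exists>E\<^sub>0\<subseteq>T \<union> {{hd p\<^sub>1, last p\<^sub>1}, {hd p\<^sub>2, last p\<^sub>2}}. member_excess V\<^sub>0 E\<^sub>0 1"
proof -
  define q\<^sub>1 where "q\<^sub>1 = rev \<alpha>\<^sub>1 @ rev \<beta>\<^sub>1"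
  define q\<^sub>2 where "q\<^sub>2 = rev \<alpha>\<^sub>2 @ rev \<beta>\<^sub>2"
  let ?Qs = "{m\<^sub>2, q\<^sub>2, q\<^sub>1}"
  have d: "internally_disjoint x y ?Qs"
    unfolding internally_disjoint_def q\<^sub>1_def q\<^sub>2_def using p\<^sub>1 p\<^sub>2 disj by auto
  have m: "path_edges (x # m\<^sub>2 @ [y]) \<subseteq> path_edges p\<^sub>2"
  proof -
    have "path_edges (x # m\<^sub>2 @ y # \<beta>\<^sub>2) \<subseteq> path_edges p\<^sub>2"
      using path_edges_append[of \<alpha>\<^sub>2 "x # m\<^sub>2 @ y # \<beta>\<^sub>2"] by (cases "\<alpha>\<^sub>2 = []") (auto simp: p\<^sub>2)
    moreover have "path_edges (x # m\<^sub>2 @ [y]) \<subseteq> path_edges (x # m\<^sub>2 @ y # \<beta>\<^sub>2)"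
      using path_edges_append[of "x # m\<^sub>2 @ [y]" \<beta>\<^sub>2] by (cases "\<beta>\<^sub>2 = []") auto
    ultimately show ?thesis by blast
  qed
  have o: "path_edges (x # q\<^sub>1 @ [y]) \<subseteq> insert {hd p\<^sub>1, last p\<^sub>1} (path_edges p\<^sub>1)"
    "path_edges (x # q\<^sub>2 @ [y]) \<subseteq> insert {hd p\<^sub>2, last p\<^sub>2} (path_edges p\<^sub>2)"
    unfolding q\<^sub>1_def q\<^sub>2_def using outer_path[OF p\<^sub>1(1)] outer_path[OF p\<^sub>2(1)] by auto
  have e1: "{hd p\<^sub>1, last p\<^sub>1} = {x, y}" if "q\<^sub>1 = []" using that by (auto simp: q\<^sub>1_def p\<^sub>1)
  have e2: "{hd p\<^sub>2, last p\<^sub>2} = {x, y}" if "q\<^sub>2 = []" using that by (auto simp: q\<^sub>2_def p\<^sub>2)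
  have em: "{x, y} \<in> T" if "m\<^sub>2 = []" using m T that by auto
  have dd: "q = [] \<and> q' = []" if "q = q'" "set q \<inter> set q' = {}" for q q' :: "'v list" using that by auto
  have "m\<^sub>2 \<noteq> q\<^sub>2"
  proof
    assume "m\<^sub>2 = q\<^sub>2"
    then have "m\<^sub>2 = [] \<and> q\<^sub>2 = []" by (rule dd) (use p\<^sub>2 in \<open>auto simp: q\<^sub>2_def\<close>)
    then show False using e2 em f by auto
  qed
  moreover have "m\<^sub>2 \<noteq> q\<^sub>1"
  proof
    assume "m\<^sub>2 = q\<^sub>1"
    then have "m\<^sub>2 = [] \<and> q\<^sub>1 = []" by (rule dd) (use p\<^sub>2 disj in \<open>auto simp: q\<^sub>1_def\<close>)
    then show False using e1 em f by auto
  qed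
  moreover have "q\<^sub>2 \<noteq> q\<^sub>1"
  proof
    assume "q\<^sub>2 = q\<^sub>1"
    then have "q\<^sub>2 = [] \<and> q\<^sub>1 = []" by (rule dd) (use p\<^sub>2 disj in \<open>auto simp: q\<^sub>1_def q\<^sub>2_def\<close>)
    then show False using e1 e2 f by auto
  qed
  ultimately have "card ?Qs = 3" by auto
  then have "member_excess (theta_vertices x y ?Qs) (theta_edges x y ?Qs) 1"
    using theta[OF d] theta_simple[OF d] card_theta[OF d] by (auto simp: member_excess_def theta_vertices_def)
  moreover have "theta_vertices x y ?Qs \<subseteq> set p\<^sub>1 \<union> set p\<^sub>2"
    by (auto simp: theta_vertices_def p\<^sub>1 p\<^sub>2 q\<^sub>1_def q\<^sub>2_def)
  moreover have "theta_edges x y ?Qs \<subseteq> T \<union> {{hd p\<^sub>1, last p\<^sub>1}, {hd p\<^sub>2, last p\<^sub>2}}"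
    using m o T unfolding theta_edges_def by blast
  ultimately show ?thesis by blast
qed

text \<open>A spanning tree misses two edges, each of which closes a cycle. If these cycles share at most one vertex,
  one of them is grown until it meets the other and the two are glued; otherwise their union contains a
  theta graph. In both cases the result has excess one and grows to the whole graph.\<close>

lemma bicyclic_member:
  assumes "bicyclic V E" shows "G V E"
proof -
  have con: "connected_graph V E" and cardE: "card E = card V + 1" using assms by (auto simp: bicyclic_def)
  have sg: "simple_graph V E" using con by (auto simp: connected_graph_def)
  then have finE: "finite E" by (auto simp: simple_graph_def intro: finite_subset[of _ "Pow V"])
  obtain T where T: "T \<subseteq> E" "card V = card T + 1"
    "\<And>u v. u \<in> V \<Longrightarrow> v \<in> V \<Longrightarrow> \<exists>p. joins p u v \<and> set p \<subseteq> V \<and> path_edges p \<subseteq> T"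
    using spanning_tree[OF con] by blast
  have "card (E - T) = 2" using T cardE finE by (subst card_Diff_subset) (auto intro: finite_subset)
  then obtain f\<^sub>1 f\<^sub>2 where f: "E - T = {f\<^sub>1, f\<^sub>2}" "f\<^sub>1 \<noteq> f\<^sub>2" by (auto simp: card_2_iff)
  have ends: "\<exists>u v. f = {u, v} \<and> u \<noteq> v \<and> u \<in> V \<and> v \<in> V" if "f \<in> E" for f
  proof -
    have "f \<subseteq> V" "card f = 2" using sg that by (auto simp: simple_graph_def)
    then show ?thesis unfolding card_2_iff by blast
  qed
  have f_T: "f\<^sub>1 \<notin> T" "f\<^sub>2 \<notin> T" "f\<^sub>1 \<in> E" "f\<^sub>2 \<in> E" using f by auto
  obtain u\<^sub>1 v\<^sub>1 where uv1: "f\<^sub>1 = {u\<^sub>1, v\<^sub>1}" "u\<^sub>1 \<noteq> v\<^sub>1" "u\<^sub>1 \<in> V" "v\<^sub>1 \<in> V"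
    using ends[OF f_T(3)] by blast
  obtain u\<^sub>2 v\<^sub>2 where uv2: "f\<^sub>2 = {u\<^sub>2, v\<^sub>2}" "u\<^sub>2 \<noteq> v\<^sub>2" "u\<^sub>2 \<in> V" "v\<^sub>2 \<in> V"
    using ends[OF f_T(4)] by blast
  note uv = uv1 uv2
  obtain p\<^sub>1 where p\<^sub>1: "joins p\<^sub>1 u\<^sub>1 v\<^sub>1" "set p\<^sub>1 \<subseteq> V" "path_edges p\<^sub>1 \<subseteq> T" using T(3) uv by blast
  obtain p\<^sub>2 where p\<^sub>2: "joins p\<^sub>2 u\<^sub>2 v\<^sub>2" "set p\<^sub>2 \<subseteq> V" "path_edges p\<^sub>2 \<subseteq> T" using T(3) uv by blast
  have c\<^sub>1: "member_excess (set p\<^sub>1) (insert f\<^sub>1 (path_edges p\<^sub>1)) 0"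
    using member_cycle[OF p\<^sub>1(1)] uv f_T p\<^sub>1 by auto
  have c\<^sub>2: "member_excess (set p\<^sub>2) (insert f\<^sub>2 (path_edges p\<^sub>2)) 0"
    using member_cycle[OF p\<^sub>2(1)] uv f_T p\<^sub>2 by auto
  have "\<exists>V\<^sub>0\<subseteq>V. \<exists>E\<^sub>0\<subseteq>E. member_excess V\<^sub>0 E\<^sub>0 1"
  proof (cases "set p\<^sub>2 \<inter> set p\<^sub>1 = {} \<or> (\<exists>v. set p\<^sub>2 \<inter> set p\<^sub>1 = {v})")
    case True
    have "\<exists>V\<^sub>1\<subseteq>V. \<exists>E\<^sub>1\<subseteq>E. member_excess V\<^sub>1 E\<^sub>1 0 \<and> (\<exists>v. V\<^sub>1 \<inter> set p\<^sub>1 = {v})"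
      by (rule member_hitting[OF con c\<^sub>2]) (use T p\<^sub>1 p\<^sub>2 f_T True in \<open>auto simp: joins_def\<close>)
    then obtain V\<^sub>1 E\<^sub>1 v where 1: "V\<^sub>1 \<subseteq> V" "E\<^sub>1 \<subseteq> E" "member_excess V\<^sub>1 E\<^sub>1 0" "V\<^sub>1 \<inter> set p\<^sub>1 = {v}" by blast
    let ?C = "insert f\<^sub>1 (path_edges p\<^sub>1)"
    have sg1: "simple_graph V\<^sub>1 E\<^sub>1" "simple_graph (set p\<^sub>1) ?C" using 1 c\<^sub>1 by (auto simp: member_excess_def)
    have "E\<^sub>1 \<inter> ?C = {}"
    proof (rule ccontr)
      assume "E\<^sub>1 \<inter> ?C \<noteq> {}"
      then obtain e where "e \<in> E\<^sub>1" "e \<in> ?C" by blast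
      with sg1 have "e \<subseteq> V\<^sub>1 \<inter> set p\<^sub>1" "card e = 2" unfolding simple_graph_def by blast+
      with 1(4) show False using card_mono[of "{v}" e] by simp
    qed
    moreover have "finite E\<^sub>1" using 1 finE finite_subset by blast
    moreover have "card (V\<^sub>1 \<union> set p\<^sub>1) + 1 = card V\<^sub>1 + card (set p\<^sub>1)"
      using card_Un_Int[of V\<^sub>1 "set p\<^sub>1"] 1 sg1 by (auto simp: simple_graph_def)
    ultimately have "card (E\<^sub>1 \<union> ?C) = card (V\<^sub>1 \<union> set p\<^sub>1) + 1"
      using 1 c\<^sub>1 card_Un_disjoint[of E\<^sub>1 ?C] by (auto simp: member_excess_def)
    moreover have "G (V\<^sub>1 \<union> set p\<^sub>1) (E\<^sub>1 \<union> ?C)"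
      by (rule glue[OF _ _ 1(4)]) (use 1(3) c\<^sub>1 in \<open>simp_all only: member_excess_def\<close>)
    moreover have "simple_graph (V\<^sub>1 \<union> set p\<^sub>1) (E\<^sub>1 \<union> ?C)"
      using sg1 unfolding simple_graph_def by blast
    ultimately have "member_excess (V\<^sub>1 \<union> set p\<^sub>1) (E\<^sub>1 \<union> ?C) 1" using 1 by (auto simp: member_excess_def)
    moreover have "V\<^sub>1 \<union> set p\<^sub>1 \<subseteq> V" "E\<^sub>1 \<union> ?C \<subseteq> E" using 1 p\<^sub>1 T f_T by auto
    ultimately show ?thesis by blast
  next
    case False
    then obtain a where "a \<in> set p\<^sub>1" "a \<in> set p\<^sub>2" by auto
    then obtain \<alpha> x r where 1: "p\<^sub>1 = \<alpha> @ x # r" "x \<in> set p\<^sub>2" "\<forall>z\<in>set \<alpha>. z \<notin> set p\<^sub>2"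
      using split_list_first_prop[of p\<^sub>1 "\<lambda>z. z \<in> set p\<^sub>2"] by blast
    with False have "\<exists>z\<in>set r. z \<in> set p\<^sub>2" by auto
    then obtain m y \<beta> where 2: "r = m @ y # \<beta>" "y \<in> set p\<^sub>2" "\<forall>z\<in>set \<beta>. z \<notin> set p\<^sub>2"
      using split_list_last_prop[of r "\<lambda>z. z \<in> set p\<^sub>2"] by blast
    have p1: "p\<^sub>1 = \<alpha> @ x # m @ y # \<beta>" using 1 2 by simp
    have xy: "x \<noteq> y" using p\<^sub>1(1) by (auto simp: joins_def p1)
    have ends: "{hd p\<^sub>1, last p\<^sub>1} = f\<^sub>1" "{hd p\<^sub>2, last p\<^sub>2} = f\<^sub>2" "{hd (rev p\<^sub>2), last (rev p\<^sub>2)} = f\<^sub>2"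
      and dist: "distinct p\<^sub>1" "distinct p\<^sub>2"
      using p\<^sub>1 p\<^sub>2 uv by (auto simp: joins_def hd_rev last_rev)
    note th = member_theta[OF p1 dist(1), where T = T]
    obtain \<gamma> \<delta> where 3: "p\<^sub>2 = \<gamma> @ x # \<delta>" using 1(2) split_list by metis
    consider "y \<in> set \<delta>" | "y \<in> set \<gamma>" using 2(2) xy by (auto simp: 3)
    then have "\<exists>V\<^sub>0\<subseteq>set p\<^sub>1 \<union> set p\<^sub>2. \<exists>E\<^sub>0\<subseteq>T \<union> {f\<^sub>1, f\<^sub>2}. member_excess V\<^sub>0 E\<^sub>0 1"
    proof cases
      case 1
      then obtain m' \<delta>' where "\<delta> = m' @ y # \<delta>'" using split_list by metis
      then have "p\<^sub>2 = \<gamma> @ x # m' @ y # \<delta>'" by (simp add: 3)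
      from th[OF this dist(2)] show ?thesis
        using \<open>\<forall>z\<in>set \<alpha>. z \<notin> set p\<^sub>2\<close> 2(3) p\<^sub>1(3) p\<^sub>2(3) f_T f(2) unfolding ends by blast
    next
      case 2
      then obtain m' \<gamma>' where "\<gamma> = \<gamma>' @ y # m'" using split_list by metis
      then have "rev p\<^sub>2 = rev \<delta> @ x # rev m' @ y # rev \<gamma>'" by (simp add: 3)
      from th[OF this] show ?thesis
        using \<open>\<forall>z\<in>set \<alpha>. z \<notin> set p\<^sub>2\<close> \<open>\<forall>z\<in>set \<beta>. z \<notin> set p\<^sub>2\<close> p\<^sub>1(3) p\<^sub>2(3) f_T f(2) dist
        unfolding ends set_rev distinct_rev path_edges_rev by blast
    qed
    moreover have "set p\<^sub>1 \<union> set p\<^sub>2 \<subseteq> V" "T \<union> {f\<^sub>1, f\<^sub>2} \<subseteq> E" using p\<^sub>1 p\<^sub>2 T f_T by auto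
    ultimately show ?thesis by (meson order_trans)
  qed
  then obtain V\<^sub>0 E\<^sub>0 where "V\<^sub>0 \<subseteq> V" "E\<^sub>0 \<subseteq> E" "member_excess V\<^sub>0 E\<^sub>0 1" by blast
  then obtain E' where E': "E' \<subseteq> E" "member_excess V E' 1" using member_spanning[OF con] by blast
  then have "E' = E" using finE cardE by (intro card_subset_eq) (auto simp: member_excess_def)
  with E' show ?thesis by (simp add: member_excess_def)
qed

end

section \<open>Weighted graph integrals\<close>

text \<open>The unspecified choice in the definition of \<^const>\<open>edge_val\<close> depends on the edge alone, so that all
  kernels and all assignments use the same ordering of the endpoints.\<close>

lemma edge_val_ends:
  fixes e :: "'v set"
  assumes "e = {u, v}"
  obtains u' v' where "e = {u', v'}" "\<And>g (x :: 'v \<Rightarrow> real). edge_val g x e = g (x u', x v')"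
proof -
  obtain u' v' where s: "(SOME (u', v'). e = {u', v'}) = (u', v')" by (meson surj_pair)
  have "case (SOME (u', v'). e = {u', v'}) of (u', v') \<Rightarrow> e = {u', v'}"
    by (rule someI[of "\<lambda>(u', v'). e = {u', v'}" "(u, v)"]) (simp add: assms)
  with s have "e = {u', v'}" by simp
  then show ?thesis by (rule that) (simp only: edge_val_def s Let_def prod.case)
qed

lemma edge_val_eq:
  assumes "g (x u, x v) = g (x v, x u)" shows "edge_val g x {u, v} = g (x u, x v)"
  using edge_val_ends[OF refl, of u v] assms by (metis doubleton_eq_iff)

lemma edge_val_cong:
  assumes "card e = 2" "\<And>v. v \<in> e \<Longrightarrow> x v = y v"
  shows "edge_val g x e = edge_val g y e"
proof -
  obtain u v where "e = {u, v}" using assms(1) by (auto simp: card_2_iff)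
  then show ?thesis by (rule edge_val_ends) (use assms(2) in auto)
qed

lemma edge_val_at_pair:
  assumes "card e = 2" "e \<subseteq> V" "x \<in> space (PiM V (\<lambda>_. M))"
  obtains p where "p \<in> space (M \<Otimes>\<^sub>M M)" "\<And>g. edge_val g x e = g p"
proof -
  obtain u v where "e = {u, v}" using assms(1) by (auto simp: card_2_iff)
  then obtain u' v' where uv: "e = {u', v'}" "\<And>g. edge_val g x e = g (x u', x v')"
    by (rule edge_val_ends) blast
  with assms have "(x u', x v') \<in> space (M \<Otimes>\<^sub>M M)" by (auto simp: space_PiM space_pair_measure)
  then show ?thesis by (rule that) (rule uv)
qed

lemma pos_weight_cong:
  assumes "pos_weight X f" "\<And>x. x \<in> space X \<Longrightarrow> f x = g x" shows "pos_weight X g"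
  using assms measurable_cong[of X f g borel] unfolding pos_weight_def by auto

context factored_density begin

abbreviation cube :: "'v set \<Rightarrow> ('v \<Rightarrow> real) measure" where
  "cube V \<equiv> PiM V (\<lambda>_. M)"

lemma product_prob: "product_prob_space (\<lambda>_::'v. M)" ..

lemma prob_cube: "prob_space (cube V)"
  by (intro prob_space_PiM prob_space_axioms)

lemma cube_component: "x \<in> space (cube V) \<Longrightarrow> v \<in> V \<Longrightarrow> x v \<in> space M"
  by (auto simp: space_PiM)

lemma pos_weight_component: "v \<in> V \<Longrightarrow> pos_weight M w \<Longrightarrow> pos_weight (cube V) (\<lambda>x. w (x v))"
  by (erule pos_weight_comp) simp

lemma edge_val_K:
  "x \<in> space (cube V) \<Longrightarrow> u \<in> V \<Longrightarrow> v \<in> V \<Longrightarrow> edge_val K x {u, v} = K (x u, x v)"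
  by (intro edge_val_eq K_sym cube_component)

lemma pos_weight_edge_val:
  assumes "e \<subseteq> V" "card e = 2" shows "pos_weight (cube V) (\<lambda>x. edge_val K x e)"
proof -
  obtain u v where e: "e = {u, v}" using assms(2) by (auto simp: card_2_iff)
  have "pos_weight (cube V) (\<lambda>x. K (x u, x v))"
    using assms e by (intro K_comp) auto
  then show ?thesis
    by (rule pos_weight_cong) (use assms e in \<open>auto simp: edge_val_K\<close>)
qed

text \<open>Integrating out the interior vertices of a path, one by one from its start, replaces the path by its kernel.
  The restriction expresses that \<open>\<Psi>\<close> does not depend on the interior vertices.\<close>

lemma integral_add_path:
  fixes V :: "'v set"
  assumes "finite V" "a \<in> V" "b \<in> V" "a \<noteq> b" "distinct q" "set q \<inter> V = {}"
    and "pos_weight (cube V) \<Psi>" and "\<And>s. s \<in> set q \<Longrightarrow> pos_weight M (w s)"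
  shows "(\<integral>x. \<Psi> (restrict x V) * ((\<Prod>e\<in>path_edges (a # q @ [b]). edge_val K x e) * (\<Prod>s\<in>set q. w s (x s))) \<partial>cube (V \<union> set q))
    = (\<integral>x. \<Psi> x * path_kernel (map w q) (x a, x b) \<partial>cube V)"
  using assms
proof (induction q arbitrary: V a \<Psi>)
  case Nil
  then show ?case
    by (intro Bochner_Integration.integral_cong) (auto simp: edge_val_K space_PiM)
next
  case (Cons s q)
  interpret PP: product_prob_space "\<lambda>_::'v. M" by (rule product_prob)
  let ?V = "insert s V"
  interpret PV: prob_space "cube ?V" by (rule prob_cube)
  define \<Psi>' where "\<Psi>' y = \<Psi> (restrict y V) * (K (y a, y s) * w s (y s))" for y
  from Cons.prems have s: "s \<notin> V" "s \<notin> set q" "a \<noteq> s" "b \<noteq> s" "a \<notin> set q" by auto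
  have ws: "weights (map w q)" using Cons.prems by (auto simp: weights_def)
  have \<Psi>': "pos_weight (cube ?V) \<Psi>'"
    unfolding \<Psi>'_def using Cons.prems
    by (intro pos_weight_mult pos_weight_component K_comp pos_weight_comp[OF \<open>pos_weight (cube V) \<Psi>\<close>]) auto
  have pk: "pos_weight (cube ?V) (\<lambda>y. path_kernel (map w q) (y s, y b))"
    using Cons.prems by (intro path_kernel_comp ws) auto
  have notin: "{a, s} \<notin> path_edges (s # q @ [b])"
    using path_edges_subset[of "{a, s}" "s # q @ [b]"] s Cons.prems by auto
  have "(\<integral>x. \<Psi> (restrict x V) * ((\<Prod>e\<in>path_edges (a # (s # q) @ [b]). edge_val K x e) * (\<Prod>s\<in>set (s # q). w s (x s))) \<partial>cube (V \<union> set (s # q)))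
     = (\<integral>x. \<Psi>' (restrict x ?V) * ((\<Prod>e\<in>path_edges (s # q @ [b]). edge_val K x e) * (\<Prod>s\<in>set q. w s (x s))) \<partial>cube (?V \<union> set q))"
    using notin s Cons.prems
    by (intro Bochner_Integration.integral_cong)
       (auto simp: \<Psi>'_def edge_val_K Int_absorb1 subset_insertI Int_insert_left)
  also have "\<dots> = (\<integral>y. \<Psi>' y * path_kernel (map w q) (y s, y b) \<partial>cube ?V)"
    using Cons.prems s by (intro Cons.IH \<Psi>') auto
  also have "\<dots> = (\<integral>x. (\<integral>t. \<Psi>' (x(s := t)) * path_kernel (map w q) ((x(s := t)) s, (x(s := t)) b) \<partial>M) \<partial>cube V)"
    using Cons.prems s
    by (intro PP.product_integral_insert PV.pos_weight_integrable pos_weight_mult \<Psi>' pk) auto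
  also have "\<dots> = (\<integral>x. \<Psi> x * path_kernel (map w (s # q)) (x a, x b) \<partial>cube V)"
  proof (rule Bochner_Integration.integral_cong[OF refl])
    fix x assume x: "x \<in> space (cube V)"
    then have r: "restrict (x(s := t)) V = x" for t
      using s by (auto simp: space_PiM PiE_def extensional_def fun_eq_iff)
    show "(\<integral>t. \<Psi>' (x(s := t)) * path_kernel (map w q) ((x(s := t)) s, (x(s := t)) b) \<partial>M)
      = \<Psi> x * path_kernel (map w (s # q)) (x a, x b)"
      using s by (simp add: \<Psi>'_def r mult.assoc)
  qed
  finally show ?case .
qed

lemma integral_add_paths:
  fixes V :: "'v set"
  assumes Qs: "finite Qs" and V: "finite V" "a \<in> V" "b \<in> V" "a \<noteq> b"
    and "\<And>q. q \<in> Qs \<Longrightarrow> distinct q \<and> set q \<inter> V = {}"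
    and "\<And>q q'. q \<in> Qs \<Longrightarrow> q' \<in> Qs \<Longrightarrow> q \<noteq> q' \<Longrightarrow> set q \<inter> set q' = {}"
    and "pos_weight (cube V) \<Psi>" and "\<And>q s. q \<in> Qs \<Longrightarrow> s \<in> set q \<Longrightarrow> pos_weight M (w s)"
  shows "(\<integral>x. \<Psi> (restrict x V) * (\<Prod>q\<in>Qs. (\<Prod>e\<in>path_edges (a # q @ [b]). edge_val K x e) * (\<Prod>s\<in>set q. w s (x s)))
            \<partial>cube (V \<union> (\<Union>q\<in>Qs. set q)))
    = (\<integral>x. \<Psi> x * (\<Prod>q\<in>Qs. path_kernel (map w q) (x a, x b)) \<partial>cube V)"
  using Qs assms(6-)
proof (induction Qs arbitrary: \<Psi>)
  case empty
  show ?case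
    by (intro Bochner_Integration.integral_cong) (auto simp: space_PiM)
next
  case (insert q Qs)
  let ?V = "V \<union> (\<Union>q\<in>Qs. set q)"
  let ?A = "\<lambda>x q. (\<Prod>e\<in>path_edges (a # q @ [b]). edge_val K x e) * (\<Prod>s\<in>set q. w s (x s))"
  define \<Psi>' where "\<Psi>' y = \<Psi> (restrict y V) * (\<Prod>q\<in>Qs. ?A y q)" for y
  have dist: "distinct (a # p @ [b])" if "p \<in> insert q Qs" for p
    using insert.prems(1)[OF that] V by auto
  have sub: "set (a # p @ [b]) \<subseteq> ?V" if "p \<in> Qs" for p using that V by auto
  have \<Psi>': "pos_weight (cube ?V) \<Psi>'"
    unfolding \<Psi>'_def
  proof (intro pos_weight_mult pos_weight_prod pos_weight_comp[OF \<open>pos_weight (cube V) \<Psi>\<close>])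
    show "(\<lambda>x. restrict x V) \<in> cube ?V \<rightarrow>\<^sub>M cube V" by (rule measurable_restrict_subset) auto
    fix p e assume p: "p \<in> Qs" and e: "e \<in> path_edges (a # p @ [b])"
    show "pos_weight (cube ?V) (\<lambda>x. edge_val K x e)"
      using path_edges_subset[OF e] sub[OF p] path_edges_card[OF dist e] p
      by (intro pos_weight_edge_val) auto
  next
    fix p s assume "p \<in> Qs" "s \<in> set p"
    then show "pos_weight (cube ?V) (\<lambda>x. w s (x s))"
      using insert.prems(4)[of p s] by (intro pos_weight_component) auto
  qed
  have A_restrict: "?A (restrict x ?V) p = ?A x p" if "p \<in> Qs" for x p
  proof (intro arg_cong2[of _ _ _ _ "(*)"] prod.cong refl)
    fix e assume e: "e \<in> path_edges (a # p @ [b])"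
    then show "edge_val K (restrict x ?V) e = edge_val K x e"
      using path_edges_subset[OF e] sub[OF that] that path_edges_card[OF dist e]
      by (intro edge_val_cong) auto
  qed (use that in auto)
  have wq: "weights (map w q)" using insert.prems(4) by (auto simp: weights_def)
  have "(\<integral>x. \<Psi> (restrict x V) * (\<Prod>q\<in>insert q Qs. ?A x q) \<partial>cube (V \<union> (\<Union>q\<in>insert q Qs. set q)))
      = (\<integral>x. \<Psi>' (restrict x ?V) * ?A x q \<partial>cube (?V \<union> set q))"
    using insert.hyps
    by (intro Bochner_Integration.integral_cong)
       (auto simp: \<Psi>'_def A_restrict Int_absorb1 Un_ac simp del: restrict_apply cong: prod.cong)
  also have "\<dots> = (\<integral>x. \<Psi>' x * path_kernel (map w q) (x a, x b) \<partial>cube ?V)"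
  proof (rule integral_add_path[OF _ _ _ V(4)])
    show "set q \<inter> ?V = {}"
      using insert.prems(1)[of q] insert.prems(2)[of q] insert.hyps by fastforce
    show "pos_weight M (w s)" if "s \<in> set q" for s
      using insert.prems(4) that by blast
  qed (use insert V \<Psi>' in auto)
  also have "\<dots> = (\<integral>x. (\<lambda>y. \<Psi> y * path_kernel (map w q) (y a, y b)) (restrict x V) * (\<Prod>q\<in>Qs. ?A x q) \<partial>cube ?V)"
    using V by (intro Bochner_Integration.integral_cong) (auto simp: \<Psi>'_def mult_ac)
  also have "\<dots> = (\<integral>x. (\<lambda>y. \<Psi> y * path_kernel (map w q) (y a, y b)) x * (\<Prod>q\<in>Qs. path_kernel (map w q) (x a, x b)) \<partial>cube V)"
  proof (rule insert.IH)
    show "pos_weight (cube V) (\<lambda>y. \<Psi> y * path_kernel (map w q) (y a, y b))"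
      using insert.prems(3) V by (intro pos_weight_mult path_kernel_comp wq) auto
    show "pos_weight M (w s)" if "p \<in> Qs" "s \<in> set p" for p s
      using insert.prems(4) that by blast
  qed (use insert.prems(1,2) in auto)
  also have "\<dots> = (\<integral>x. \<Psi> x * (\<Prod>q\<in>insert q Qs. path_kernel (map w q) (x a, x b)) \<partial>cube V)"
    using insert.hyps by (simp add: mult.assoc)
  finally show ?case .
qed

lemma integral_two_vertices:
  fixes a b :: 'v
  assumes "a \<noteq> b" "pos_weight (M \<Otimes>\<^sub>M M) F"
  shows "(\<integral>x. F (x a, x b) \<partial>cube {a, b}) = (\<integral>p. F p \<partial>(M \<Otimes>\<^sub>M M))"
proof -
  interpret PP: product_prob_space "\<lambda>_::'v. M" by (rule product_prob)
  interpret PV: prob_space "cube {a, b}" by (rule prob_cube)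
  have "pos_weight (cube {a, b}) (\<lambda>x. F (x a, x b))"
    by (rule pos_weight_comp[OF assms(2)]) auto
  then have "(\<integral>x. F (x a, x b) \<partial>cube {a, b}) = (\<integral>x. (\<integral>t. F ((x(a := t)) a, (x(a := t)) b) \<partial>M) \<partial>cube {b})"
    using assms(1) by (intro PP.product_integral_insert PV.pos_weight_integrable) auto
  also have "\<dots> = (\<integral>x. (\<lambda>s. \<integral>t. F (t, s) \<partial>M) (x b) \<partial>cube {b})"
    using assms(1) by simp
  also have "\<dots> = (\<integral>s. (\<integral>t. F (t, s) \<partial>M) \<partial>M)"
  proof (rule PP.product_integral_singleton)
    have "pos_weight (M \<Otimes>\<^sub>M M) (\<lambda>p. F (snd p, fst p))"
      by (rule pos_weight_comp[OF assms(2)]) measurable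
    from pos_weight_integral[OF this] show "(\<lambda>s. \<integral>t. F (t, s) \<partial>M) \<in> borel_measurable M"
      by (simp add: pos_weight_measurable)
  qed
  also have "\<dots> = (\<integral>p. F p \<partial>(M \<Otimes>\<^sub>M M))"
    using P.integral_snd[of "curry F"] P.pos_weight_integrable[OF assms(2)] by simp
  finally show ?thesis .
qed

definition weighted_count :: "('v \<Rightarrow> real \<Rightarrow> real) \<Rightarrow> 'v set \<Rightarrow> 'v set set \<Rightarrow> real" where
  "weighted_count w V E = (\<integral>x. (\<Prod>e\<in>E. edge_val K x e) * (\<Prod>v\<in>V. w v (x v)) \<partial>cube V)"

text \<open>With weights whose product is one, the exponent is \<open>0\<close>. Allowing arbitrary weights is what makes this
  property stable under gluing.\<close>

definition good :: "'v set \<Rightarrow> 'v set set \<Rightarrow> bool" where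
  "good V E \<longleftrightarrow> simple_graph V E \<and> (\<forall>w. (\<forall>v\<in>V. pos_weight M (w v)) \<longrightarrow>
     exp (\<Sum>v\<in>V. mean_log (w v)) \<le> weighted_count w V E)"

lemma pos_weight_graph:
  assumes "simple_graph V E"
  shows "pos_weight (cube V) (\<lambda>x. \<Prod>e\<in>E. edge_val K x e)"
  using assms unfolding simple_graph_def by (intro pos_weight_prod pos_weight_edge_val) auto

lemma good_theta:
  fixes a b :: 'v
  assumes "internally_disjoint a b Qs"
  shows "good (theta_vertices a b Qs) (theta_edges a b Qs)"
proof -
  have Qs: "finite Qs" "Qs \<noteq> {}" and ab: "a \<noteq> b" and q: "\<And>q. q \<in> Qs \<Longrightarrow> distinct (a # q @ [b])"
    and disj: "\<And>q q'. q \<in> Qs \<Longrightarrow> q' \<in> Qs \<Longrightarrow> q \<noteq> q' \<Longrightarrow> set q \<inter> set q' = {}"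
    using assms unfolding internally_disjoint_def by blast+
  let ?U = "\<Union>q\<in>Qs. set q" and ?E = "\<Union>q\<in>Qs. path_edges (a # q @ [b])"
  let ?V = "{a, b} \<union> ?U"
  note sg = theta_simple[OF assms, unfolded theta_vertices_def theta_edges_def]
  note edisj = theta_edges_disjoint[OF assms]
  show ?thesis
    unfolding good_def theta_vertices_def theta_edges_def
  proof (intro conjI sg allI impI)
    fix w assume w: "\<forall>v\<in>?V. pos_weight M (w v)"
    have ws: "weights (map w p)" if "p \<in> Qs" for p using w that by (auto simp: weights_def)
    have wab: "pos_weight M (w a)" "pos_weight M (w b)" using w by auto
    have nab: "a \<notin> ?U" "b \<notin> ?U" using q by auto
    have fin: "finite ?U" using Qs by auto
    let ?\<Psi> = "\<lambda>x. w a (x a) * w b (x b)"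
    have \<Psi>: "pos_weight (cube {a, b}) ?\<Psi>"
      using w by (intro pos_weight_mult pos_weight_component) auto
    have sum_eq: "(\<Sum>v\<in>?V. mean_log (w v)) = mean_log (w a) + mean_log (w b) + (\<Sum>p\<in>Qs. \<Sum>u\<leftarrow>map w p. mean_log u)"
    proof -
      have "(\<Sum>v\<in>?V. mean_log (w v)) = mean_log (w a) + mean_log (w b) + (\<Sum>v\<in>?U. mean_log (w v))"
        using nab ab fin by simp
      also have "(\<Sum>v\<in>?U. mean_log (w v)) = (\<Sum>p\<in>Qs. \<Sum>v\<in>set p. mean_log (w v))"
        using Qs disj by (intro sum.UNION_disjoint) auto
      also have "\<dots> = (\<Sum>p\<in>Qs. \<Sum>u\<leftarrow>map w p. mean_log u)"
        using q by (intro sum.cong) (auto simp: sum_list_distinct_conv_sum_set comp_def)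
      finally show ?thesis .
    qed
    have "weighted_count w ?V ?E = (\<integral>x. ?\<Psi> (restrict x {a, b}) *
        (\<Prod>q\<in>Qs. (\<Prod>e\<in>path_edges (a # q @ [b]). edge_val K x e) * (\<Prod>s\<in>set q. w s (x s))) \<partial>cube ?V)"
    proof -
      have "(\<Prod>e\<in>?E. edge_val K x e) = (\<Prod>q\<in>Qs. \<Prod>e\<in>path_edges (a # q @ [b]). edge_val K x e)" for x
        using Qs edisj by (intro prod.UNION_disjoint) auto
      moreover have "(\<Prod>v\<in>?V. w v (x v)) = ?\<Psi> (restrict x {a, b}) * (\<Prod>q\<in>Qs. \<Prod>s\<in>set q. w s (x s))" for x
      proof -
        have "(\<Prod>v\<in>?U. w v (x v)) = (\<Prod>p\<in>Qs. \<Prod>v\<in>set p. w v (x v))"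
          using Qs disj by (intro prod.UNION_disjoint) auto
        then show ?thesis using nab ab fin by simp
      qed
      ultimately show ?thesis
        unfolding weighted_count_def by (simp only: prod.distrib mult_ac)
    qed
    also have "\<dots> = (\<integral>x. ?\<Psi> x * (\<Prod>q\<in>Qs. path_kernel (map w q) (x a, x b)) \<partial>cube {a, b})"
      by (rule integral_add_paths) (use Qs ab q disj \<Psi> w in auto)
    also have "\<dots> = (\<integral>p. w a (fst p) * w b (snd p) * (\<Prod>q\<in>Qs. path_kernel (map w q) p) \<partial>(M \<Otimes>\<^sub>M M))"
    proof -
      have "pos_weight (M \<Otimes>\<^sub>M M) (\<lambda>p. w a (fst p) * w b (snd p) * (\<Prod>q\<in>Qs. path_kernel (map w q) p))"
        by (intro pos_weight_mult pos_weight_prod path_kernel[OF ws] pos_weight_comp[OF wab(1)]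
             pos_weight_comp[OF wab(2)] measurable_fst measurable_snd)
      from integral_two_vertices[OF ab this] show ?thesis by simp
    qed
    finally have count_eq: "weighted_count w ?V ?E = \<dots>" .
    show "exp (\<Sum>v\<in>?V. mean_log (w v)) \<le> weighted_count w ?V ?E"
      unfolding sum_eq count_eq by (rule parallel_paths[OF Qs ws wab])
  qed
qed

lemma integral_glue:
  fixes V\<^sub>1 V\<^sub>2 :: "'v set"
  assumes fin: "finite V\<^sub>1" "finite V\<^sub>2" and V: "V\<^sub>1 \<inter> V\<^sub>2 = {v}"
    and F: "pos_weight (cube V\<^sub>1) F\<^sub>1" "pos_weight (cube V\<^sub>2) F\<^sub>2"
  shows "(\<integral>x. F\<^sub>1 (restrict x V\<^sub>1) * F\<^sub>2 (restrict x V\<^sub>2) \<partial>cube (V\<^sub>1 \<union> V\<^sub>2))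
    = (\<integral>x. F\<^sub>1 x * (\<integral>y. F\<^sub>2 (y(v := x v)) \<partial>cube (V\<^sub>2 - {v})) \<partial>cube V\<^sub>1)"
proof -
  interpret PP: product_prob_space "\<lambda>_::'v. M" by (rule product_prob)
  let ?W = "V\<^sub>2 - {v}"
  let ?f = "\<lambda>x. F\<^sub>1 (restrict x V\<^sub>1) * F\<^sub>2 (restrict x V\<^sub>2)"
  interpret PV: prob_space "cube (V\<^sub>1 \<union> ?W)" by (rule prob_cube)
  have un: "V\<^sub>1 \<union> V\<^sub>2 = V\<^sub>1 \<union> ?W" and v: "v \<in> V\<^sub>1" "v \<in> V\<^sub>2" using V by auto
  have "pos_weight (cube (V\<^sub>1 \<union> ?W)) ?f"
    using v by (intro pos_weight_mult pos_weight_comp[OF F(1)] pos_weight_comp[OF F(2)] measurable_restrict_subset) auto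
  then have "(\<integral>x. ?f x \<partial>cube (V\<^sub>1 \<union> ?W)) = (\<integral>x. (\<integral>y. ?f (merge V\<^sub>1 ?W (x, y)) \<partial>cube ?W) \<partial>cube V\<^sub>1)"
    using fin V by (intro PP.product_integral_fold PV.pos_weight_integrable) auto
  also have "\<dots> = (\<integral>x. F\<^sub>1 x * (\<integral>y. F\<^sub>2 (y(v := x v)) \<partial>cube ?W) \<partial>cube V\<^sub>1)"
  proof (rule Bochner_Integration.integral_cong[OF refl])
    fix x assume x: "x \<in> space (cube V\<^sub>1)"
    have 1: "restrict (merge V\<^sub>1 ?W (x, y)) V\<^sub>1 = x" for y
      using x by (auto simp: space_PiM PiE_def extensional_def fun_eq_iff merge_def)
    have 2: "restrict (merge V\<^sub>1 ?W (x, y)) V\<^sub>2 = y(v := x v)" if "y \<in> space (cube ?W)" for y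
      using that V v by (auto simp: space_PiM PiE_def extensional_def fun_eq_iff merge_def)
    have "(\<integral>y. ?f (merge V\<^sub>1 ?W (x, y)) \<partial>cube ?W) = (\<integral>y. F\<^sub>1 x * F\<^sub>2 (y(v := x v)) \<partial>cube ?W)"
      by (intro Bochner_Integration.integral_cong) (auto simp: 1 2)
    then show "(\<integral>y. ?f (merge V\<^sub>1 ?W (x, y)) \<partial>cube ?W) = F\<^sub>1 x * (\<integral>y. F\<^sub>2 (y(v := x v)) \<partial>cube ?W)"
      by simp
  qed
  finally show ?thesis by (simp add: un)
qed

lemma edge_val_restrict:
  "simple_graph V E \<Longrightarrow> e \<in> E \<Longrightarrow> edge_val g (restrict x V) e = edge_val g x e"
  by (intro edge_val_cong) (auto simp: simple_graph_def)

text \<open>Let \<open>B\<close> be the integral of the second graph as a function of the position of the common vertex. It acts as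
  an additional weight there in the first graph, so a lower bound for \<open>mean_log B\<close> is needed. It comes from the second
  graph itself, with the weight \<open>\<rho> / B\<close> at the common vertex: then the integral is \<open>\<integral> \<rho> = 1\<close>, hence the
  exponent in its lower bound is at most \<open>0\<close>.\<close>

lemma good_glue:
  fixes V\<^sub>1 V\<^sub>2 :: "'v set"
  assumes 1: "good V\<^sub>1 E\<^sub>1" and 2: "good V\<^sub>2 E\<^sub>2" and V: "V\<^sub>1 \<inter> V\<^sub>2 = {v}"
  shows "good (V\<^sub>1 \<union> V\<^sub>2) (E\<^sub>1 \<union> E\<^sub>2)"
proof -
  let ?W = "V\<^sub>2 - {v}"
  have sg: "simple_graph V\<^sub>1 E\<^sub>1" "simple_graph V\<^sub>2 E\<^sub>2" using 1 2 by (auto simp: good_def)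
  then have fin: "finite V\<^sub>1" "finite V\<^sub>2" by (auto simp: simple_graph_def)
  have finE: "finite E\<^sub>1" "finite E\<^sub>2" using sg by (auto intro: simple_graph_finite_edges)
  have v: "v \<in> V\<^sub>1" "v \<in> V\<^sub>2" using V by auto
  have Edisj: "E\<^sub>1 \<inter> E\<^sub>2 = {}"
  proof (rule ccontr)
    assume "E\<^sub>1 \<inter> E\<^sub>2 \<noteq> {}"
    then obtain e where e: "e \<in> E\<^sub>1" "e \<in> E\<^sub>2" by blast
    then have "e \<subseteq> V\<^sub>1 \<inter> V\<^sub>2" "card e = 2" using sg by (auto simp: simple_graph_def)
    then have "e \<subseteq> {v}" "card e = 2" using V by auto
    then show False using card_mono[of "{v}" e] by simp
  qed
  have un: "insert v ?W = V\<^sub>2" using v by auto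
  show ?thesis
    unfolding good_def
  proof (intro conjI allI impI)
    show "simple_graph (V\<^sub>1 \<union> V\<^sub>2) (E\<^sub>1 \<union> E\<^sub>2)"
      using sg by (auto simp: simple_graph_def)
    fix w assume w: "\<forall>u\<in>V\<^sub>1 \<union> V\<^sub>2. pos_weight M (w u)"
    define F where "F = (\<lambda>y. (\<Prod>e\<in>E\<^sub>2. edge_val K y e) * (\<Prod>u\<in>?W. w u (y u)))"
    define B where "B t = (\<integral>y. F (y(v := t)) \<partial>cube ?W)" for t
    interpret PW: prob_space "cube ?W" by (rule prob_cube)
    interpret PP: product_prob_space "\<lambda>_::'v. M" by (rule product_prob)
    have F: "pos_weight (cube V\<^sub>2) F"
      unfolding F_def using w by (intro pos_weight_mult pos_weight_prod pos_weight_graph sg pos_weight_component) auto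
    have "(\<lambda>p. (snd p)(v := fst p)) \<in> M \<Otimes>\<^sub>M cube ?W \<rightarrow>\<^sub>M cube V\<^sub>2"
      using measurable_compose[OF measurable_pair_swap' measurable_add_dim[of v ?W "\<lambda>_. M"]]
      by (simp only: un split_beta' fst_conv snd_conv)
    from PW.pos_weight_integral[OF pos_weight_comp[OF F this]]
    have B: "pos_weight M B" by (simp add: B_def[abs_def])
    have F_restrict: "F (restrict x V\<^sub>2) = F x" for x
      unfolding F_def using sg(2) by (auto simp: edge_val_restrict cong: prod.cong intro!: arg_cong2[of _ _ _ _ "(*)"] prod.cong)
    have split2: "(\<integral>x. F\<^sub>1 (restrict x V) * F x \<partial>cube (V \<union> V\<^sub>2)) = (\<integral>x. F\<^sub>1 x * B (x v) \<partial>cube V)"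
      if "finite V" "V \<inter> V\<^sub>2 = {v}" "pos_weight (cube V) F\<^sub>1" for V F\<^sub>1
      using integral_glue[OF that(1) fin(2) that(2) that(3) F] by (simp add: F_restrict B_def)
    have mean_B: "(\<Sum>u\<in>?W. mean_log (w u)) \<le> mean_log B"
    proof -
      define w' where "w' = w(v := (\<lambda>t. \<rho> t / B t))"
      have pr: "pos_weight M (\<lambda>t. \<rho> t / B t)" by (intro pos_weight_divide \<rho> B)
      have w': "\<forall>u\<in>V\<^sub>2. pos_weight M (w' u)" using w pr by (auto simp: w'_def)
      have "(\<Prod>u\<in>V\<^sub>2. w' u (x u)) = \<rho> (x v) / B (x v) * (\<Prod>u\<in>?W. w u (x u))" for x
        using fin v by (subst prod.remove[of _ v]) (auto simp: w'_def intro!: prod.cong)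
      then have "weighted_count w' V\<^sub>2 E\<^sub>2 = (\<integral>x. (\<lambda>y. \<rho> (y v) / B (y v)) (restrict x {v}) * F x \<partial>cube ({v} \<union> V\<^sub>2))"
        using v by (simp add: weighted_count_def F_def insert_absorb mult_ac)
      also have "\<dots> = (\<integral>x. (\<lambda>y. \<rho> (y v) / B (y v)) x * B (x v) \<partial>cube {v})"
        using v pr by (intro split2) (auto intro: pos_weight_component[of v "{v}" "\<lambda>t. \<rho> t / B t"])
      also have "\<dots> = (\<integral>x. \<rho> (x v) \<partial>cube {v})"
        using pos_weight_pos[OF B] by (intro Bochner_Integration.integral_cong) (force simp: space_PiM)+
      also have "\<dots> = 1"
        using PP.product_integral_singleton[of \<rho> v] \<rho> integral_\<rho> by (simp add: pos_weight_measurable)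
      finally have "exp (\<Sum>u\<in>V\<^sub>2. mean_log (w' u)) \<le> 1"
        using 2 w' unfolding good_def by metis
      also have "(\<Sum>u\<in>V\<^sub>2. mean_log (w' u)) = mean_log \<rho> - mean_log B + (\<Sum>u\<in>?W. mean_log (w u))"
        using fin v by (subst sum.remove[of _ v]) (auto simp: w'_def mean_log_divide \<rho> B intro!: sum.cong)
      finally show ?thesis using mean_log_\<rho>_nonneg by simp
    qed
    define w' where "w' = w(v := (\<lambda>t. w v t * B t))"
    have w': "\<forall>u\<in>V\<^sub>1. pos_weight M (w' u)" using w B v by (auto simp: w'_def intro: pos_weight_mult)
    let ?G = "\<lambda>x. (\<Prod>e\<in>E\<^sub>1. edge_val K x e) * (\<Prod>u\<in>V\<^sub>1. w u (x u))"
    have G: "pos_weight (cube V\<^sub>1) ?G"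
      using w by (intro pos_weight_mult pos_weight_prod pos_weight_graph sg pos_weight_component) auto
    have G_restrict: "?G (restrict x V\<^sub>1) = ?G x" for x
      using sg(1) by (auto simp: edge_val_restrict cong: prod.cong intro!: arg_cong2[of _ _ _ _ "(*)"] prod.cong)
    have Vun: "V\<^sub>1 \<union> V\<^sub>2 = V\<^sub>1 \<union> ?W" using v by auto
    have "(\<Sum>u\<in>V\<^sub>1 \<union> V\<^sub>2. mean_log (w u)) = (\<Sum>u\<in>V\<^sub>1. mean_log (w u)) + (\<Sum>u\<in>?W. mean_log (w u))"
      unfolding Vun using fin V by (intro sum.union_disjoint) auto
    also have "\<dots> \<le> (\<Sum>u\<in>V\<^sub>1. mean_log (w u)) + mean_log B" using mean_B by simp
    also have "\<dots> = (\<Sum>u\<in>V\<^sub>1. mean_log (w' u))"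
      using fin v w B by (subst (1 2) sum.remove[of _ v]) (auto simp: w'_def mean_log_mult intro!: sum.cong)
    finally have "exp (\<Sum>u\<in>V\<^sub>1 \<union> V\<^sub>2. mean_log (w u)) \<le> exp (\<Sum>u\<in>V\<^sub>1. mean_log (w' u))" by simp
    also have "\<dots> \<le> weighted_count w' V\<^sub>1 E\<^sub>1" using 1 w' unfolding good_def by blast
    also have "\<dots> = (\<integral>x. ?G x * B (x v) \<partial>cube V\<^sub>1)"
    proof -
      have "(\<Prod>u\<in>V\<^sub>1. w' u (x u)) = (\<Prod>u\<in>V\<^sub>1. w u (x u)) * B (x v)" for x
      proof -
        have "(\<Prod>u\<in>V\<^sub>1 - {v}. w' u (x u)) = (\<Prod>u\<in>V\<^sub>1 - {v}. w u (x u))"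
          by (intro prod.cong) (auto simp: w'_def)
        then show ?thesis using fin v by (simp add: prod.remove[of _ v] w'_def)
      qed
      then show ?thesis by (simp add: weighted_count_def mult.assoc)
    qed
    also have "\<dots> = (\<integral>x. ?G (restrict x V\<^sub>1) * F x \<partial>cube (V\<^sub>1 \<union> V\<^sub>2))"
      by (rule split2[symmetric]) (use fin V G in auto)
    also have "\<dots> = weighted_count w (V\<^sub>1 \<union> V\<^sub>2) (E\<^sub>1 \<union> E\<^sub>2)"
    proof -
      have "(\<Prod>e\<in>E\<^sub>1 \<union> E\<^sub>2. edge_val K x e) = (\<Prod>e\<in>E\<^sub>1. edge_val K x e) * (\<Prod>e\<in>E\<^sub>2. edge_val K x e)" for x
        using finE Edisj by (rule prod.union_disjoint)
      moreover have "(\<Prod>u\<in>V\<^sub>1 \<union> V\<^sub>2. w u (x u)) = (\<Prod>u\<in>V\<^sub>1. w u (x u)) * (\<Prod>u\<in>?W. w u (x u))" for x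
        unfolding Vun using fin V by (intro prod.union_disjoint) auto
      ultimately show ?thesis
        unfolding weighted_count_def G_restrict F_def by (simp only: mult_ac)
    qed
    finally show "exp (\<Sum>u\<in>V\<^sub>1 \<union> V\<^sub>2. mean_log (w u)) \<le> weighted_count w (V\<^sub>1 \<union> V\<^sub>2) (E\<^sub>1 \<union> E\<^sub>2)" .
  qed
qed

end

section \<open>The inequality for positive kernels\<close>

lemma (in factored_density) bicyclic_good:
  assumes "bicyclic V E" shows "good V E"
proof -
  interpret glue_closed good
    by unfold_locales (auto intro: good_theta good_glue)
  show ?thesis by (rule bicyclic_member[OF assms])
qed

lemma prod_edges_vertices:
  fixes F :: "'v \<Rightarrow> real"
  assumes "simple_graph V E"
  shows "(\<Prod>e\<in>E. \<Prod>v\<in>e. F v) = (\<Prod>v\<in>V. F v ^ card {e\<in>E. v \<in> e})"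
proof -
  have fin: "finite V" "finite E" using assms simple_graph_finite_edges by (auto simp: simple_graph_def)
  have "(\<Prod>e\<in>E. \<Prod>v\<in>e. F v) = (\<Prod>e\<in>E. \<Prod>v\<in>V. if v \<in> e then F v else 1)"
    using assms fin by (intro prod.cong refl prod.mono_neutral_cong_left) (auto simp: simple_graph_def)
  also have "\<dots> = (\<Prod>v\<in>V. \<Prod>e\<in>E. if v \<in> e then F v else 1)"
    by (rule prod.swap)
  also have "\<dots> = (\<Prod>v\<in>V. F v ^ card {e\<in>E. v \<in> e})"
    using fin by (intro prod.cong) (simp_all add: prod.inter_filter[symmetric])
  finally show ?thesis .
qed

lemma sum_degrees:
  assumes "simple_graph V E"
  shows "(\<Sum>v\<in>V. card {e\<in>E. v \<in> e}) = 2 * card E"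
proof -
  have fin: "finite V" "finite E" using assms simple_graph_finite_edges by (auto simp: simple_graph_def)
  have "(\<Sum>v\<in>V. card {e\<in>E. v \<in> e}) = (\<Sum>v\<in>V. \<Sum>e\<in>E. if v \<in> e then 1 else 0)"
    using fin by (intro sum.cong) (simp_all add: sum.inter_filter[symmetric])
  also have "\<dots> = (\<Sum>e\<in>E. \<Sum>v\<in>V. if v \<in> e then 1 else 0)"
    by (rule sum.swap)
  also have "\<dots> = (\<Sum>e\<in>E. card e)"
    using assms fin by (intro sum.cong refl) (auto simp: simple_graph_def sum.inter_filter[symmetric] Collect_conj_eq Int_absorb1 Int_absorb2 intro!: arg_cong[of _ _ card])
  also have "\<dots> = 2 * card E"
    using assms by (simp add: simple_graph_def)
  finally show ?thesis .
qed

text \<open>The density is \<open>F(x) g(x, y) F(y)\<close>, normalised. Its use at the edges puts a factor \<open>F\<close> on a vertex for each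
  edge there, which the weights \<open>f v / F ^ deg v\<close> compensate. The exponent in the definition of \<open>F\<close> is the one for which
  the product of these weights is one.\<close>

lemma positive_inequality:
  fixes M :: "real measure" and V :: "'v set"
  assumes M: "prob_space M" and N: "prob_space N" and g: "pos_weight (M \<Otimes>\<^sub>M M) g"
    and g_sym: "\<And>x y. x \<in> space M \<Longrightarrow> y \<in> space M \<Longrightarrow> g (x, y) = g (y, x)"
    and h: "bounded_measurable (M \<Otimes>\<^sub>M N) h"
    and g_factor: "AE p in M \<Otimes>\<^sub>M M. g p = (\<integral>z. h (fst p, z) * h (snd p, z) \<partial>N)"
    and VE: "bicyclic V E" and f: "\<And>v. v \<in> V \<Longrightarrow> pos_weight M (f v)"
  defines "F \<equiv> \<lambda>t. (\<Prod>v\<in>V. f v t) powr (1 / (2 * real (card E)))"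
  shows "(\<integral>p. F (fst p) * g p * F (snd p) \<partial>(M \<Otimes>\<^sub>M M)) ^ card E
    \<le> (\<integral>x. (\<Prod>e\<in>E. edge_val g x e) * (\<Prod>v\<in>V. f v (x v)) \<partial>PiM V (\<lambda>_. M))"
proof -
  interpret prob_space M by fact
  interpret P: pair_prob_space M M ..
  have sg: "simple_graph V E" using VE by (auto simp: bicyclic_def connected_graph_def)
  have fin: "finite V" "finite E" using sg simple_graph_finite_edges by (auto simp: simple_graph_def)
  have E: "card E > 0" using VE by (auto simp: bicyclic_def)
  have F: "pos_weight M F"
    unfolding F_def using f by (intro pos_weight_powr pos_weight_prod) auto
  define Kr where "Kr p = F (fst p) * g p * F (snd p)" for p
  have Kr: "pos_weight (M \<Otimes>\<^sub>M M) Kr"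
    unfolding Kr_def by (intro pos_weight_mult g pos_weight_comp[OF F] measurable_fst measurable_snd)
  define Z where "Z = integral\<^sup>L (M \<Otimes>\<^sub>M M) Kr"
  have Z: "Z > 0" unfolding Z_def by (rule P.pos_weight_integral_pos[OF Kr])
  define K where "K p = Kr p * (1 / Z)" for p
  define h' where "h' q = F (fst q) * h q * (1 / sqrt Z)" for q
  interpret factored_density M N K h'
  proof (intro factored_density.intro factored_density_axioms.intro M N)
    show "pos_weight (M \<Otimes>\<^sub>M M) K"
      unfolding K_def using Z by (intro pos_weight_mult Kr pos_weight_const) auto
    show "K (x, y) = K (y, x)" if "x \<in> space M" "y \<in> space M" for x y
      using g_sym[OF that] by (simp add: K_def Kr_def)
    show "(\<integral>p. K p \<partial>(M \<Otimes>\<^sub>M M)) = 1"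
      using Z unfolding K_def by (simp add: Z_def)
    show "bounded_measurable (M \<Otimes>\<^sub>M N) h'"
      unfolding h'_def using Z
      by (intro bounded_measurable_mult h pos_weight_bounded[OF pos_weight_comp[OF F measurable_fst]] pos_weight_bounded[OF pos_weight_const]) auto
    show "AE p in M \<Otimes>\<^sub>M M. K p = (\<integral>z. h' (fst p, z) * h' (snd p, z) \<partial>N)"
      using g_factor
    proof eventually_elim
      case (elim p)
      have "(\<integral>z. h' (fst p, z) * h' (snd p, z) \<partial>N)
        = (\<integral>z. (F (fst p) * F (snd p) * (1 / Z)) * (h (fst p, z) * h (snd p, z)) \<partial>N)"
        using Z by (intro Bochner_Integration.integral_cong) (auto simp: h'_def field_simps)
      also have "\<dots> = K p" by (simp add: K_def Kr_def elim)
      finally show ?case by simp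
    qed
  qed
  define d where "d v = card {e\<in>E. v \<in> e}" for v
  define w where "w v t = f v t / F t ^ d v" for v t
  have w: "pos_weight M (w v)" if "v \<in> V" for v
    unfolding w_def using that by (intro pos_weight_divide pos_weight_power F f)
  have "(\<Sum>v\<in>V. mean_log (w v)) = mean_log (\<lambda>t. \<Prod>v\<in>V. w v t)"
    by (rule mean_log_prod[symmetric]) (rule w)
  also have "\<dots> = mean_log (\<lambda>t. 1)"
  proof (rule mean_log_cong)
    fix t assume t: "t \<in> space M"
    have p: "(\<Prod>v\<in>V. f v t) > 0" using pos_weight_pos[OF f t] by (intro prod_pos) auto
    have "(\<Prod>v\<in>V. F t ^ d v) = F t ^ (2 * card E)"
      using sum_degrees[OF sg] by (simp add: power_sum[symmetric] d_def)
    also have "\<dots> = (\<Prod>v\<in>V. f v t)"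
      using p E by (simp add: F_def powr_powr powr_realpow[symmetric])
    finally show "(\<Prod>v\<in>V. w v t) = 1" using p by (simp add: w_def prod_dividef)
  qed
  finally have zero: "(\<Sum>v\<in>V. mean_log (w v)) = 0" by (simp add: mean_log_one)
  have "exp (\<Sum>v\<in>V. mean_log (w v)) \<le> weighted_count w V E"
    using bicyclic_good[OF VE] w unfolding good_def by blast
  then have "1 \<le> weighted_count w V E" by (simp add: zero)
  also have "weighted_count w V E = (\<integral>x. (1 / Z ^ card E) * ((\<Prod>e\<in>E. edge_val g x e) * (\<Prod>v\<in>V. f v (x v))) \<partial>cube V)"
    unfolding weighted_count_def
  proof (rule Bochner_Integration.integral_cong[OF refl])
    fix x assume x: "x \<in> space (cube V)"
    have Fp: "F (x v) > 0" if "v \<in> V" for v using pos_weight_pos[OF F cube_component[OF x that]] .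
    have "edge_val K x e = edge_val g x e * (\<Prod>v\<in>e. F (x v)) / Z" if "e \<in> E" for e
    proof -
      from sg that obtain u v where e: "e = {u, v}" "u \<noteq> v" "u \<in> V" "v \<in> V"
        by (auto simp: simple_graph_def card_2_iff)
      have "edge_val g x {u, v} = g (x u, x v)"
        by (intro edge_val_eq g_sym cube_component[OF x] e)
      then show ?thesis using e x by (simp add: edge_val_K K_def Kr_def)
    qed
    then have "(\<Prod>e\<in>E. edge_val K x e) = (\<Prod>e\<in>E. edge_val g x e) * (\<Prod>v\<in>V. F (x v) ^ d v) / Z ^ card E"
      by (simp add: prod.distrib prod_dividef prod_edges_vertices[OF sg] d_def)
    moreover have "(\<Prod>v\<in>V. w v (x v)) = (\<Prod>v\<in>V. f v (x v)) / (\<Prod>v\<in>V. F (x v) ^ d v)"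
      by (simp add: w_def prod_dividef)
    moreover have "(\<Prod>v\<in>V. F (x v) ^ d v) > 0" using Fp by (intro prod_pos) auto
    ultimately show "(\<Prod>e\<in>E. edge_val K x e) * (\<Prod>v\<in>V. w v (x v)) =
       (1 / Z ^ card E) * ((\<Prod>e\<in>E. edge_val g x e) * (\<Prod>v\<in>V. f v (x v)))"
      by (simp add: field_simps)
  qed
  finally show ?thesis
    using Z unfolding Z_def[symmetric] Kr_def[symmetric] by (simp add: field_simps)
qed

section \<open>Passage to nonnegative kernels on the unit interval\<close>

lemma (in complete_measure) measurable_AE_eq:
  assumes f': "f' \<in> borel_measurable M" and eq: "AE x in M. f x = f' x"
  shows "f \<in> borel_measurable M"
proof (rule measurableI)
  fix S :: "'b set" assume S: "S \<in> sets borel"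
  show "f -` S \<inter> space M \<in> sets M"
  proof (rule in_sets_AE)
    show "AE x in M. x \<in> f' -` S \<inter> space M \<longleftrightarrow> x \<in> f -` S \<inter> space M"
      using eq by eventually_elim auto
  qed (use measurable_sets[OF f' S] in auto)
qed simp

lemma integral_completion_AE:
  fixes f f' :: "'b \<Rightarrow> real"
  assumes "f' \<in> borel_measurable M" "AE x in M. f x = f' x"
  shows "integral\<^sup>L (completion M) f = integral\<^sup>L M f'"
proof -
  have ae: "AE x in completion M. f x = f' x" using assms(2) by (rule AE_completion)
  have f': "f' \<in> borel_measurable (completion M)" using assms(1) by (rule measurable_completion)
  have "integral\<^sup>L (completion M) f = integral\<^sup>L (completion M) f'"
    by (rule integral_cong_AE[OF completion.measurable_AE_eq[OF f' ae] f' ae])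
  then show ?thesis using assms(1) by (simp add: integral_completion)
qed

lemma complete_unit_interval: "complete_measure unit_interval"
proof
  fix A B assume "B \<subseteq> A" "A \<in> null_sets unit_interval"
  then have "B \<subseteq> {0..1}" "B \<in> null_sets lebesgue"
    by (auto simp: unit_interval_def null_sets_restrict_space intro: null_sets_completion_subset)
  then have "B \<in> null_sets unit_interval"
    by (auto simp: unit_interval_def null_sets_restrict_space)
  then show "B \<in> sets unit_interval" by auto
qed

lemma space_unit_interval [simp]: "space unit_interval = {0..1}"
  by (simp add: unit_interval_def)

lemma prob_unit_interval: "prob_space unit_interval"
  by (rule prob_spaceI) (simp add: unit_interval_def emeasure_restrict_space)

text \<open>Two different coordinates of the product are jointly distributed as the square of the measure.\<close>

lemma AE_pair_of_coordinates:
  assumes M: "prob_space M" and V: "finite V" "u \<in> V" "v \<in> V" "u \<noteq> v"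
    and P: "AE p in M \<Otimes>\<^sub>M M. P p"
  shows "AE x in PiM V (\<lambda>_. M). P (x u, x v)"
proof -
  interpret prob_space M by fact
  interpret PP: product_prob_space "\<lambda>_. M" ..
  obtain A where A: "A \<in> sets (M \<Otimes>\<^sub>M M)" "emeasure (M \<Otimes>\<^sub>M M) A = 0" "{p \<in> space (M \<Otimes>\<^sub>M M). \<not> P p} \<subseteq> A"
    using P by (rule AE_E) blast
  have "(\<integral>\<^sup>+x. indicator A (x u, x v) \<partial>PiM {u, v} (\<lambda>_. M)) = (\<integral>\<^sup>+p. indicator A (fst p, snd p) \<partial>(M \<Otimes>\<^sub>M M))"
    using A by (intro PP.product_nn_integral_pair V) simp
  also have "\<dots> = 0" using A by simp
  finally have "AE x in PiM {u, v} (\<lambda>_. M). indicator A (x u, x v) = (0 :: ennreal)"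
    using A(1) by (subst (asm) nn_integral_0_iff_AE) auto
  then have ae: "AE x in PiM {u, v} (\<lambda>_. M). (x u, x v) \<notin> A"
    by eventually_elim (simp add: indicator_eq_0_iff)
  have "AE x in distr (PiM V (\<lambda>_. M)) (PiM {u, v} (\<lambda>_. M)) (\<lambda>f. restrict f {u, v}). (x u, x v) \<notin> A"
    by (subst PP.distr_restrict[symmetric]) (use V ae in auto)
  then have "AE x in PiM V (\<lambda>_. M). (restrict x {u, v} u, restrict x {u, v} v) \<notin> A"
    by (rule AE_distrD[rotated]) (use V in \<open>auto intro: measurable_restrict_subset\<close>)
  then show ?thesis
  proof (rule AE_mp, intro AE_I2 impI)
    fix x assume x: "x \<in> space (PiM V (\<lambda>_. M))" and "(restrict x {u, v} u, restrict x {u, v} v) \<notin> A"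
    then have "(x u, x v) \<notin> A" by simp
    moreover have "(x u, x v) \<in> space (M \<Otimes>\<^sub>M M)" using x V by (auto simp: space_PiM space_pair_measure)
    ultimately show "P (x u, x v)" using A(3) by auto
  qed
qed

lemma AE_pair_of_fst:
  assumes "prob_space M" "AE x in M. P x" shows "AE p in M \<Otimes>\<^sub>M M. P (fst p)"
proof -
  interpret prob_space M by fact
  obtain A where "A \<in> null_sets M" "{x \<in> space M. \<not> P x} \<subseteq> A"
    using assms(2) unfolding eventually_ae_filter by blast
  then show ?thesis
    by (intro AE_I'[of "A \<times> space M"] times_in_null_sets1) (auto simp: space_pair_measure)
qed

lemma AE_pair_of_snd:
  assumes "prob_space M" "AE x in M. P x" shows "AE p in M \<Otimes>\<^sub>M M. P (snd p)"
proof -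
  interpret prob_space M by fact
  obtain A where "A \<in> null_sets M" "{x \<in> space M. \<not> P x} \<subseteq> A"
    using assms(2) unfolding eventually_ae_filter by blast
  then show ?thesis
    by (intro AE_I'[of "space M \<times> A"] times_in_null_sets2) (auto simp: space_pair_measure)
qed

text \<open>A version of \<open>g\<close> that is measurable for the uncompleted product. First \<open>h\<close> is replaced by a bounded measurable version,
  whose Gram kernel is then truncated at \<open>0\<close>; so the result is symmetric and nonnegative everywhere.\<close>

lemma doubly_nonnegative_version:
  assumes "doubly_nonnegative g"
  obtains g' h' where "bounded_measurable (unit_interval \<Otimes>\<^sub>M unit_interval) g'"
    "\<And>x y. 0 \<le> g' (x, y)"
    "\<And>x y. g' (x, y) = g' (y, x)"
    "AE p in unit_interval \<Otimes>\<^sub>M unit_interval. g p = g' p"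
    "bounded_measurable (unit_interval \<Otimes>\<^sub>M unit_interval) h'"
    "AE p in unit_interval \<Otimes>\<^sub>M unit_interval. g' p = (\<integral>z. h' (fst p, z) * h' (snd p, z) \<partial>unit_interval)"
proof -
  let ?U = unit_interval let ?P = "?U \<Otimes>\<^sub>M ?U"
  interpret U: prob_space ?U by (rule prob_unit_interval)
  interpret P: pair_prob_space ?U ?U ..
  obtain h where g_pos: "\<And>x y. x \<in> {0..1} \<Longrightarrow> y \<in> {0..1} \<Longrightarrow> 0 \<le> g (x, y)"
    and h: "bounded_measurable (completion ?P) h"
    and gh: "AE p in ?P. g p = (\<integral>z. h (fst p, z) * h (snd p, z) \<partial>?U)"
    using assms[unfolded doubly_nonnegative_def unit_square_def AE_completion_iff split_beta'] by auto
  obtain C where C: "C > 0" "\<And>p. p \<in> space ?P \<Longrightarrow> \<bar>h p\<bar> \<le> C"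
    using h by (rule bounded_measurableE) (unfold space_completion, blast)
  obtain h0 where h0: "h0 \<in> borel_measurable ?P" "AE p in ?P. h p = h0 p"
    using completion_ex_borel_measurable_real[OF bounded_measurable_measurable[OF h]] by blast
  define h' where "h' p = max (- C) (min C (h0 p))" for p
  have h': "bounded_measurable ?P h'"
    by (rule bounded_measurableI[of _ _ C]) (use h0 C in \<open>auto simp: h'_def[abs_def]\<close>)
  have hh': "AE p in ?P. h p = h' p"
    using h0(2)
  proof (rule AE_mp, intro AE_I2 impI)
    fix p assume "p \<in> space ?P" "h p = h0 p"
    with C(2)[of p] show "h p = h' p" by (auto simp: h'_def)
  qed
  define S where "S p = (\<integral>z. h' (fst p, z) * h' (snd p, z) \<partial>?U)" for p
  have "bounded_measurable (?P \<Otimes>\<^sub>M ?U) (\<lambda>q. h' (fst (fst q), snd q))"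
    "bounded_measurable (?P \<Otimes>\<^sub>M ?U) (\<lambda>q. h' (snd (fst q), snd q))"
    by (auto intro: bounded_measurable_comp[OF h'])
  from U.bounded_measurable_integral[OF bounded_measurable_mult[OF this]]
  have S: "bounded_measurable ?P S" by (simp add: S_def[abs_def])
  have gS: "AE p in ?P. g p = S p"
  proof -
    \<comment> \<open>The sections of \<open>h\<close> at almost every point are measurable because Lebesgue measure is complete.\<close>
    have "AE x in ?U. AE z in ?U. h (x, z) = h' (x, z)" using P.AE_pair[OF hh'] by simp
    then have "AE p in ?P. (AE z in ?U. h (fst p, z) = h' (fst p, z)) \<and> (AE z in ?U. h (snd p, z) = h' (snd p, z))"
      by (intro AE_conjI AE_pair_of_fst AE_pair_of_snd prob_unit_interval)
    with gh show ?thesis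
    proof (rule AE_mp[OF AE_conjI], intro AE_I2 impI)
      fix p assume p: "p \<in> space ?P"
        and "g p = (\<integral>z. h (fst p, z) * h (snd p, z) \<partial>?U) \<and>
          ((AE z in ?U. h (fst p, z) = h' (fst p, z)) \<and> (AE z in ?U. h (snd p, z) = h' (snd p, z)))"
      then have *: "g p = (\<integral>z. h (fst p, z) * h (snd p, z) \<partial>?U)"
        "AE z in ?U. h (fst p, z) = h' (fst p, z)" "AE z in ?U. h (snd p, z) = h' (snd p, z)" by auto
      have ae: "AE z in ?U. h (fst p, z) * h (snd p, z) = h' (fst p, z) * h' (snd p, z)"
        using *(2,3) by eventually_elim simp
      have m: "(\<lambda>z. h' (fst p, z) * h' (snd p, z)) \<in> borel_measurable ?U"
        using p by (intro bounded_measurable_measurable bounded_measurable_mult bounded_measurable_comp[OF h'])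
          (auto simp: space_pair_measure)
      show "g p = S p"
        unfolding *(1) S_def
        by (rule integral_cong_AE[OF complete_measure.measurable_AE_eq[OF complete_unit_interval m ae] m ae])
    qed
  qed
  define g' where "g' p = max 0 (S p)" for p
  have gg': "AE p in ?P. g p = g' p"
    using gS
  proof (rule AE_mp, intro AE_I2 impI)
    fix p assume "p \<in> space ?P" "g p = S p"
    with g_pos[of "fst p" "snd p"] show "g p = g' p" by (auto simp: g'_def space_pair_measure)
  qed
  obtain D where D: "D > 0" "\<And>p. p \<in> space ?P \<Longrightarrow> \<bar>S p\<bar> \<le> D"
    using S by (rule bounded_measurableE) blast
  show ?thesis
  proof (rule that)
    show "bounded_measurable ?P g'"
      by (rule bounded_measurableI[of _ _ D])
         (use S D in \<open>auto simp: g'_def[abs_def] abs_le_iff intro!: borel_measurable_max bounded_measurable_measurable\<close>)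
    show "0 \<le> g' (x, y)" for x y by (simp add: g'_def)
    show "g' (x, y) = g' (y, x)" for x y by (simp add: g'_def S_def mult.commute)
    show "AE p in ?P. g p = g' p" by (rule gg')
    show "bounded_measurable ?P h'" by (rule h')
    show "AE p in ?P. g' p = (\<integral>z. h' (fst p, z) * h' (snd p, z) \<partial>?U)"
      using gS gg' by eventually_elim (simp add: S_def)
  qed
qed

text \<open>The constant is a Gram kernel in one additional dimension. The fair coin makes room for that dimension
  while keeping a probability measure, at the price of a factor \<open>sqrt 2\<close>.\<close>

lemma factor_add_constant:
  assumes M: "prob_space M" and N: "prob_space N" and h: "bounded_measurable (M \<Otimes>\<^sub>M N) h" and \<epsilon>: "\<epsilon> \<ge> 0"
    and g: "AE p in M \<Otimes>\<^sub>M M. g p = (\<integral>z. h (fst p, z) * h (snd p, z) \<partial>N)"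
  shows "\<exists>h'. bounded_measurable (M \<Otimes>\<^sub>M (measure_pmf (bernoulli_pmf (1/2)) \<Otimes>\<^sub>M N)) h' \<and>
    (AE p in M \<Otimes>\<^sub>M M. g p + \<epsilon> = (\<integral>z. h' (fst p, z) * h' (snd p, z) \<partial>(measure_pmf (bernoulli_pmf (1/2)) \<Otimes>\<^sub>M N)))"
proof -
  let ?B = "measure_pmf (bernoulli_pmf (1/2))"
  interpret prob_space M by fact
  interpret N: prob_space N by fact
  interpret B: prob_space ?B by (rule prob_space_measure_pmf)
  interpret BN: pair_prob_space ?B N ..
  define h' where "h' q = sqrt 2 * (if fst (snd q) then h (fst q, snd (snd q)) else sqrt \<epsilon>)" for q :: "_ \<times> bool \<times> _"
  have h': "bounded_measurable (M \<Otimes>\<^sub>M (?B \<Otimes>\<^sub>M N)) h'"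
  proof -
    obtain C where C: "C > 0" "\<And>p. p \<in> space (M \<Otimes>\<^sub>M N) \<Longrightarrow> \<bar>h p\<bar> \<le> C"
      using h by (rule bounded_measurableE) blast
    have [measurable]: "h \<in> borel_measurable (M \<Otimes>\<^sub>M N)" using h by simp
    show ?thesis
    proof (rule bounded_measurableI[of _ _ "sqrt 2 * (C + sqrt \<epsilon>)"])
      show "h' \<in> borel_measurable (M \<Otimes>\<^sub>M (?B \<Otimes>\<^sub>M N))"
        unfolding h'_def[abs_def] by measurable
      fix q assume "q \<in> space (M \<Otimes>\<^sub>M (?B \<Otimes>\<^sub>M N))"
      then have "\<bar>h (fst q, snd (snd q))\<bar> \<le> C" by (intro C) (auto simp: space_pair_measure)
      then show "\<bar>h' q\<bar> \<le> sqrt 2 * (C + sqrt \<epsilon>)"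
        using C(1) \<epsilon> real_sqrt_ge_zero[OF \<epsilon>] unfolding h'_def abs_mult by (intro mult_mono) (auto intro: add_increasing2)
    qed
  qed
  have "AE p in M \<Otimes>\<^sub>M M. g p + \<epsilon> = (\<integral>z. h' (fst p, z) * h' (snd p, z) \<partial>(?B \<Otimes>\<^sub>M N))"
    using g
  proof (rule AE_mp, intro AE_I2 impI)
    fix p assume p: "p \<in> space (M \<Otimes>\<^sub>M M)" and eq: "g p = (\<integral>z. h (fst p, z) * h (snd p, z) \<partial>N)"
    have "bounded_measurable (?B \<Otimes>\<^sub>M N) (\<lambda>z. h' (fst p, z) * h' (snd p, z))"
      using p by (intro bounded_measurable_mult bounded_measurable_comp[OF h']) (auto simp: space_pair_measure)
    then have "(\<integral>z. h' (fst p, z) * h' (snd p, z) \<partial>(?B \<Otimes>\<^sub>M N))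
      = (\<integral>b. (\<integral>z. h' (fst p, (b, z)) * h' (snd p, (b, z)) \<partial>N) \<partial>?B)"
      by (subst BN.integral_fst'[symmetric]) (auto intro: BN.bounded_integrable)
    also have "\<dots> = (\<integral>z. h (fst p, z) * h (snd p, z) \<partial>N) + \<epsilon>"
    proof -
      have 1: "h' (fst p, (True, z)) * h' (snd p, (True, z)) = 2 * (h (fst p, z) * h (snd p, z))" for z
        by (simp add: h'_def)
      have "h' (fst p, (False, z)) * h' (snd p, (False, z)) = (sqrt 2)\<^sup>2 * (sqrt \<epsilon>)\<^sup>2" for z
        unfolding h'_def power2_eq_square by (simp only: fst_conv snd_conv if_False mult_ac)
      then have 2: "h' (fst p, (False, z)) * h' (snd p, (False, z)) = 2 * \<epsilon>" for z
        using \<epsilon> by simp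
      show ?thesis
        by (subst integral_bernoulli_pmf) (simp_all add: 1 2 N.prob_space)
    qed
    finally show "g p + \<epsilon> = (\<integral>z. h' (fst p, z) * h' (snd p, z) \<partial>(?B \<Otimes>\<^sub>M N))"
      by (simp add: eq)
  qed
  with h' show ?thesis by blast
qed

text \<open>Adding \<open>\<epsilon>\<close> to the kernel and to the weights makes everything positive. The lower bound only grows, and the
  graph integral converges as \<open>\<epsilon>\<close> tends to \<open>0\<close>.\<close>

lemma nonneg_inequality:
  fixes M :: "real measure" and V :: "'v set"
  assumes M: "prob_space M" and g: "bounded_measurable (M \<Otimes>\<^sub>M M) g"
    and g_sym: "\<And>x y. g (x, y) = g (y, x)" and g_pos: "\<And>x y. 0 \<le> g (x, y)"
    and h: "bounded_measurable (M \<Otimes>\<^sub>M M) h"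
    and g_factor: "AE p in M \<Otimes>\<^sub>M M. g p = (\<integral>z. h (fst p, z) * h (snd p, z) \<partial>M)"
    and VE: "bicyclic V E" and f: "\<And>v. v \<in> V \<Longrightarrow> bounded_measurable M (f v)"
    and f_pos: "\<And>v x. v \<in> V \<Longrightarrow> x \<in> space M \<Longrightarrow> 0 \<le> f v x"
  defines "F \<equiv> \<lambda>t. (\<Prod>v\<in>V. f v t) powr (1 / (2 * real (card E)))"
  shows "(\<integral>p. F (fst p) * g p * F (snd p) \<partial>(M \<Otimes>\<^sub>M M)) ^ card E
    \<le> (\<integral>x. (\<Prod>e\<in>E. edge_val g x e) * (\<Prod>v\<in>V. f v (x v)) \<partial>PiM V (\<lambda>_. M))"
proof -
  interpret prob_space M by fact
  interpret P: pair_prob_space M M ..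
  interpret PV: prob_space "PiM V (\<lambda>_. M)" by (intro prob_space_PiM M)
  have sg: "simple_graph V E" using VE by (auto simp: bicyclic_def connected_graph_def)
  have fin: "finite V" "finite E" using sg simple_graph_finite_edges by (auto simp: simple_graph_def)
  have E: "\<And>e. e \<in> E \<Longrightarrow> card e = 2 \<and> e \<subseteq> V" using sg by (auto simp: simple_graph_def)
  define ge where "ge \<epsilon> p = g p + \<epsilon>" for \<epsilon> p
  define fe where "fe \<epsilon> v t = f v t + \<epsilon>" for \<epsilon> v t
  define Fe where "Fe \<epsilon> t = (\<Prod>v\<in>V. fe \<epsilon> v t) powr (1 / (2 * real (card E)))" for \<epsilon> t
  define I where "I \<epsilon> x = (\<Prod>e\<in>E. edge_val (ge \<epsilon>) x e) * (\<Prod>v\<in>V. fe \<epsilon> v (x v))" for \<epsilon> x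
  have pw: "pos_weight X (\<lambda>x. u x + \<epsilon>)"
    if "bounded_measurable X u" "\<And>x. x \<in> space X \<Longrightarrow> 0 \<le> u x" "\<epsilon> > 0" for X :: "'x measure" and u \<epsilon>
  proof -
    note u = that
    obtain C where "\<And>x. x \<in> space X \<Longrightarrow> \<bar>u x\<bar> \<le> C" using u(1) by (rule bounded_measurableE) blast
    then show ?thesis
      using u by (intro pos_weightI[of _ _ \<epsilon> "C + \<epsilon>"]) (auto simp: abs_le_iff)
  qed
  have ge: "pos_weight (M \<Otimes>\<^sub>M M) (ge \<epsilon>)" if "\<epsilon> > 0" for \<epsilon>
    unfolding ge_def[abs_def] using g_pos that by (intro pw g) (auto simp: space_pair_measure)
  have fe: "pos_weight M (fe \<epsilon> v)" if "\<epsilon> > 0" "v \<in> V" for \<epsilon> v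
    unfolding fe_def[abs_def] using f_pos that by (intro pw f) auto
  have Fe: "pos_weight M (Fe \<epsilon>)" if "\<epsilon> > 0" for \<epsilon>
    unfolding Fe_def[abs_def] using that by (intro pos_weight_powr pos_weight_prod fe) auto
  have positive: "(\<integral>p. Fe \<epsilon> (fst p) * ge \<epsilon> p * Fe \<epsilon> (snd p) \<partial>(M \<Otimes>\<^sub>M M)) ^ card E \<le> integral\<^sup>L (PiM V (\<lambda>_. M)) (I \<epsilon>)"
    if \<epsilon>: "\<epsilon> > 0" for \<epsilon>
  proof -
    let ?N = "measure_pmf (bernoulli_pmf (1/2)) \<Otimes>\<^sub>M M"
    interpret BN: pair_prob_space "measure_pmf (bernoulli_pmf (1/2))" M
      by (intro pair_prob_space.intro pair_sigma_finite.intro prob_space_measure_pmf M prob_space_imp_sigma_finite)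
    obtain h' where "bounded_measurable (M \<Otimes>\<^sub>M ?N) h'"
      "AE p in M \<Otimes>\<^sub>M M. g p + \<epsilon> = (\<integral>z. h' (fst p, z) * h' (snd p, z) \<partial>?N)"
      using factor_add_constant[OF M M h less_imp_le[OF \<epsilon>] g_factor] by blast
    from positive_inequality[OF M BN.prob_space_axioms ge[OF \<epsilon>] _ this(1) _ VE fe[OF \<epsilon>]] this(2)
    show ?thesis unfolding Fe_def[abs_def] I_def[abs_def] by (simp add: ge_def g_sym)
  qed
  have F0: "0 \<le> F t" for t by (simp add: F_def)
  have F_le: "F t \<le> Fe \<epsilon> t" if "\<epsilon> > 0" "t \<in> space M" for \<epsilon> t
    unfolding F_def Fe_def fe_def using that f_pos
    by (intro powr_mono2 prod_mono prod_nonneg) auto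
  have F_meas: "F \<in> borel_measurable M"
    unfolding F_def using f by measurable
  have lower: "(\<integral>p. F (fst p) * g p * F (snd p) \<partial>(M \<Otimes>\<^sub>M M)) ^ card E \<le> integral\<^sup>L (PiM V (\<lambda>_. M)) (I \<epsilon>)"
    if \<epsilon>: "\<epsilon> > 0" for \<epsilon>
  proof (rule order_trans[OF power_mono positive[OF \<epsilon>]])
    have i: "integrable (M \<Otimes>\<^sub>M M) (\<lambda>p. Fe \<epsilon> (fst p) * ge \<epsilon> p * Fe \<epsilon> (snd p))"
      by (intro P.pos_weight_integrable pos_weight_mult ge[OF \<epsilon>] pos_weight_comp[OF Fe[OF \<epsilon>]] measurable_fst measurable_snd)
    have le: "F (fst p) * g p * F (snd p) \<le> Fe \<epsilon> (fst p) * ge \<epsilon> p * Fe \<epsilon> (snd p)" if "p \<in> space (M \<Otimes>\<^sub>M M)" for p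
    proof -
      have s: "fst p \<in> space M" "snd p \<in> space M" using that by (auto simp: space_pair_measure)
      have "0 \<le> Fe \<epsilon> (fst p)" "0 \<le> Fe \<epsilon> (snd p)" by (simp_all add: Fe_def)
      then show ?thesis
        using F_le[OF \<epsilon> s(1)] F_le[OF \<epsilon> s(2)] F0 g_pos[of "fst p" "snd p"] \<epsilon>
        by (intro mult_mono) (auto simp: ge_def)
    qed
    have nn: "0 \<le> F (fst p) * g p * F (snd p)" for p
      using F0 g_pos[of "fst p" "snd p"] by simp
    show "(\<integral>p. F (fst p) * g p * F (snd p) \<partial>(M \<Otimes>\<^sub>M M)) \<le> (\<integral>p. Fe \<epsilon> (fst p) * ge \<epsilon> p * Fe \<epsilon> (snd p) \<partial>(M \<Otimes>\<^sub>M M))"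
      by (rule integral_mono'[OF i le]) (use nn in \<open>auto intro: order_trans[OF nn le]\<close>)
    show "0 \<le> (\<integral>p. F (fst p) * g p * F (snd p) \<partial>(M \<Otimes>\<^sub>M M))" using nn by simp
  qed
  let ?\<epsilon> = "\<lambda>n. 1 / real (Suc n)"
  have I_meas: "pos_weight (PiM V (\<lambda>_. M)) (I \<epsilon>)" if \<epsilon>: "\<epsilon> > 0" for \<epsilon>
    unfolding I_def[abs_def]
  proof (intro pos_weight_mult pos_weight_prod)
    fix v assume "v \<in> V" then show "pos_weight (PiM V (\<lambda>_. M)) (\<lambda>x. fe \<epsilon> v (x v))"
      by (intro pos_weight_comp[OF fe[OF \<epsilon>]]) auto
  next
    fix e assume e: "e \<in> E"
    obtain u v where uv: "e = {u, v}" using E[OF e] by (auto simp: card_2_iff)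
    have "edge_val (ge \<epsilon>) x e = ge \<epsilon> (x u, x v)" for x
      unfolding uv by (rule edge_val_eq) (simp add: ge_def g_sym)
    then show "pos_weight (PiM V (\<lambda>_. M)) (\<lambda>x. edge_val (ge \<epsilon>) x e)"
      using E[OF e] uv by (simp add: pos_weight_comp[OF ge[OF \<epsilon>]])
  qed
  have lim_\<epsilon>: "?\<epsilon> \<longlonglongrightarrow> 0" using LIMSEQ_Suc[OF lim_1_over_n] by simp
  have lim: "(\<lambda>n. I (?\<epsilon> n) x) \<longlonglongrightarrow> I 0 x" if x: "x \<in> space (PiM V (\<lambda>_. M))" for x
    unfolding I_def
  proof (intro tendsto_mult tendsto_prod)
    fix e assume "e \<in> E"
    then obtain p where "\<And>g. edge_val g x e = g p" using E edge_val_at_pair[OF _ _ x] by metis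
    then show "(\<lambda>n. edge_val (ge (?\<epsilon> n)) x e) \<longlonglongrightarrow> edge_val (ge 0) x e"
      using tendsto_add[OF tendsto_const lim_\<epsilon>, of "g p"] by (simp add: ge_def)
  next
    fix v assume "v \<in> V"
    show "(\<lambda>n. fe (?\<epsilon> n) v (x v)) \<longlonglongrightarrow> fe 0 v (x v)"
      using tendsto_add[OF tendsto_const lim_\<epsilon>, of "f v (x v)"] by (simp add: fe_def)
  qed
  have bound: "0 \<le> I \<epsilon> x \<and> I \<epsilon> x \<le> I 1 x" if x: "x \<in> space (PiM V (\<lambda>_. M))" and \<epsilon>: "0 \<le> \<epsilon>" "\<epsilon> \<le> 1" for x \<epsilon>
  proof -
    have 1: "0 \<le> edge_val (ge \<epsilon>) x e \<and> edge_val (ge \<epsilon>) x e \<le> edge_val (ge 1) x e" if e: "e \<in> E" for e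
    proof -
      obtain p where "\<And>g. edge_val g x e = g p" using E[OF e] edge_val_at_pair[OF _ _ x] by metis
      then show ?thesis using g_pos[of "fst p" "snd p"] \<epsilon> by (simp add: ge_def)
    qed
    have 2: "0 \<le> fe \<epsilon> v (x v) \<and> fe \<epsilon> v (x v) \<le> fe 1 v (x v)" if "v \<in> V" for v
    proof -
      have "x v \<in> space M" using x that by (auto simp: space_PiM)
      then show ?thesis using f_pos[OF that, of "x v"] \<epsilon> by (simp add: fe_def)
    qed
    show ?thesis
      unfolding I_def
    proof (intro conjI mult_nonneg_nonneg mult_mono prod_mono prod_nonneg 1[THEN conjunct1] 2[THEN conjunct1])
      show "0 \<le> edge_val (ge 1) x e" if "e \<in> E" for e using 1[OF that] by linarith
    qed (use 1 2 in blast)+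
  qed
  have I0_meas: "I 0 \<in> borel_measurable (PiM V (\<lambda>_. M))"
    by (rule borel_measurable_LIMSEQ_real[OF lim]) (use I_meas in auto)
  have "(\<lambda>n. integral\<^sup>L (PiM V (\<lambda>_. M)) (I (?\<epsilon> n))) \<longlonglongrightarrow> integral\<^sup>L (PiM V (\<lambda>_. M)) (I 0)"
  proof (rule integral_dominated_convergence[of _ _ _ "I 1"])
    show "AE x in PiM V (\<lambda>_. M). (\<lambda>n. I (?\<epsilon> n) x) \<longlonglongrightarrow> I 0 x" by (rule AE_I2[OF lim])
    show "AE x in PiM V (\<lambda>_. M). norm (I (?\<epsilon> n) x) \<le> I 1 x" for n
      using bound[of _ "?\<epsilon> n"] by (intro AE_I2) auto
    show "integrable (PiM V (\<lambda>_. M)) (I 1)" by (rule PV.pos_weight_integrable[OF I_meas]) simp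
  qed (use I_meas I0_meas in auto)
  then have "(\<integral>p. F (fst p) * g p * F (snd p) \<partial>(M \<Otimes>\<^sub>M M)) ^ card E \<le> integral\<^sup>L (PiM V (\<lambda>_. M)) (I 0)"
    by (rule LIMSEQ_le_const) (use lower in auto)
  then show ?thesis by (simp add: I_def[abs_def] ge_def[abs_def] fe_def)
qed

theorem corollary6p7:
  fixes V :: "'a set" and E :: "'a set set"
  assumes "bicyclic V E"
  shows "extra_good V E"
proof -
  let ?U = unit_interval
  have sg: "simple_graph V E" using assms by (auto simp: bicyclic_def connected_graph_def)
  have E: "E \<noteq> {}" using assms by (auto simp: bicyclic_def)
  have fin: "finite V" "finite E" using sg simple_graph_finite_edges by (auto simp: simple_graph_def)
  interpret prob_space ?U by (rule prob_unit_interval)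
  show ?thesis
    unfolding extra_good_def Let_def
  proof (intro conjI sg E allI impI)
    fix g :: "real \<times> real \<Rightarrow> real" and f :: "'a \<Rightarrow> real \<Rightarrow> real"
    assume g: "doubly_nonnegative g"
      and f: "\<forall>v\<in>V. bounded_measurable ?U (f v) \<and> (\<forall>t\<in>{0..1}. 0 \<le> f v t)"
    obtain g' h where g': "bounded_measurable (?U \<Otimes>\<^sub>M ?U) g'" "\<And>x y. 0 \<le> g' (x, y)"
      "\<And>x y. g' (x, y) = g' (y, x)" "AE p in ?U \<Otimes>\<^sub>M ?U. g p = g' p"
      "bounded_measurable (?U \<Otimes>\<^sub>M ?U) h"
      "AE p in ?U \<Otimes>\<^sub>M ?U. g' p = (\<integral>z. h (fst p, z) * h (snd p, z) \<partial>?U)"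
      using doubly_nonnegative_version[OF g] by blast
    define F where "F = (\<lambda>t. (\<Prod>v\<in>V. f v t) powr (1 / (2 * real (card E))))"
    have g_sym: "g (x, y) = g (y, x)" if "x \<in> {0..1}" "y \<in> {0..1}" for x y
      using g that by (auto simp: doubly_nonnegative_def)
    have fm [measurable]: "f v \<in> borel_measurable ?U" if "v \<in> V" for v using f that by auto
    have gm [measurable]: "g' \<in> borel_measurable (?U \<Otimes>\<^sub>M ?U)" using g'(1) by simp
    have Fm [measurable]: "F \<in> borel_measurable ?U" unfolding F_def by measurable
    have right: "(\<integral>(x, y). F x * g (x, y) * F y \<partial>unit_square)
        = (\<integral>p. F (fst p) * g' p * F (snd p) \<partial>(?U \<Otimes>\<^sub>M ?U))"
      unfolding unit_square_def
    proof (rule integral_completion_AE)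
      show "AE p in ?U \<Otimes>\<^sub>M ?U. (case p of (x, y) \<Rightarrow> F x * g (x, y) * F y) = F (fst p) * g' p * F (snd p)"
        using g'(4) by eventually_elim (simp add: split_beta')
    qed measurable
    have left: "(\<integral>x. (\<Prod>e\<in>E. edge_val g x e) * (\<Prod>v\<in>V. f v (x v)) \<partial>unit_cube V)
        = (\<integral>x. (\<Prod>e\<in>E. edge_val g' x e) * (\<Prod>v\<in>V. f v (x v)) \<partial>PiM V (\<lambda>_. ?U))"
      unfolding unit_cube_def
    proof (rule integral_completion_AE)
      have edges: "\<exists>u v. e = {u, v} \<and> u \<in> V \<and> v \<in> V \<and> u \<noteq> v" if "e \<in> E" for e
      proof -
        have "e \<subseteq> V" "card e = 2" using sg that by (auto simp: simple_graph_def)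
        then show ?thesis unfolding card_2_iff by blast
      qed
      have "(\<lambda>x. edge_val g' x e) \<in> borel_measurable (PiM V (\<lambda>_. ?U))" if e: "e \<in> E" for e
      proof -
        obtain u v where uv: "e = {u, v}" "u \<in> V" "v \<in> V" using edges[OF e] by blast
        have "edge_val g' x e = g' (x u, x v)" for x
          unfolding uv by (rule edge_val_eq) (simp add: g'(3))
        then show ?thesis using uv by simp
      qed
      moreover have "(\<lambda>x. f v (x v)) \<in> borel_measurable (PiM V (\<lambda>_. ?U))" if "v \<in> V" for v
        by (rule measurable_compose[OF measurable_component_singleton[OF that] fm[OF that]])
      ultimately show "(\<lambda>x. (\<Prod>e\<in>E. edge_val g' x e) * (\<Prod>v\<in>V. f v (x v))) \<in> borel_measurable (PiM V (\<lambda>_. ?U))"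
        by (intro borel_measurable_times borel_measurable_prod)
      have "AE x in PiM V (\<lambda>_. ?U). \<forall>e\<in>E. edge_val g x e = edge_val g' x e"
      proof (rule AE_finite_allI[OF fin(2)])
        fix e assume e: "e \<in> E"
        obtain u v where uv: "e = {u, v}" "u \<in> V" "v \<in> V" "u \<noteq> v" using edges[OF e] by blast
        have "AE x in PiM V (\<lambda>_. ?U). g (x u, x v) = g' (x u, x v)"
          by (rule AE_pair_of_coordinates[OF prob_unit_interval fin(1) uv(2-4) g'(4)])
        then show "AE x in PiM V (\<lambda>_. ?U). edge_val g x e = edge_val g' x e"
        proof (rule AE_mp, intro AE_I2 impI)
          fix x assume "x \<in> space (PiM V (\<lambda>_. ?U))" and eq: "g (x u, x v) = g' (x u, x v)"
          then have "x u \<in> {0..1}" "x v \<in> {0..1}" using uv by (auto simp: space_PiM)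
          then have "edge_val g x e = g (x u, x v)"
            unfolding uv(1) by (intro edge_val_eq g_sym)
          moreover have "edge_val g' x e = g' (x u, x v)"
            unfolding uv(1) by (rule edge_val_eq) (simp add: g'(3))
          ultimately show "edge_val g x e = edge_val g' x e" using eq by simp
        qed
      qed
      then show "AE x in PiM V (\<lambda>_. ?U). (\<Prod>e\<in>E. edge_val g x e) * (\<Prod>v\<in>V. f v (x v))
          = (\<Prod>e\<in>E. edge_val g' x e) * (\<Prod>v\<in>V. f v (x v))"
        by eventually_elim (simp cong: prod.cong)
    qed
    have "(\<integral>p. F (fst p) * g' p * F (snd p) \<partial>(?U \<Otimes>\<^sub>M ?U)) ^ card E
      \<le> (\<integral>x. (\<Prod>e\<in>E. edge_val g' x e) * (\<Prod>v\<in>V. f v (x v)) \<partial>PiM V (\<lambda>_. ?U))"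
      unfolding F_def by (rule nonneg_inequality[OF prob_unit_interval g'(1,3,2,5,6) assms]) (use f in auto)
    then show "(\<integral>x. (\<Prod>e\<in>E. edge_val g x e) * (\<Prod>v\<in>V. f v (x v)) \<partial>unit_cube V)
       \<ge> (\<integral>(x, y). (\<Prod>v\<in>V. f v x) powr (1 / (2 * real (card E))) * g (x, y) *
             (\<Prod>v\<in>V. f v y) powr (1 / (2 * real (card E))) \<partial>unit_square) ^ card E"
      using left right unfolding F_def by simp
  qed
qed

end
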